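(* Let $(\Gamma_h)_{h>0}$ be a family of isoradial graphs, and suppose there exist constants $c_p,c_d>0$ such that for all $h>0$ $$c_p h\le \inf_{e\in E_h}|e| \qquad\text{and}\qquad c_d h\le \inf_{e^*\in E_h^*}|e^*| .$$ Let $p^h$ be the discrete heat kernel of $\Gamma_h$, extended to $\mathbb{C}\times\mathbb{C}$ by projection to the closest vertex. Then for all $\beta\in(0,1)$ and $\tau>0$, $$\lim_{h\to 0} -2\left(h^\beta\tau\right)\log p^h_{h^\beta\tau}(x,y)=|x-y|^2$$ uniformly for $(x,y)$ in compact subsets of $\mathbb{C}\times\mathbb{C}$.
   Context: For each $h>0$, $\Gamma_h$ is an infinite planar graph embedded in $\mathbb{C}$ with straight edges, with vertex set $V_h$, edge set $E_h$ and face set $F_h$; it is locally finite (bounded sets contain finitely many vertices) and its (bounded, polygonal) faces tile the plane. $v\sim u$ means $\{v,u\}\in E_h$. $\Gamma_h$ is isoradial: each face $f\in F_h$ is inscribed in a circle of diameter $h$ whose center $m_f$ lies inside $f$. The dual graph $\Gamma_h^*$ has vertex set $V_h^*=\{m_f: f\in F_h\}$, with $m_f,m_g$ joined by a straight edge iff $f,g$ are adjacent; $E_h^*$ is its edge set. For $e\in E_h$, $e^*\in E_h^*$ is the dual edge joining the circumcenters of the two faces sharing $e$. $|e|,|e^*|$ denote Euclidean lengths. For $u\in V_h$, the dual face $D_u$ of $u$ is the polygon containing $u$ bounded by the dual edges $e^*$ of the edges $e$ incident to $u$; $A_u$ is its area. Edge weights: $\omega_{uv}=|e^*|/|e|$ for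 $e=\{u,v\}\in E_h$. Vertex weights: $m_u=\sum_{z\sim u}\omega_{uz}$. The geometric graph Laplacian is $(\Delta_h f)(u)=\frac1{A_u}\sum_{v\sim u}\omega_{uv}(f(v)-f(u))$ for $f:V_h\to\mathbb{C}$. $X^h=(X^h_t)_{t\ge0}$ is the continuous-time random walk on $V_h$ with generator $\frac12\Delta_h$: it stays at $u$ for an exponential time of rate $\frac{m_u}{2A_u}$ and then jumps to $v\sim u$ with probability $\omega_{uv}/m_u$. $\mathbb{P}_u$ is its law when started at $u$. The discrete heat kernel is $p^h_t(u,v)=\mathbb{P}_u[X^h_t=v]/A_v$ for $u,v\in V_h$, $t\ge0$. For $x,y\in\mathbb{C}$, $p^h_t(x,y):=p^h_t(\pi_{V_h}(x),\pi_{V_h}(y))$, where $\pi_{V_h}$ maps a point to a closest vertex in Euclidean distance (with some fixed choice in case of ties). *)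

theory Defs
  imports "HOL-Analysis.Analysis" "HOL-Probability.Probability"
begin

text \<open>
  A graph drawn in the plane with straight edges is a set \<open>V\<close> of points together with a set
  \<open>E\<close> of two-element subsets of \<open>V\<close>; the edge \<open>{u, v}\<close> is drawn as its convex hull, so that
  its Euclidean length is \<open>diameter {u, v}\<close>.
\<close>

definition plane_graph :: "complex set \<Rightarrow> complex set set \<Rightarrow> bool" where
  "plane_graph V E \<longleftrightarrow>
     (\<forall>e\<in>E. e \<subseteq> V \<and> card e = 2) \<and>
     (\<forall>e\<in>E. convex hull e \<inter> V \<subseteq> e) \<and>
     (\<forall>e\<in>E. \<forall>e'\<in>E. e \<noteq> e' \<longrightarrow> convex hull e \<inter> convex hull e' \<subseteq> e \<inter> e')"

definition neighbours :: "complex set set \<Rightarrow> complex \<Rightarrow> complex set" where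
  "neighbours E u = {v. {u, v} \<in> E}"

definition graph_faces :: "complex set \<Rightarrow> complex set set \<Rightarrow> complex set set" where
  "graph_faces V E = components (- (V \<union> (\<Union>e\<in>E. convex hull e)))"

text \<open>
  Faces are open sets. A bounded face is a polygon if its frontier is a cycle of the graph; as the
  vertices of the cycle are distinct and edges do not cross, the cycle is a simple closed curve.
\<close>

definition polygonal_face :: "complex set set \<Rightarrow> complex set \<Rightarrow> bool" where
  "polygonal_face E f \<longleftrightarrow> bounded f \<and>
     (\<exists>vs. 3 \<le> length vs \<and> distinct vs \<and>
        (\<forall>i<length vs. {vs ! i, vs ! (Suc i mod length vs)} \<in> E) \<and>
        frontier f = (\<Union>i<length vs. closed_segment (vs ! i) (vs ! (Suc i mod length vs))))"

definition face_vertices :: "complex set \<Rightarrow> complex set \<Rightarrow> complex set" where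
  "face_vertices V f = V \<inter> frontier f"

definition isoradial_graph :: "real \<Rightarrow> complex set \<Rightarrow> complex set set \<Rightarrow> bool" where
  "isoradial_graph h V E \<longleftrightarrow>
     plane_graph V E \<and> infinite V \<and>
     (\<forall>B. bounded B \<longrightarrow> finite (V \<inter> B)) \<and>
     (\<forall>f\<in>graph_faces V E. polygonal_face E f) \<and>
     (\<Union>f\<in>graph_faces V E. closure f) = UNIV \<and>
     (\<forall>f\<in>graph_faces V E. \<exists>c\<in>f. face_vertices V f \<subseteq> sphere c (h / 2))"

text \<open>The centre is unique, since a polygonal face has at least three vertices.\<close>

definition circumcentre :: "complex set \<Rightarrow> complex set \<Rightarrow> complex" where
  "circumcentre V f = (THE c. \<exists>r. face_vertices V f \<subseteq> sphere c r)"

definition incident_faces :: "complex set \<Rightarrow> complex set set \<Rightarrow> complex set \<Rightarrow> complex set set" where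
  "incident_faces V E e = {f \<in> graph_faces V E. convex hull e \<subseteq> frontier f}"

definition dual_edges :: "complex set \<Rightarrow> complex set set \<Rightarrow> complex set set" where
  "dual_edges V E = {{circumcentre V f, circumcentre V g} | f g.
     f \<noteq> g \<and> (\<exists>e\<in>E. f \<in> incident_faces V E e \<and> g \<in> incident_faces V E e)}"

text \<open>In an isoradial graph every edge is incident to exactly two faces.\<close>

definition dual_edge :: "complex set \<Rightarrow> complex set set \<Rightarrow> complex set \<Rightarrow> complex set" where
  "dual_edge V E e = circumcentre V ` incident_faces V E e"

definition dual_face :: "complex set \<Rightarrow> complex set set \<Rightarrow> complex \<Rightarrow> complex set" where
  "dual_face V E u =
     connected_component_set (- (\<Union>e\<in>{e \<in> E. u \<in> e}. convex hull (dual_edge V E e))) u"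

definition vertex_area :: "complex set \<Rightarrow> complex set set \<Rightarrow> complex \<Rightarrow> real" where
  "vertex_area V E u = measure lebesgue (dual_face V E u)"

definition edge_weight :: "complex set \<Rightarrow> complex set set \<Rightarrow> complex \<Rightarrow> complex \<Rightarrow> real" where
  "edge_weight V E u v = diameter (dual_edge V E {u, v}) / diameter {u, v}"

definition vertex_weight :: "complex set \<Rightarrow> complex set set \<Rightarrow> complex \<Rightarrow> real" where
  "vertex_weight V E u = (\<Sum>z\<in>neighbours E u. edge_weight V E u z)"

definition jump_rate :: "complex set \<Rightarrow> complex set set \<Rightarrow> complex \<Rightarrow> real" where
  "jump_rate V E u = vertex_weight V E u / (2 * vertex_area V E u)"

definition jump_law :: "complex set \<Rightarrow> complex set set \<Rightarrow> complex \<Rightarrow> complex pmf" where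
  "jump_law V E u = embed_pmf
     (\<lambda>v. if v \<in> neighbours E u then edge_weight V E u v / vertex_weight V E u else 0)"

text \<open>
  The continuous-time random walk is built from independent pairs \<open>\<omega> (n, y)\<close>, one for every
  \<open>n :: nat\<close> and every vertex \<open>y\<close>, consisting of an exponential holding time of rate
  \<open>jump_rate V E y\<close> and an independent target distributed as \<open>jump_law V E y\<close>. If the walk is at
  \<open>y\<close> after \<open>n\<close> jumps, it stays there for time \<open>fst (\<omega> (n, y))\<close> and then jumps to
  \<open>snd (\<omega> (n, y))\<close>. Since every pair is used at most once, this is the Markov jump process with
  generator \<open>f \<mapsto> (\<lambda>u. (\<Sum>v\<in>neighbours E u. edge_weight V E u v * (f v - f u)) / (2 * vertex_area V E u))\<close>.
\<close>

definition walk_space ::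
  "complex set \<Rightarrow> complex set set \<Rightarrow> (nat \<times> complex \<Rightarrow> real \<times> complex) measure" where
  "walk_space V E = PiM (UNIV \<times> V) (\<lambda>(n, y).
     density lborel (exponential_density (jump_rate V E y)) \<Otimes>\<^sub>M measure_pmf (jump_law V E y))"

primrec jump_chain :: "complex \<Rightarrow> (nat \<times> complex \<Rightarrow> real \<times> complex) \<Rightarrow> nat \<Rightarrow> complex" where
  "jump_chain u \<omega> 0 = u"
| "jump_chain u \<omega> (Suc n) = snd (\<omega> (n, jump_chain u \<omega> n))"

definition jump_time :: "complex \<Rightarrow> (nat \<times> complex \<Rightarrow> real \<times> complex) \<Rightarrow> nat \<Rightarrow> real" where
  "jump_time u \<omega> n = (\<Sum>i<n. fst (\<omega> (i, jump_chain u \<omega> i)))"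

text \<open>
  At time \<open>t\<close> the walk sits at \<open>jump_chain u \<omega> n\<close> for the \<open>n\<close> with
  \<open>jump_time u \<omega> n \<le> t < jump_time u \<omega> (Suc n)\<close>. If infinitely many jumps occur up to time \<open>t\<close>
  there is no such \<open>n\<close> and the walk is sent to the cemetery \<open>None\<close>.
\<close>

definition walk ::
  "complex \<Rightarrow> real \<Rightarrow> (nat \<times> complex \<Rightarrow> real \<times> complex) \<Rightarrow> complex option" where
  "walk u t \<omega> =
     (if \<exists>n. t < jump_time u \<omega> (Suc n)
      then Some (jump_chain u \<omega> (LEAST n. t < jump_time u \<omega> (Suc n)))
      else None)"

definition heat_kernel ::
  "complex set \<Rightarrow> complex set set \<Rightarrow> real \<Rightarrow> complex \<Rightarrow> complex \<Rightarrow> real" where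
  "heat_kernel V E t u v =
     measure (walk_space V E) {\<omega> \<in> space (walk_space V E). walk u t \<omega> = Some v}
       / vertex_area V E v"

definition closest_vertex_map :: "complex set \<Rightarrow> (complex \<Rightarrow> complex) \<Rightarrow> bool" where
  "closest_vertex_map V p \<longleftrightarrow> (\<forall>x. p x \<in> V \<and> (\<forall>v\<in>V. dist x (p x) \<le> dist x v))"

end

theory Submission
  imports Defs "HOL-Real_Asymp.Real_Asymp"
begin

text \<open>
  Seen from a vertex \<open>u\<close>, every face at \<open>u\<close> lies to the left of exactly one edge at \<open>u\<close> and to the right
  of exactly one. If \<open>a\<close> and \<open>b\<close> are the circumcentres, relative to \<open>u\<close>, of the faces to the left and to the
  right of \<open>{u, z}\<close>, then \<open>z - u = a + b\<close> and \<open>a - b = \<i> * \<omega> * (z - u)\<close> with \<open>\<omega>\<close> the edge weight. Hence the sums of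
  \<open>\<omega> * (z - u)\<close> and of \<open>\<omega> * (z - u)\<^sup>2\<close> over the neighbours \<open>z\<close> telescope to \<open>0\<close>, while that of
  \<open>\<omega> * \<bar>z - u\<bar>\<^sup>2\<close> is four times the area of the dual face: the walk is a martingale with exactly the
  covariance of planar Brownian motion and with jumps bounded by \<open>h\<close>.

  The heat kernel is a Poisson mixture of powers of one averaging operator. Only errors that are
  negligible on the scale \<open>exp (- C / t)\<close> with \<open>t = h\<^sup>\<beta> * \<tau>\<close> matter, so powers of \<open>h\<close> may be neglected.
  The upper bound is a Chernoff bound. For the lower bound, tilting the kernel by \<open>exp (\<lambda> \<bullet> z)\<close> with
  \<open>\<lambda> = (v - u) / t\<close> and a second moment estimate lead the walk close to \<open>v\<close> at the correct
  exponential cost. Halving the remaining time repeatedly, it then gets within a bounded multiple of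
  \<open>h\<close> of \<open>v\<close> at a cost polynomial in \<open>1 / h\<close>, and it reaches \<open>v\<close> itself by walking greedily, which is
  possible because every vertex other than \<open>v\<close> has a neighbour that is closer to \<open>v\<close>.
\<close>

section \<open>Averaging operators of Markov kernels\<close>

text \<open>The walk is given only as a function on a product space that might explode, so its law
  has to be tied to a semigroup. The probabilities of exactly n jumps arise by iterating the
  first-jump equation; since all rates are at most \<open>Q\<close>, the remainder after n
  iterations is at most (Q t)^n / n!, which identifies the law with the Poisson mixture.

  The graph hypotheses provide no cyclic order of the neighbours of a vertex. The telescoping is
  therefore an exchange of two bijections from neighbours to the faces at the vertex.

  Because the first two moments of a step are exact at every vertex, exponential moments are bounded
  uniformly in the vertex, and no local limit theorem is involved. The exponent enters twice:
  \<beta> < 1 gives h / t \<rightarrow> 0, so that the tilt changes little over one jump and the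
  cost is Gaussian; 0 < \<beta> gives t ln (1 / h) \<rightarrow> 0, which removes all factors
  polynomial in 1 / h. The lower bound on edges controls the jump rates and the spacing of vertices,
  the one on dual edges keeps every single step probability away from 0.\<close>

locale markov_kernel =
  fixes V :: "'a set" and S :: "'a \<Rightarrow> 'a set" and p :: "'a \<Rightarrow> 'a \<Rightarrow> real"
  assumes S_subset: "u \<in> V \<Longrightarrow> S u \<subseteq> V"
    and p_nonneg: "u \<in> V \<Longrightarrow> z \<in> S u \<Longrightarrow> 0 \<le> p u z"
    and p_sum: "u \<in> V \<Longrightarrow> (\<Sum>z\<in>S u. p u z) = 1"
begin

definition avg :: "('a \<Rightarrow> real) \<Rightarrow> 'a \<Rightarrow> real" where
  "avg f u = (\<Sum>z\<in>S u. p u z * f z)"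

lemma avg_mono:
  assumes "\<And>z. z \<in> V \<Longrightarrow> f z \<le> g z" and "u \<in> V"
  shows "avg f u \<le> avg g u"
  unfolding avg_def using assms S_subset p_nonneg by (blast intro: sum_mono mult_left_mono)

lemma avg_affine: "u \<in> V \<Longrightarrow> avg (\<lambda>z. c * f z + b) u = c * avg f u + b"
  using p_sum[of u]
  by (simp add: avg_def ring_distribs sum.distrib mult.left_commute
      flip: sum_distrib_left sum_distrib_right)

lemma iter_mono:
  assumes "\<And>z. z \<in> V \<Longrightarrow> f z \<le> g z" and "u \<in> V"
  shows "(avg ^^ k) f u \<le> (avg ^^ k) g u"
  using assms(2)
proof (induction k arbitrary: u)
  case (Suc k)
  show ?case unfolding funpow.simps o_apply by (rule avg_mono[OF Suc.IH Suc.prems])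
qed (use assms in auto)

lemma iter_affine: "u \<in> V \<Longrightarrow> (avg ^^ k) (\<lambda>z. c * f z + b) u = c * (avg ^^ k) f u + b"
proof (induction k arbitrary: u)
  case (Suc k)
  have "avg ((avg ^^ k) (\<lambda>z. c * f z + b)) u = avg (\<lambda>z. c * (avg ^^ k) f z + b) u"
    using Suc by (intro order.antisym avg_mono) auto
  then show ?case using Suc.prems by (simp add: avg_affine)
qed simp

lemma iter_cmult: "u \<in> V \<Longrightarrow> (avg ^^ k) (\<lambda>z. c * f z) u = c * (avg ^^ k) f u"
  using iter_affine[of u k c f 0] by simp

lemma iter_const: "u \<in> V \<Longrightarrow> (avg ^^ k) (\<lambda>z. b) u = b"
  using iter_affine[of u k 0 _ b] by simp

lemma iter_bounds:
  assumes "\<And>z. z \<in> V \<Longrightarrow> a \<le> f z" "\<And>z. z \<in> V \<Longrightarrow> f z \<le> b" and "u \<in> V"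
  shows "a \<le> (avg ^^ k) f u" "(avg ^^ k) f u \<le> b"
  using iter_mono[of "\<lambda>_. a" f u k] iter_mono[of f "\<lambda>_. b" u k] iter_const[OF assms(3)] assms by auto

text \<open>One half of Chapman-Kolmogorov: only paths that are in \<open>B\<close> after
  \<open>k\<close> steps are kept. All lower bounds are assembled from this.\<close>

lemma iter_chain:
  assumes "\<And>w. w \<in> V \<Longrightarrow> w \<in> B \<Longrightarrow> c \<le> (avg ^^ l) f w" and "\<And>w. w \<in> V \<Longrightarrow> 0 \<le> f w"
    and "u \<in> V"
  shows "c * (avg ^^ k) (indicator B) u \<le> (avg ^^ (k + l)) f u"
proof -
  have "(avg ^^ k) (\<lambda>w. c * indicator B w) u \<le> (avg ^^ k) ((avg ^^ l) f) u"
  proof (rule iter_mono[OF _ assms(3)])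
    fix z assume z: "z \<in> V"
    have "0 \<le> (avg ^^ l) f z"
      using iter_mono[of "\<lambda>_. 0" f z l] iter_const[of z l 0] assms(2) z by simp
    then show "c * indicator B z \<le> (avg ^^ l) f z" using assms(1)[OF z] by (auto simp: indicator_def)
  qed
  then show ?thesis by (simp add: iter_cmult[OF assms(3)] funpow_add)
qed

end

section \<open>The law of the walk as an iterated integral\<close>

locale jump_walk =
  fixes V :: "complex set" and E :: "complex set set"
  assumes countable_V: "countable V"
    and rate_pos: "y \<in> V \<Longrightarrow> 0 < jump_rate V E y"
    and finite_support: "y \<in> V \<Longrightarrow> finite (set_pmf (jump_law V E y))"
    and support_subset: "y \<in> V \<Longrightarrow> set_pmf (jump_law V E y) \<subseteq> V"
begin

definition step_space :: "nat \<times> complex \<Rightarrow> (real \<times> complex) measure" where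
  "step_space = (\<lambda>(n, y).
     density lborel (exponential_density (jump_rate V E y)) \<Otimes>\<^sub>M measure_pmf (jump_law V E y))"

lemma sets_step_space [measurable_cong]:
  "sets (step_space i) = sets (borel \<Otimes>\<^sub>M count_space UNIV)"
  by (auto simp: step_space_def split_beta intro!: sets_pair_measure_cong)

lemma space_step_space [simp]: "space (step_space i) = UNIV"
  using sets_eq_imp_space_eq[OF sets_step_space, of i] by (simp add: space_pair_measure)

lemma walk_space_eq: "walk_space V E = PiM (UNIV \<times> V) step_space"
  by (simp add: walk_space_def step_space_def)

lemma prob_space_step_space:
  assumes "i \<in> UNIV \<times> V"
  shows "prob_space (step_space i)"
proof -
  obtain n y where i: "i = (n, y)" "y \<in> V" using assms by auto
  interpret a: prob_space "density lborel (exponential_density (jump_rate V E y))"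
    using rate_pos[OF i(2)] by (rule prob_space_exponential_density)
  interpret b: prob_space "measure_pmf (jump_law V E y)" by (rule prob_space_measure_pmf)
  interpret pair_prob_space "density lborel (exponential_density (jump_rate V E y))"
    "measure_pmf (jump_law V E y)" ..
  show ?thesis unfolding i step_space_def by (simp add: prob_space_axioms)
qed

lemma component_measurable:
  "i \<in> UNIV \<times> V \<Longrightarrow> (\<lambda>\<omega>. \<omega> i) \<in> measurable (walk_space V E) (borel \<Otimes>\<^sub>M count_space UNIV)"
  unfolding walk_space_eq
  by (subst measurable_cong_sets[OF refl sets_step_space[symmetric, of i]])
     (rule measurable_component_singleton)

text \<open>The coordinate that is read depends on the sample itself. Since \<open>V\<close> is
  countable, the claim reduces to fixed coordinates, one for each value of \<open>X\<close>.\<close>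

lemma chain_component_measurable:
  assumes X: "X \<in> measurable (walk_space V E) (count_space UNIV)"
  shows "(\<lambda>\<omega>. \<omega> (n, X \<omega>)) \<in> measurable (walk_space V E) (borel \<Otimes>\<^sub>M count_space UNIV)"
proof -
  \<comment> \<open>\<open>None\<close> collects the samples with \<open>X\<close> outside
    \<open>V\<close>; every point of the product space takes the value \<open>undefined\<close> at
    such an index.\<close>
  let ?g = "\<lambda>\<omega>. if X \<omega> \<in> V then Some (X \<omega>) else None"
  let ?f = "\<lambda>z \<omega>. case z of None \<Rightarrow> undefined | Some y \<Rightarrow> \<omega> (n, y)"
  have "(\<lambda>\<omega>. ?f (?g \<omega>) \<omega>) \<in> measurable (walk_space V E) (borel \<Otimes>\<^sub>M count_space UNIV)"
  proof (rule measurable_compose_countable'[where I = "insert None (Some ` V)"])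
    fix z assume "z \<in> insert None (Some ` V)"
    then show "?f z \<in> measurable (walk_space V E) (borel \<Otimes>\<^sub>M count_space UNIV)"
      by (cases z) (auto intro!: component_measurable simp: space_pair_measure)
  next
    have "(\<lambda>y. if y \<in> V then Some y else None) \<in>
        measurable (count_space UNIV) (count_space (insert None (Some ` V)))"
      by auto
    from measurable_compose[OF X this]
    show "?g \<in> measurable (walk_space V E) (count_space (insert None (Some ` V)))" .
  next
    show "countable (insert None (Some ` V))" using countable_V by auto
  qed
  also have "?this \<longleftrightarrow> ?thesis"
    by (intro measurable_cong)
       (auto simp: walk_space_eq space_PiM PiE_def extensional_def)
  finally show ?thesis .
qed

lemma jump_chain_measurable [measurable]:
  "(\<lambda>\<omega>. jump_chain u \<omega> n) \<in> measurable (walk_space V E) (count_space UNIV)"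
proof (induction n)
  case (Suc n)
  from measurable_compose[OF chain_component_measurable[OF Suc] measurable_snd]
  show ?case by simp
qed simp

lemma jump_time_measurable [measurable]:
  "(\<lambda>\<omega>. jump_time u \<omega> n) \<in> borel_measurable (walk_space V E)"
  unfolding jump_time_def
  by (intro borel_measurable_sum
      measurable_compose[OF chain_component_measurable[OF jump_chain_measurable] measurable_fst])

text \<open>Holding times are arbitrary reals on the sample space, so jump times need not increase.
  Demanding the bound for all \<open>m < n\<close> makes \<open>n\<close> exactly the least index
  chosen in \<open>walk\<close>, without discarding a null set.\<close>

definition stay_event :: "complex \<Rightarrow> nat \<Rightarrow> real \<Rightarrow> complex \<Rightarrow> (nat \<times> complex \<Rightarrow> real \<times> complex) set" where
  "stay_event v n t u = {\<omega> \<in> space (walk_space V E).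
     (\<forall>m<n. jump_time u \<omega> (Suc m) \<le> t) \<and> t < jump_time u \<omega> (Suc n) \<and> jump_chain u \<omega> n = v}"

lemma stay_event_sets [measurable]: "stay_event v n t u \<in> sets (walk_space V E)"
  unfolding stay_event_def by measurable

definition stay_prob :: "complex \<Rightarrow> nat \<Rightarrow> real \<Rightarrow> complex \<Rightarrow> ennreal" where
  "stay_prob v n t u = emeasure (walk_space V E) (stay_event v n t u)"

lemma prob_space_walk_space: "prob_space (walk_space V E)"
  unfolding walk_space_eq by (intro prob_space_PiM prob_space_step_space)

text \<open>The jump times and the jump chain are measurable in the sample, so the event is a
  section of a set measurable jointly in time and sample. Needed because the probability is later
  integrated over the first holding time.\<close>

lemma stay_prob_measurable: "(\<lambda>t. stay_prob v n t u) \<in> borel_measurable borel"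
proof -
  interpret prob_space "walk_space V E" by (rule prob_space_walk_space)
  let ?A = "{x \<in> space (borel \<Otimes>\<^sub>M walk_space V E).
    (\<forall>m<n. jump_time u (snd x) (Suc m) \<le> fst x) \<and> fst x < jump_time u (snd x) (Suc n) \<and>
    jump_chain u (snd x) n = v}"
  have "?A \<in> sets (borel \<Otimes>\<^sub>M walk_space V E)" by measurable
  from measurable_emeasure_Pair[OF this]
  show ?thesis
    unfolding stay_prob_def stay_event_def
    by (simp add: vimage_def space_pair_measure conj_commute)
qed

lemma walk_prob_eq:
  "emeasure (walk_space V E) {\<omega> \<in> space (walk_space V E). walk u t \<omega> = Some v} =
   (\<Sum>n. stay_prob v n t u)"
proof -
  have "{\<omega> \<in> space (walk_space V E). walk u t \<omega> = Some v} = (\<Union>n. stay_event v n t u)" (is "?L = ?R")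
  proof (intro set_eqI iffI)
    fix \<omega> assume \<omega>: "\<omega> \<in> ?L"
    let ?P = "\<lambda>n. t < jump_time u \<omega> (Suc n)"
    have ex: "\<exists>n. ?P n" using \<omega> by (auto simp: walk_def split: if_splits)
    let ?n = "LEAST n. ?P n"
    have "jump_chain u \<omega> ?n = v" using \<omega> ex by (auto simp: walk_def split: if_splits)
    moreover have "?P ?n" using ex by (rule LeastI_ex)
    moreover have "\<forall>m<?n. jump_time u \<omega> (Suc m) \<le> t" using not_less_Least[of _ ?P] not_less by blast
    ultimately show "\<omega> \<in> ?R" using \<omega> by (auto simp: stay_event_def)
  next
    fix \<omega> assume "\<omega> \<in> ?R"
    then obtain n where n: "\<omega> \<in> stay_event v n t u" by auto
    then have "(LEAST n. t < jump_time u \<omega> (Suc n)) = n"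
      by (intro Least_equality) (auto simp: stay_event_def not_less[symmetric])
    then show "\<omega> \<in> ?L" using n by (auto simp: stay_event_def walk_def)
  qed
  moreover have "disjoint_family (\<lambda>n. stay_event v n t u)"
  proof -
    have "stay_event v m t u \<inter> stay_event v n t u = {}" if "m < n" for m n
      using that by (auto simp: stay_event_def)
    then show ?thesis unfolding disjoint_family_on_def by (metis inf_commute linorder_neqE_nat)
  qed
  then have "(\<Sum>n. stay_prob v n t u) = emeasure (walk_space V E) (\<Union>n. stay_event v n t u)"
    unfolding stay_prob_def by (intro suminf_emeasure) auto
  ultimately show ?thesis by simp
qed

lemma stay_prob_0:
  assumes u: "u \<in> V" and t: "0 \<le> t"
  shows "stay_prob v 0 t u = ennreal (if u = v then exp (- jump_rate V E u * t) else 0)"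
proof (cases "u = v")
  case True
  interpret ex: prob_space "density lborel (exponential_density (jump_rate V E u))"
    using rate_pos[OF u] by (rule prob_space_exponential_density)
  have i: "(0, u) \<in> UNIV \<times> V" using u by auto
  have "stay_prob v 0 t u = emeasure (distr (walk_space V E) (step_space (0,u)) (\<lambda>\<omega>. \<omega> (0,u))) ({t<..} \<times> UNIV)"
    unfolding stay_prob_def stay_event_def using True component_measurable[OF i]
    by (subst emeasure_distr)
       (auto simp: jump_time_def vimage_def walk_space_eq[symmetric] sets_step_space mem_Times_iff
         measurable_cong_sets[OF refl sets_step_space] intro!: arg_cong[where f="emeasure _"])
  also have "distr (walk_space V E) (step_space (0,u)) (\<lambda>\<omega>. \<omega> (0,u)) = step_space (0,u)"
    unfolding walk_space_eq by (rule distr_PiM_component[OF prob_space_step_space i])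
  also have "emeasure (step_space (0,u)) ({t<..} \<times> UNIV) =
      emeasure (density lborel (exponential_density (jump_rate V E u))) {t<..}"
    unfolding step_space_def
    by (simp, subst measure_pmf.emeasure_pair_measure_Times) (auto simp: measure_pmf.emeasure_space_1[simplified])
  also have "\<dots> = ennreal (exp (- jump_rate V E u * t))"
  proof -
    have "distributed (density lborel (exponential_density (jump_rate V E u))) lborel (\<lambda>x. x)
       (exponential_density (jump_rate V E u))"
      unfolding distributed_def by (auto simp: distr_id2 exponential_density_nonneg rate_pos[OF u] intro!: less_imp_le)
    from ex.exponential_distributedD_gt[OF this t] show ?thesis
      using rate_pos[OF u] by (simp add: ex.emeasure_eq_measure greaterThan_def mult.commute)
  qed
  finally show ?thesis using True by simp
next
  case False
  then show ?thesis by (simp add: stay_prob_def stay_event_def)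
qed


text \<open>Only the pair at \<open>(0, u)\<close> is used at the first jump. The other pairs of
  generation 0 are never read again, so the remaining path is the walk driven by the generations
  from 1 on, renumbered by \<open>apfst Suc\<close>.\<close>

lemma jump_chain_shift:
  fixes X :: "nat \<times> complex \<Rightarrow> real \<times> complex" and s :: real and u w :: complex
  assumes X: "X \<in> extensional (UNIV \<times> V - {(0, u)})"
  defines "\<omega> \<equiv> X((0, u) := (s, w))" and "\<sigma> \<equiv> \<lambda>i\<in>UNIV \<times> V. X (apfst Suc i)"
  shows "jump_chain u \<omega> (Suc n) = jump_chain w \<sigma> n"
    and "jump_time u \<omega> (Suc n) = s + jump_time w \<sigma> n"
proof -
  \<comment> \<open>For \<open>y\<close> outside \<open>V\<close> both sides are
    \<open>undefined\<close>, so the identity needs no side condition.\<close>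
  have step: "\<omega> (Suc n, y) = \<sigma> (n, y)" for n y
    using X by (auto simp: \<omega>_def \<sigma>_def extensional_def)
  show chain: "jump_chain u \<omega> (Suc n) = jump_chain w \<sigma> n" for n
    by (induction n) (use step in \<open>auto simp: \<omega>_def\<close>)
  show "jump_time u \<omega> (Suc n) = s + jump_time w \<sigma> n"
    unfolding jump_time_def sum.lessThan_Suc_shift
    by (simp only: chain step) (simp add: \<omega>_def)
qed

text \<open>What remains after the first jump is again a walk, since the law of the pairs does not depend on \<open>n\<close>.\<close>

lemma stay_prob_Suc:
  assumes u: "u \<in> V" and t: "0 \<le> t"
  shows "stay_prob v (Suc n) t u =
    (\<integral>\<^sup>+s. ennreal (jump_rate V E u * exp (- jump_rate V E u * s)) * indicator {0..t} s *
       (\<Sum>w\<in>set_pmf (jump_law V E u). ennreal (pmf (jump_law V E u) w) * stay_prob v n (t - s) w) \<partial>lborel)"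
proof -
  let ?I = "UNIV \<times> V :: (nat \<times> complex) set" and ?W = "walk_space V E"
  let ?K = "?I - {(0, u)}" and ?q = "jump_rate V E u"
  let ?PK = "PiM ?K step_space" and ?M = "step_space (0, u)"
  let ?S = "\<lambda>X. \<lambda>i\<in>?I. X (apfst Suc i)"
  have ins: "insert (0, u) ?K = ?I" using u by auto
  interpret M: prob_space ?M by (rule prob_space_step_space) (use u in auto)
  interpret PK: prob_space ?PK by (rule prob_space_PiM, rule prob_space_step_space) auto
  \<comment> \<open>Independence: the coordinate \<open>(0, u)\<close> can be drawn separately from
    all others.\<close>
  have W1: "distr (?M \<Otimes>\<^sub>M ?PK) ?W (\<lambda>(x, X). X((0, u) := x)) = ?W"
    using distr_pair_PiM_eq_PiM[of ?K step_space "(0, u)"] prob_space_step_space u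
    unfolding ins walk_space_eq by auto
  have shift_law: "step_space (apfst Suc i) = step_space i" for i
    by (auto simp: step_space_def split_beta)
  \<comment> \<open>Renumbering is injective, misses \<open>(0, u)\<close> and preserves the factor
    laws, so the shifted sample again has the law of the full product.\<close>
  have "apfst Suc \<in> ?I \<rightarrow> ?K" by (auto simp: Pi_iff)
  then have W2: "distr ?PK ?W ?S = ?W"
    using distr_PiM_reindex[of ?K step_space "apfst Suc" ?I] prob_space_step_space
    by (auto simp: shift_law walk_space_eq inj_on_def)
  have meas1: "(\<lambda>(x, X). X((0, u) := x)) \<in> measurable (?M \<Otimes>\<^sub>M ?PK) ?W"
  proof -
    have "(\<lambda>z. (snd z)((0, u) := fst z)) \<in> measurable (?M \<Otimes>\<^sub>M ?PK) (PiM (insert (0, u) ?K) step_space)"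
      by measurable
    then show ?thesis unfolding ins walk_space_eq by (simp add: split_beta)
  qed
  have meas2: "?S \<in> measurable ?PK ?W"
    unfolding walk_space_eq
  proof (rule measurable_restrict)
    fix i :: "nat \<times> complex" assume "i \<in> ?I"
    then have "apfst Suc i \<in> ?K" by auto
    from measurable_component_singleton[OF this, of step_space]
    show "(\<lambda>X. X (apfst Suc i)) \<in> measurable ?PK (step_space i)" by (simp add: shift_law)
  qed
  let ?A = "(\<lambda>(x, X). X((0, u) := x)) -` stay_event v (Suc n) t u \<inter> space (?M \<Otimes>\<^sub>M ?PK)"
  have A: "?A \<in> sets (?M \<Otimes>\<^sub>M ?PK)" using meas1 by (rule measurable_sets) (rule stay_event_sets)
  \<comment> \<open>With the first pair fixed, the event for \<open>n + 1\<close> jumps becomes the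
    event for \<open>n\<close> jumps of the shifted walk with time \<open>t - s\<close> left, or is
    empty if \<open>s\<close> exceeds \<open>t\<close>.\<close>
  have slice: "emeasure ?PK (Pair x -` ?A) = indicator {..t} (fst x) * stay_prob v n (t - fst x) (snd x)" for x
  proof -
    obtain s w where x: "x = (s, w)" by force
    have "Pair x -` ?A = (if s \<le> t then ?S -` stay_event v n (t - s) w \<inter> space ?PK else {})"
    proof -
      have "X((0, u) := x) \<in> stay_event v (Suc n) t u \<longleftrightarrow> s \<le> t \<and> ?S X \<in> stay_event v n (t - s) w"
        if X: "X \<in> space ?PK" for X
      proof -
        have ext: "X \<in> extensional ?K" using X by (auto simp: space_PiM PiE_def)
        have sp: "X((0, u) := x) \<in> space ?W"
          using X u by (auto simp: walk_space_eq space_PiM PiE_def extensional_def)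
        have sp2: "?S X \<in> space ?W" by (auto simp: walk_space_eq space_PiM)
        have all: "(\<forall>m<Suc n. Q m) \<longleftrightarrow> Q 0 \<and> (\<forall>m<n. Q (Suc m))" for Q
          by (auto simp: less_Suc_eq_0_disj)
        show ?thesis
          using sp sp2 unfolding stay_event_def x mem_Collect_eq jump_chain_shift[OF ext] all
          by (auto simp: jump_time_def algebra_simps)
      qed
      then show ?thesis by (auto simp: space_pair_measure)
    qed
    moreover have "emeasure ?PK (?S -` stay_event v n (t - s) w \<inter> space ?PK) = stay_prob v n (t - s) w"
      using emeasure_distr[OF meas2 stay_event_sets] W2 unfolding stay_prob_def by metis
    ultimately show ?thesis by (simp add: x)
  qed
  have [measurable]: "(\<lambda>s. stay_prob v n (t - s) w) \<in> borel_measurable borel" for w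
    by (rule measurable_compose[OF _ stay_prob_measurable]) simp
  let ?D = "density lborel (exponential_density ?q)"
  let ?H = "\<lambda>x. emeasure ?PK (Pair x -` ?A)"
  have H: "?H \<in> borel_measurable ?M" using A by (rule PK.measurable_emeasure_Pair)
  have MD: "?M = ?D \<Otimes>\<^sub>M measure_pmf (jump_law V E u)" by (simp add: step_space_def)
  have "stay_prob v (Suc n) t u = emeasure (?M \<Otimes>\<^sub>M ?PK) ?A"
    using emeasure_distr[OF meas1 stay_event_sets] W1 unfolding stay_prob_def by metis
  also have "\<dots> = (\<integral>\<^sup>+x. ?H x \<partial>?M)"
    using A by (rule PK.emeasure_pair_measure_alt)
  also have "\<dots> = (\<integral>\<^sup>+s. \<integral>\<^sup>+w. ?H (s, w) \<partial>measure_pmf (jump_law V E u) \<partial>?D)"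
    using H unfolding MD by (rule measure_pmf.nn_integral_fst[symmetric])
  also have "\<dots> = (\<integral>\<^sup>+s. (\<Sum>w\<in>set_pmf (jump_law V E u). ennreal (pmf (jump_law V E u) w) *
      (indicator {..t} s * stay_prob v n (t - s) w)) \<partial>?D)"
    unfolding slice fst_conv snd_conv
    by (intro nn_integral_cong, subst nn_integral_measure_pmf_finite[OF finite_support[OF u]])
       (auto intro!: sum.cong simp: mult_ac)
  also have "\<dots> = (\<integral>\<^sup>+s. ennreal (exponential_density ?q s) *
     (\<Sum>w\<in>set_pmf (jump_law V E u). ennreal (pmf (jump_law V E u) w) *
      (indicator {..t} s * stay_prob v n (t - s) w)) \<partial>lborel)"
    by (subst nn_integral_density) auto
  also have "\<dots> = (\<integral>\<^sup>+s. ennreal (?q * exp (- ?q * s)) * indicator {0..t} s *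
       (\<Sum>w\<in>set_pmf (jump_law V E u). ennreal (pmf (jump_law V E u) w) * stay_prob v n (t - s) w) \<partial>lborel)"
    by (intro nn_integral_cong)
       (auto simp: exponential_density_def indicator_def mult_ac)
  finally show ?thesis .
qed

end

section \<open>Uniformization\<close>

text \<open>The clock of rate \<open>Q\<close> dominates all jump rates. \<open>avg_eq\<close> says
  that one tick acts as the identity plus the generator divided by \<open>Q\<close>: a tick at
  \<open>u\<close> is a true jump with probability \<open>jump_rate V E u / Q\<close>.\<close>

locale uniformized_walk = jump_walk V E + markov_kernel V S p
  for V :: "complex set" and E S p +
  fixes Q :: real
  assumes Q_pos: "0 < Q"
    and rate_le: "y \<in> V \<Longrightarrow> jump_rate V E y \<le> Q"
    and avg_eq: "u \<in> V \<Longrightarrow> avg f u = f u + jump_rate V E u / Q *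
      ((\<Sum>w\<in>set_pmf (jump_law V E u). pmf (jump_law V E u) w * f w) - f u)"
begin

text \<open>Exponential series of \<open>x\<close> times the averaging operator, applied to the
  indicator of \<open>v\<close>; multiplied by exp (- Q t) at x = Q t it becomes the semigroup of
  the generator.\<close>

definition unif_series :: "complex \<Rightarrow> complex \<Rightarrow> real \<Rightarrow> real" where
  "unif_series v u x = (\<Sum>k. (avg ^^ k) (indicator {v}) u / fact k * x ^ k)"

definition unif_prob :: "complex \<Rightarrow> real \<Rightarrow> complex \<Rightarrow> real" where
  "unif_prob v t u = exp (- Q * t) * unif_series v u (Q * t)"

lemma coeff_bounds:
  assumes "u \<in> V"
  shows "0 \<le> (avg ^^ k) (indicator {v}) u" "(avg ^^ k) (indicator {v}) u \<le> 1"
  by (rule iter_bounds[where a=0 and b=1 and f="indicator {v}", OF _ _ assms]; simp add: indicator_def)+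

lemma summable_bounded_exp:
  fixes c :: "nat \<Rightarrow> real"
  assumes "\<And>k. \<bar>c k\<bar> \<le> 1"
  shows "summable (\<lambda>k. c k / fact k * x ^ k)"
proof (rule summable_comparison_test)
  show "summable (\<lambda>k. \<bar>x\<bar> ^ k / fact k)" using summable_exp[of "\<bar>x\<bar>"] by (simp add: divide_inverse mult.commute)
  show "\<exists>N. \<forall>n\<ge>N. norm (c n / fact n * x ^ n) \<le> \<bar>x\<bar> ^ n / fact n"
    using mult_right_mono[OF assms] by (auto simp: abs_mult power_abs divide_simps intro!: exI[of _ 0])
qed

lemma summable_unif_series:
  assumes "u \<in> V"
  shows "summable (\<lambda>k. (avg ^^ k) (indicator {v}) u / fact k * x ^ k)"
    and "summable (\<lambda>k. (avg ^^ Suc k) (indicator {v}) u / fact k * x ^ k)"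
proof -
  have "\<bar>(avg ^^ k) (indicator {v}) u\<bar> \<le> 1" for k using coeff_bounds[OF assms, of k v] by simp
  then show "summable (\<lambda>k. (avg ^^ k) (indicator {v}) u / fact k * x ^ k)"
    and "summable (\<lambda>k. (avg ^^ Suc k) (indicator {v}) u / fact k * x ^ k)"
    by (rule summable_bounded_exp; blast)+
qed

lemma unif_series_nonneg: "u \<in> V \<Longrightarrow> 0 \<le> x \<Longrightarrow> 0 \<le> unif_series v u x"
  unfolding unif_series_def
  by (intro suminf_nonneg summable_unif_series) (simp_all add: coeff_bounds)

lemma unif_prob_nonneg: "u \<in> V \<Longrightarrow> 0 \<le> t \<Longrightarrow> 0 \<le> unif_prob v t u"
  using Q_pos by (simp add: unif_prob_def unif_series_nonneg)

text \<open>The generating function at \<open>r\<close> of a Poisson variable of mean Q t.\<close>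

lemma unif_prob_le:
  assumes f: "\<And>k. (avg ^^ k) (indicator {v}) u \<le> C * r ^ k" and u: "u \<in> V" and "0 \<le> t" "0 \<le> r"
  shows "unif_prob v t u \<le> C * exp ((r - 1) * Q * t)"
proof -
  have s: "(\<lambda>k. C * ((r * (Q * t)) ^ k /\<^sub>R fact k)) sums (C * exp (r * (Q * t)))"
    by (intro sums_mult exp_converges)
  have "unif_series v u (Q * t) \<le> C * exp (r * (Q * t))"
    unfolding unif_series_def sums_unique[OF s]
  proof (intro suminf_le summable_unif_series[OF u])
    show "(avg ^^ k) (indicator {v}) u / fact k * (Q * t) ^ k \<le> C * ((r * (Q * t)) ^ k /\<^sub>R fact k)" for k
      using mult_right_mono[OF f[of k], of "(Q * t) ^ k / fact k"] Q_pos assms(3)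
      by (simp add: field_simps power_mult_distrib)
  qed (use s in \<open>simp add: sums_iff\<close>)
  then have "unif_prob v t u \<le> exp (- Q * t) * (C * exp (r * (Q * t)))"
    unfolding unif_prob_def by (intro mult_left_mono) auto
  also have "\<dots> = C * exp ((r - 1) * Q * t)"
    by (simp add: algebra_simps flip: exp_add)
  finally show ?thesis .
qed

lemma unif_prob_le_1: "u \<in> V \<Longrightarrow> 0 \<le> t \<Longrightarrow> unif_prob v t u \<le> 1"
  using unif_prob_le[of v u 1 1 t] coeff_bounds by simp

text \<open>A single Poisson term suffices: at the mode its weight is only polynomially small in Q
  t.\<close>

lemma unif_prob_ge:
  assumes "u \<in> V" "0 \<le> t"
  shows "exp (- Q * t) * (Q * t) ^ k / fact k * (avg ^^ k) (indicator {v}) u \<le> unif_prob v t u"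
proof -
  have "(\<Sum>i\<in>{k}. (avg ^^ i) (indicator {v}) u / fact i * (Q * t) ^ i) \<le> unif_series v u (Q * t)"
    unfolding unif_series_def using assms Q_pos
    by (intro sum_le_suminf summable_unif_series) (simp_all add: coeff_bounds)
  then have "exp (- Q * t) * ((avg ^^ k) (indicator {v}) u / fact k * (Q * t) ^ k) \<le> unif_prob v t u"
    unfolding unif_prob_def by (intro mult_left_mono) auto
  then show ?thesis by (simp add: mult_ac)
qed

lemma unif_prob_0: "u \<in> V \<Longrightarrow> unif_prob v 0 u = indicator {v} u"
  using powser_zero[of "\<lambda>k. (avg ^^ k) (indicator {v}) u / fact k"]
  by (simp add: unif_prob_def unif_series_def)

text \<open>Kolmogorov's backward equation. Differentiating the power series termwise shifts its
  coefficients by one application of \<open>avg\<close>, which \<open>avg_eq\<close> turns into the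
  generator.\<close>

lemma unif_prob_deriv:
  assumes u: "u \<in> V"
  shows "((\<lambda>t. unif_prob v t u) has_real_derivative jump_rate V E u *
     ((\<Sum>w\<in>set_pmf (jump_law V E u). pmf (jump_law V E u) w * unif_prob v t w) - unif_prob v t u)) (at t)"
proof -
  let ?c = "\<lambda>k u. (avg ^^ k) (indicator {v}) u" and ?T = "set_pmf (jump_law V E u)"
    and ?m = "pmf (jump_law V E u)" and ?q = "jump_rate V E u"
  let ?x = "Q * t"
  have TV: "w \<in> V" if "w \<in> ?T" for w using support_subset[OF u] that by auto
  have "diffs (\<lambda>k. ?c k u / fact k) = (\<lambda>k. ?c (Suc k) u / fact k)"
    by (simp add: diffs_def fun_eq_iff del: funpow.simps of_nat_Suc)
  then have D: "(unif_series v u has_real_derivative (\<Sum>k. ?c (Suc k) u / fact k * x ^ k)) (at x)" for x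
    using termdiffs_strong_converges_everywhere[of "\<lambda>k. ?c k u / fact k", OF summable_unif_series(1)[OF u]]
    unfolding unif_series_def[abs_def] by simp
  have "(\<Sum>k. ?c (Suc k) u / fact k * x ^ k) = unif_series v u x +
      ?q / Q * ((\<Sum>w\<in>?T. ?m w * unif_series v w x) - unif_series v u x)" for x
  proof -
    have sm: "(\<lambda>k. ?c k w / fact k * x ^ k) sums unif_series v w x" if "w \<in> V" for w
      unfolding unif_series_def using summable_unif_series(1)[OF that] by (rule summable_sums)
    have "(\<lambda>k. ?c k u / fact k * x ^ k + ?q / Q * ((\<Sum>w\<in>?T. ?m w * (?c k w / fact k * x ^ k)) - ?c k u / fact k * x ^ k))
       sums (unif_series v u x + ?q / Q * ((\<Sum>w\<in>?T. ?m w * unif_series v w x) - unif_series v u x))"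
      using TV u by (intro sums_add sums_mult sums_diff sums_sum sm) auto
    moreover have "?c k u / fact k * x ^ k + ?q / Q * ((\<Sum>w\<in>?T. ?m w * (?c k w / fact k * x ^ k)) - ?c k u / fact k * x ^ k)
        = ?c (Suc k) u / fact k * x ^ k" for k
    proof -
      have "(\<Sum>w\<in>?T. ?m w * (?c k w / fact k * x ^ k)) = (\<Sum>w\<in>?T. ?m w * ?c k w) * (x ^ k / fact k)"
        unfolding sum_distrib_right by (intro sum.cong) (simp_all add: mult_ac)
      moreover have "c / f * y + q / Q * (m * (y / f) - c / f * y) = (c + q / Q * (m - c)) / f * y"
        for c f q m y :: real
        by (simp add: algebra_simps add_divide_distrib diff_divide_distrib)
      ultimately show ?thesis by (simp add: avg_eq[OF u])
    qed
    ultimately show ?thesis by (simp add: sums_iff)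
  qed
  note D' = D[unfolded this]
  have "((\<lambda>t. unif_series v u (Q * t)) has_real_derivative (unif_series v u ?x +
      ?q / Q * ((\<Sum>w\<in>?T. ?m w * unif_series v w ?x) - unif_series v u ?x)) * Q) (at t)"
    by (rule DERIV_chain2[OF D']) (auto intro!: derivative_eq_intros)
  then have "((\<lambda>t. unif_prob v t u) has_real_derivative
      exp (- Q * t) * (- Q) * unif_series v u ?x + exp (- Q * t) * ((unif_series v u ?x +
      ?q / Q * ((\<Sum>w\<in>?T. ?m w * unif_series v w ?x) - unif_series v u ?x)) * Q)) (at t)"
    unfolding unif_prob_def[abs_def]
    by (auto intro!: derivative_eq_intros)
  moreover have "(\<Sum>w\<in>?T. ?m w * unif_prob v t w) = exp (- Q * t) * (\<Sum>w\<in>?T. ?m w * unif_series v w ?x)"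
    unfolding unif_prob_def sum_distrib_left by (intro sum.cong) (simp_all add: mult_ac)
  ultimately show ?thesis
    using Q_pos by (elim DERIV_cong) (simp add: unif_prob_def field_simps)
qed

text \<open>Integral over the time and target of the first jump, in the form of
  \<open>stay_prob_Suc\<close>: it maps the probabilities of \<open>n\<close> jumps to those of
  \<open>n + 1\<close>.\<close>

definition first_step :: "(real \<Rightarrow> complex \<Rightarrow> ennreal) \<Rightarrow> real \<Rightarrow> complex \<Rightarrow> ennreal" where
  "first_step f t u = (\<integral>\<^sup>+s. ennreal (jump_rate V E u * exp (- jump_rate V E u * s)) * indicator {0..t} s *
       (\<Sum>w\<in>set_pmf (jump_law V E u). ennreal (pmf (jump_law V E u) w) * f (t - s) w) \<partial>lborel)"

lemma first_step_mono:
  assumes "\<And>s w. 0 \<le> s \<Longrightarrow> w \<in> V \<Longrightarrow> f s w \<le> g s w" and "u \<in> V"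
  shows "first_step f t u \<le> first_step g t u"
  unfolding first_step_def
  using assms support_subset[OF assms(2)]
  by (intro nn_integral_mono) (auto simp: indicator_def intro!: mult_left_mono sum_mono)

lemma first_step_add:
  assumes "\<And>w. (\<lambda>s. f s w) \<in> borel_measurable borel" "\<And>w. (\<lambda>s. g s w) \<in> borel_measurable borel"
  shows "first_step (\<lambda>s w. f s w + g s w) t u = first_step f t u + first_step g t u"
proof -
  have [measurable]: "(\<lambda>s. f (t - s) w) \<in> borel_measurable borel" "(\<lambda>s. g (t - s) w) \<in> borel_measurable borel" for w
    by (rule measurable_compose[OF _ assms(1)] measurable_compose[OF _ assms(2)]; simp)+
  show ?thesis
    unfolding first_step_def by (subst nn_integral_add[symmetric]) (auto simp: ring_distribs sum.distrib)
qed

lemma first_step_sum: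
  assumes "\<And>n w. (\<lambda>s. f n s w) \<in> borel_measurable borel"
  shows "first_step (\<lambda>s w. \<Sum>n<(N::nat). f n s w) t u = (\<Sum>n<N. first_step (f n) t u)"
proof (induction N)
  case (Suc N)
  show ?case using assms by (simp add: first_step_add Suc)
qed (simp add: first_step_def)

text \<open>Variation of constants: the backward equation integrated against the factor exp (- q s),
  where q is the jump rate at \<open>u\<close>. Thus \<open>unif_prob\<close> solves the equation
  whose iterates are the jump probabilities.\<close>

lemma unif_prob_first_step:
  assumes u: "u \<in> V" and t: "0 \<le> t"
  shows "ennreal (unif_prob v t u) = stay_prob v 0 t u + first_step (\<lambda>s w. ennreal (unif_prob v s w)) t u"
proof -
  let ?T = "set_pmf (jump_law V E u)" and ?m = "pmf (jump_law V E u)" and ?q = "jump_rate V E u"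
  \<comment> \<open>Antiderivative of the integrand: in its derivative the terms with
    \<open>unif_prob v (t - s) u\<close> cancel.\<close>
  let ?F = "\<lambda>s. - exp (- ?q * s) * unif_prob v (t - s) u"
  let ?f = "\<lambda>s. ?q * exp (- ?q * s) * (\<Sum>w\<in>?T. ?m w * unif_prob v (t - s) w)"
  have TV: "w \<in> V" if "w \<in> ?T" for w using support_subset[OF u] that by auto
  have q: "0 < ?q" using rate_pos[OF u] .
  have der: "((\<lambda>s. unif_prob v (t - s) w) has_real_derivative - (jump_rate V E w *
     ((\<Sum>z\<in>set_pmf (jump_law V E w). pmf (jump_law V E w) z * unif_prob v (t - s) z) - unif_prob v (t - s) w))) (at s)"
    if "w \<in> V" for s w
  proof -
    have "((\<lambda>s. t - s) has_real_derivative - 1) (at s)" by (auto intro!: derivative_eq_intros)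
    from DERIV_chain2[OF unif_prob_deriv[OF that] this] show ?thesis by simp
  qed
  have cont: "continuous_on UNIV (\<lambda>s. unif_prob v (t - s) w)" if "w \<in> V" for w
    using der[OF that] by (intro continuous_at_imp_continuous_on ballI) (blast intro: DERIV_isCont)
  have "(\<integral>\<^sup>+s. ennreal (?f s) * indicator {0..t} s \<partial>lborel) = ennreal (?F t - ?F 0)"
  proof (rule nn_integral_FTC_Icc)
    show "?f \<in> borel_measurable borel"
      using TV by (intro borel_measurable_continuous_onI continuous_intros cont) auto
    show "(?F has_real_derivative ?f s) (at s)" if "s \<in> {0..t}" for s
    proof -
      have "(?F has_real_derivative (?q * exp (- ?q * s)) * unif_prob v (t - s) u +
         - exp (- ?q * s) * - (?q * ((\<Sum>w\<in>?T. ?m w * unif_prob v (t - s) w) - unif_prob v (t - s) u))) (at s)"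
        by (rule derivative_eq_intros der[OF u] refl | simp)+
      then show ?thesis by (simp add: algebra_simps)
    qed
    show "0 \<le> ?f s" if "s \<in> {0..t}" for s
      using q that TV by (auto intro!: mult_nonneg_nonneg sum_nonneg unif_prob_nonneg)
  qed (rule t)
  also have "(\<integral>\<^sup>+s. ennreal (?f s) * indicator {0..t} s \<partial>lborel) = first_step (\<lambda>s w. ennreal (unif_prob v s w)) t u"
    unfolding first_step_def
  proof (intro nn_integral_cong)
    fix s
    show "ennreal (?f s) * indicator {0..t} s = ennreal (?q * exp (- ?q * s)) * indicator {0..t} s *
        (\<Sum>w\<in>?T. ennreal (?m w) * ennreal (unif_prob v (t - s) w))"
    proof (cases "s \<in> {0..t}")
      case True
      then have "(\<Sum>w\<in>?T. ennreal (?m w) * ennreal (unif_prob v (t - s) w)) =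
         ennreal (\<Sum>w\<in>?T. ?m w * unif_prob v (t - s) w)"
        by (subst sum_ennreal[symmetric]) (auto simp: ennreal_mult TV unif_prob_nonneg intro!: mult_nonneg_nonneg)
      moreover have "0 \<le> (\<Sum>w\<in>?T. ?m w * unif_prob v (t - s) w)"
        using True TV by (auto intro!: sum_nonneg mult_nonneg_nonneg unif_prob_nonneg)
      ultimately show ?thesis using True q by (simp add: ennreal_mult)
    qed simp
  qed
  finally have "first_step (\<lambda>s w. ennreal (unif_prob v s w)) t u =
      ennreal (unif_prob v t u - (if u = v then exp (- ?q * t) else 0))"
    by (simp add: unif_prob_0[OF u] indicator_def)
  \<comment> \<open>Conversion to \<open>ennreal\<close> truncates negative numbers at 0, so the
    sign of the difference must be known before it can be split; it is the monotonicity of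
    \<open>?F\<close>.\<close>
  moreover have "0 \<le> unif_prob v t u - (if u = v then exp (- ?q * t) else 0)"
  proof -
    have "?F 0 \<le> ?F t"
    proof (rule DERIV_nonneg_imp_nondecreasing[OF t])
      fix s assume s: "0 \<le> s" "s \<le> t"
      have "(?F has_real_derivative (?q * exp (- ?q * s)) * unif_prob v (t - s) u +
         - exp (- ?q * s) * - (?q * ((\<Sum>w\<in>?T. ?m w * unif_prob v (t - s) w) - unif_prob v (t - s) u))) (at s)"
        by (rule derivative_eq_intros der[OF u] refl | simp)+
      then have "(?F has_real_derivative ?f s) (at s)" by (simp add: algebra_simps)
      moreover have "0 \<le> ?f s"
        using q s TV by (auto intro!: mult_nonneg_nonneg sum_nonneg unif_prob_nonneg)
      ultimately show "\<exists>y. (?F has_real_derivative y) (at s) \<and> 0 \<le> y" by blast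
    qed
    then show ?thesis using u by (cases "u = v") (auto simp: unif_prob_0)
  qed
  ultimately show ?thesis
    unfolding stay_prob_0[OF u t] by (cases "u = v") (simp_all flip: ennreal_plus)
qed

text \<open>The partial sums are the iterates of the first-jump equation started at 0. Its integral
  operator is monotone, so they stay below any nonnegative solution.\<close>

lemma sum_stay_prob_le:
  "u \<in> V \<Longrightarrow> 0 \<le> t \<Longrightarrow> (\<Sum>n<N. stay_prob v n t u) \<le> ennreal (unif_prob v t u)"
proof (induction N arbitrary: t u)
  case (Suc N)
  have "(\<Sum>n<Suc N. stay_prob v n t u) = stay_prob v 0 t u + (\<Sum>n<N. first_step (stay_prob v n) t u)"
    by (simp only: sum.lessThan_Suc_shift stay_prob_Suc[OF Suc.prems] first_step_def)
  also have "(\<Sum>n<N. first_step (stay_prob v n) t u) = first_step (\<lambda>s w. \<Sum>n<N. stay_prob v n s w) t u"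
    by (rule first_step_sum[symmetric], rule stay_prob_measurable)
  also have "\<dots> \<le> first_step (\<lambda>s w. ennreal (unif_prob v s w)) t u"
    using Suc by (intro first_step_mono) auto
  finally show ?case using unif_prob_first_step[OF Suc.prems] by (simp add: add_left_mono)
qed simp

text \<open>The jump density is at most \<open>Q\<close>, so each application of the operator
  integrates once and gains a factor Q t / (N + 1).\<close>

lemma first_step_power:
  assumes u: "u \<in> V" and t: "0 \<le> t"
  shows "first_step (\<lambda>s w. ennreal ((Q * s) ^ N / fact N)) t u \<le> ennreal ((Q * t) ^ Suc N / fact (Suc N))"
proof -
  let ?T = "set_pmf (jump_law V E u)" and ?m = "pmf (jump_law V E u)" and ?q = "jump_rate V E u"
  have q: "0 < ?q" using rate_pos[OF u] .
  have "first_step (\<lambda>s w. ennreal ((Q * s) ^ N / fact N)) t u \<le>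
     (\<integral>\<^sup>+s. ennreal (Q * ((Q * (t - s)) ^ N / fact N)) * indicator {0..t} s \<partial>lborel)"
    unfolding first_step_def
  proof (intro nn_integral_mono)
    fix s :: real
    show "ennreal (?q * exp (- ?q * s)) * indicator {0..t} s * (\<Sum>w\<in>?T. ennreal (?m w) * ennreal ((Q * (t - s)) ^ N / fact N))
      \<le> ennreal (Q * ((Q * (t - s)) ^ N / fact N)) * indicator {0..t} s"
    proof (cases "s \<in> {0..t}")
      case True
      let ?y = "(Q * (t - s)) ^ N / fact N"
      have y: "0 \<le> ?y" using True Q_pos by simp
      have "(\<Sum>w\<in>?T. ennreal (?m w) * ennreal ?y) = (\<Sum>w\<in>?T. ennreal (?m w)) * ennreal ?y"
        by (rule sum_distrib_right[symmetric])
      also have "(\<Sum>w\<in>?T. ennreal (?m w)) = 1"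
        using sum_pmf_eq_1[OF finite_support[OF u] order_refl] by (simp add: sum_ennreal)
      finally have e: "(\<Sum>w\<in>?T. ennreal (?m w) * ennreal ?y) = ennreal ?y" by simp
      have "?q * exp (- ?q * s) \<le> Q * 1"
        using rate_le[OF u] q True by (intro mult_mono) auto
      from mult_right_mono[OF this y] have "?q * exp (- ?q * s) * ?y \<le> Q * ?y" by simp
      then show ?thesis unfolding e using True y q
        by (simp add: ennreal_leI flip: ennreal_mult)
    qed simp
  qed
  also have "\<dots> = ennreal (- ((Q * (t - t)) ^ Suc N / fact (Suc N)) - - ((Q * (t - 0)) ^ Suc N / fact (Suc N)))"
  proof (rule nn_integral_FTC_Icc)
    show "((\<lambda>s. - ((Q * (t - s)) ^ Suc N / fact (Suc N))) has_real_derivative Q * ((Q * (t - s)) ^ N / fact N))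
        (at s)" for s
      by (rule derivative_eq_intros refl | simp del: power_Suc fact_Suc)+
         (simp add: fact_Suc divide_simps del: of_nat_Suc)
  qed (use Q_pos t in auto)
  finally show ?thesis by simp
qed

text \<open>Iterating the equation from the trivial bound 1 leaves a remainder that tends to 0 as
  \<open>N\<close> grows. Together with \<open>sum_stay_prob_le\<close> this determines the jump
  probabilities completely.\<close>

lemma unif_prob_le_sum:
  "u \<in> V \<Longrightarrow> 0 \<le> t \<Longrightarrow> ennreal (unif_prob v t u) \<le> (\<Sum>n<N. stay_prob v n t u) + ennreal ((Q * t) ^ N / fact N)"
proof (induction N arbitrary: t u)
  case 0
  then show ?case using unif_prob_le_1[OF 0] by (simp add: ennreal_leI flip: ennreal_1)
next
  case (Suc N)
  let ?r = "\<lambda>s w::complex. ennreal ((Q * s) ^ N / fact N)"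
  have "ennreal (unif_prob v t u) = stay_prob v 0 t u + first_step (\<lambda>s w. ennreal (unif_prob v s w)) t u"
    by (rule unif_prob_first_step[OF Suc.prems])
  also have "\<dots> \<le> stay_prob v 0 t u + first_step (\<lambda>s w. (\<Sum>n<N. stay_prob v n s w) + ?r s w) t u"
    using Suc by (intro add_left_mono first_step_mono) auto
  also have "first_step (\<lambda>s w. (\<Sum>n<N. stay_prob v n s w) + ?r s w) t u =
     (\<Sum>n<N. first_step (stay_prob v n) t u) + first_step ?r t u"
    by (subst first_step_add)
       (auto simp: first_step_sum stay_prob_measurable intro!: borel_measurable_sum)
  also have "stay_prob v 0 t u + ((\<Sum>n<N. first_step (stay_prob v n) t u) + first_step ?r t u) =
     (\<Sum>n<Suc N. stay_prob v n t u) + first_step ?r t u"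
    by (simp only: sum.lessThan_Suc_shift stay_prob_Suc[OF Suc.prems] first_step_def add.assoc)
  also have "\<dots> \<le> (\<Sum>n<Suc N. stay_prob v n t u) + ennreal ((Q * t) ^ Suc N / fact (Suc N))"
    by (intro add_left_mono first_step_power Suc.prems)
  finally show ?case .
qed

lemma measure_walk_eq_unif_prob:
  assumes u: "u \<in> V" and t: "0 \<le> t"
  shows "measure (walk_space V E) {\<omega> \<in> space (walk_space V E). walk u t \<omega> = Some v} = unif_prob v t u"
proof -
  let ?e = "emeasure (walk_space V E) {\<omega> \<in> space (walk_space V E). walk u t \<omega> = Some v}"
  have lim: "(\<lambda>N. \<Sum>n<N. stay_prob v n t u) \<longlonglongrightarrow> ?e"
    unfolding walk_prob_eq using summableI by (rule summable_LIMSEQ)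
  have "?e \<le> ennreal (unif_prob v t u)"
    by (rule LIMSEQ_le_const2[OF lim]) (use sum_stay_prob_le[OF assms] in auto)
  moreover have "ennreal (unif_prob v t u) \<le> ?e"
  proof -
    have "(\<lambda>N. ennreal ((Q * t) ^ N / fact N)) \<longlonglongrightarrow> ennreal 0"
      using summable_LIMSEQ_zero[OF summable_exp[of "Q * t"]]
      by (intro tendsto_ennrealI) (simp add: divide_inverse mult.commute)
    from tendsto_add[OF lim this] have "(\<lambda>N. (\<Sum>n<N. stay_prob v n t u) + ennreal ((Q * t) ^ N / fact N)) \<longlonglongrightarrow> ?e"
      by simp
    then show ?thesis by (rule LIMSEQ_le_const) (use unif_prob_le_sum[OF assms] in auto)
  qed
  ultimately have "?e = ennreal (unif_prob v t u)" by (rule order.antisym)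
  then show ?thesis using unif_prob_nonneg[OF assms] by (simp add: measure_def)
qed

end

section \<open>Faces of an isoradial graph\<close>

text \<open>Twice the signed area of the triangle u, z, p: positive if \<open>p\<close> is to the
  left of the line directed from \<open>u\<close> to \<open>z\<close>.\<close>

definition cross :: "complex \<Rightarrow> complex \<Rightarrow> complex \<Rightarrow> real" where
  "cross u z p = Im (cnj (z - u) * (p - u))"

lemma cross_swap: "cross z u p = - cross u z p"
  by (simp add: cross_def algebra_simps)

lemma cross_midpoint [simp]: "cross u z (midpoint u z) = 0"
  by (simp add: cross_def midpoint_def field_simps)

lemma cross_segment: "p \<in> closed_segment u z \<Longrightarrow> cross u z p = 0"
  by (auto simp: closed_segment_def cross_def) (simp add: algebra_simps)

lemma cross_zero_collinear:
  assumes "cross u z p = 0" "u \<noteq> z"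
  obtains s where "p = u + of_real s * (z - u)"
proof -
  define a b x y where "a = Re (z - u)" "b = Im (z - u)" "x = Re (p - u)" "y = Im (p - u)"
  have ab: "a * y = b * x" using assms(1) by (simp add: cross_def a_b_x_y_def algebra_simps)
  have n: "a\<^sup>2 + b\<^sup>2 \<noteq> 0" using assms(2) by (auto simp: a_b_x_y_def complex_eq_iff sum_power2_eq_zero_iff)
  let ?s = "(a * x + b * y) / (a\<^sup>2 + b\<^sup>2)"
  have "x * (a\<^sup>2 + b\<^sup>2) = (a * x + b * y) * a" "y * (a\<^sup>2 + b\<^sup>2) = (a * x + b * y) * b"
    using ab by algebra+
  then have "x = ?s * a" "y = ?s * b" using n by (simp_all add: field_simps)
  then show ?thesis by (intro that[of ?s]) (simp add: complex_eq_iff a_b_x_y_def)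
qed

lemma continuous_on_cross [continuous_intros]: "continuous_on A (cross u z)"
  unfolding cross_def by (intro continuous_intros)

lemma cross_affine: "cross u z ((1 - t) *\<^sub>R x + t *\<^sub>R y) = (1 - t) * cross u z x + t * cross u z y"
  by (simp add: cross_def scaleR_conv_of_real algebra_simps)

lemma convex_cross_pos: "convex {p. cross u z p > 0}"
proof (rule convexI, simp)
  fix x y and a b :: real
  assume *: "0 < cross u z x" "0 < cross u z y" "0 \<le> a" "0 \<le> b" "a + b = 1"
  have "a = 1 - b" using *(5) by simp
  then have "cross u z (a *\<^sub>R x + b *\<^sub>R y) = a * cross u z x + b * cross u z y"
    using cross_affine[of u z b x y] by simp
  moreover have "0 < a * cross u z x + b * cross u z y"
    using * by (cases "a = 0") (auto intro!: add_pos_nonneg)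
  ultimately show "0 < cross u z (a *\<^sub>R x + b *\<^sub>R y)" by simp
qed

locale isoradial =
  fixes h :: real and V :: "complex set" and E :: "complex set set"
  assumes iso: "isoradial_graph h V E" and h_pos: "0 < h"
begin

abbreviation "Faces \<equiv> graph_faces V E"

abbreviation "N \<equiv> neighbours E"

lemma plane: "plane_graph V E" and infinite_V: "infinite V"
  and locally_finite: "bounded B \<Longrightarrow> finite (V \<inter> B)"
  and cover: "(\<Union>f\<in>Faces. closure f) = UNIV"
  using iso by (simp_all add: isoradial_graph_def)

section \<open>Elementary properties of edges\<close>

lemma edge_subset_V: "e \<in> E \<Longrightarrow> e \<subseteq> V"
  using plane by (auto simp: plane_graph_def)

lemma edge_cases:
  assumes "e \<in> E"
  obtains u z where "e = {u, z}" "u \<noteq> z" "u \<in> V" "z \<in> V" "convex hull e = closed_segment u z"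
proof -
  have "card e = 2" using plane assms by (auto simp: plane_graph_def)
  then obtain u z where "e = {u, z}" "u \<noteq> z" by (auto simp: card_2_iff)
  then show ?thesis using edge_subset_V[OF assms] that by (simp add: segment_convex_hull)
qed

lemma neighbourD:
  assumes "z \<in> N u"
  shows "{u, z} \<in> E" "u \<noteq> z" "u \<in> V" "z \<in> V" "u \<in> N z"
proof -
  show e: "{u, z} \<in> E" using assms by (simp add: neighbours_def)
  have "card {u, z} = 2" using plane e by (auto simp: plane_graph_def)
  then show "u \<noteq> z" by auto
  show "u \<in> V" "z \<in> V" using edge_subset_V[OF e] by auto
  show "u \<in> N z" using e by (simp add: neighbours_def insert_commute)
qed

lemma midpoint_edge:
  assumes "z \<in> N u"
  shows "midpoint u z \<in> convex hull {u, z}" "midpoint u z \<notin> {u, z}" "midpoint u z \<notin> V"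
proof -
  show m: "midpoint u z \<in> convex hull {u, z}" by (simp add: midpoint_in_closed_segment flip: segment_convex_hull)
  show n: "midpoint u z \<notin> {u, z}" using neighbourD(2)[OF assms] by (simp add: midpoint_eq_endpoint)
  have "convex hull {u, z} \<inter> V \<subseteq> {u, z}"
    using plane neighbourD(1)[OF assms] by (auto simp: plane_graph_def)
  then show "midpoint u z \<notin> V" using m n by blast
qed

lemma edges_meet:
  assumes "e \<in> E" "e' \<in> E" "p \<in> convex hull e" "p \<in> convex hull e'" "p \<notin> e"
  shows "e = e'"
proof (rule ccontr)
  assume "e \<noteq> e'"
  then have "convex hull e \<inter> convex hull e' \<subseteq> e \<inter> e'"
    using plane assms(1,2) by (simp add: plane_graph_def)
  then show False using assms(3-5) by (auto dest: subsetD)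
qed

lemma vertex_on_edge:
  assumes "e \<in> E" "p \<in> convex hull e" "p \<in> V"
  shows "p \<in> e"
proof -
  have "convex hull e \<inter> V \<subseteq> e" using plane assms(1) by (simp add: plane_graph_def)
  then show ?thesis using assms(2,3) by (auto dest: subsetD)
qed

section \<open>Elementary properties of faces\<close>

lemma face_connected: "f \<in> Faces \<Longrightarrow> connected f"
  unfolding graph_faces_def by (rule in_components_connected)

lemma face_nonempty: "f \<in> Faces \<Longrightarrow> f \<noteq> {}"
  unfolding graph_faces_def by (rule in_components_nonempty)

lemma face_subset: "f \<in> Faces \<Longrightarrow> f \<subseteq> - (V \<union> (\<Union>e\<in>E. convex hull e))"
  unfolding graph_faces_def by (rule in_components_subset)

lemma face_disjoint_V: "f \<in> Faces \<Longrightarrow> p \<in> f \<Longrightarrow> p \<notin> V"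
  and face_disjoint_edge: "f \<in> Faces \<Longrightarrow> e \<in> E \<Longrightarrow> p \<in> f \<Longrightarrow> p \<notin> convex hull e"
  using face_subset[of f] by auto

lemma faces_disjoint: "f \<in> Faces \<Longrightarrow> g \<in> Faces \<Longrightarrow> p \<in> f \<Longrightarrow> p \<in> g \<Longrightarrow> f = g"
  unfolding graph_faces_def using components_eq[of f _ g] by auto

lemma face_maximal:
  assumes "connected T" "T \<noteq> {}" "T \<inter> V = {}" "\<And>e. e \<in> E \<Longrightarrow> T \<inter> convex hull e = {}"
  obtains f where "f \<in> Faces" "T \<subseteq> f"
proof -
  have sub: "T \<subseteq> - (V \<union> (\<Union>e\<in>E. convex hull e))" (is "_ \<subseteq> ?S") using assms(3,4) by (fastforce simp: disjoint_iff)
  then have "?S \<noteq> {}" using assms(2) by blast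
  from exists_component_superset[OF sub this assms(1)] show ?thesis
    using that unfolding graph_faces_def by auto
qed

lemma face_cycle:
  assumes "f \<in> Faces"
  obtains vs where "3 \<le> length vs" "distinct vs"
    "\<And>i. i < length vs \<Longrightarrow> {vs ! i, vs ! (Suc i mod length vs)} \<in> E"
    "frontier f = (\<Union>i<length vs. closed_segment (vs ! i) (vs ! (Suc i mod length vs)))"
    "bounded f"
proof -
  have "polygonal_face E f" using iso assms by (simp add: isoradial_graph_def)
  then obtain vs where "bounded f \<and> 3 \<le> length vs \<and> distinct vs \<and>
      (\<forall>i<length vs. {vs ! i, vs ! (Suc i mod length vs)} \<in> E) \<and>
      frontier f = (\<Union>i<length vs. closed_segment (vs ! i) (vs ! (Suc i mod length vs)))"
    unfolding polygonal_face_def by (elim conjE exE) (rule that, intro conjI)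
  then show ?thesis by (intro that[of vs]) simp_all
qed

lemma face_bounded: "f \<in> Faces \<Longrightarrow> bounded f"
proof -
  assume "f \<in> Faces"
  then have "polygonal_face E f" using iso by (simp add: isoradial_graph_def)
  then show ?thesis unfolding polygonal_face_def by (rule conjunct1)
qed

lemma frontier_edge:
  assumes "f \<in> Faces" "p \<in> frontier f"
  obtains e where "e \<in> E" "p \<in> convex hull e" "convex hull e \<subseteq> frontier f"
proof -
  obtain vs where vs: "\<And>i. i < length vs \<Longrightarrow> {vs ! i, vs ! (Suc i mod length vs)} \<in> E"
    "frontier f = (\<Union>i<length vs. closed_segment (vs ! i) (vs ! (Suc i mod length vs)))"
    using face_cycle[OF assms(1)] by metis
  then obtain i where "i < length vs" "p \<in> closed_segment (vs ! i) (vs ! (Suc i mod length vs))"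
    using assms by auto
  then show ?thesis using that[of "{vs ! i, vs ! (Suc i mod length vs)}"] vs
    by (auto simp: segment_convex_hull)
qed

lemma edge_in_frontier:
  assumes "f \<in> Faces" "e \<in> E" "p \<in> convex hull e" "p \<notin> e" "p \<in> frontier f"
  shows "convex hull e \<subseteq> frontier f"
proof -
  obtain e' where e': "e' \<in> E" "p \<in> convex hull e'" "convex hull e' \<subseteq> frontier f"
    using frontier_edge[OF assms(1,5)] .
  have "e = e'" by (rule edges_meet[OF assms(2) e'(1) assms(3) e'(2) assms(4)])
  then show ?thesis using e'(3) by simp
qed

lemma on_frontier:
  assumes "p \<in> V \<or> (\<exists>e\<in>E. p \<in> convex hull e)"
  obtains f where "f \<in> Faces" "p \<in> frontier f"
proof -
  obtain f where f: "f \<in> Faces" "p \<in> closure f" using cover by blast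
  then have "p \<notin> f" using assms face_disjoint_V face_disjoint_edge by blast
  then have "p \<in> frontier f" using f interior_subset by (auto simp: frontier_def)
  then show ?thesis using that f by blast
qed

lemma face_has_centre:
  assumes "f \<in> Faces"
  obtains c where "c \<in> f" "V \<inter> frontier f \<subseteq> sphere c (h / 2)"
proof -
  have "\<forall>f\<in>Faces. \<exists>c\<in>f. V \<inter> frontier f \<subseteq> sphere c (h / 2)"
    using iso by (simp add: isoradial_graph_def face_vertices_def)
  then show ?thesis using assms that by blast
qed

text \<open>An edge bounds some face, hence is a chord of a circle of diameter
  \<open>h\<close>.\<close>

lemma edge_length_le: "z \<in> N u \<Longrightarrow> dist u z \<le> h"
proof -
  assume z: "z \<in> N u"
  obtain f where f: "f \<in> Faces" "midpoint u z \<in> frontier f"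
    using on_frontier midpoint_edge(1)[OF z] neighbourD(1)[OF z] by metis
  have "convex hull {u, z} \<subseteq> frontier f"
    by (rule edge_in_frontier[OF f(1) neighbourD(1)[OF z] midpoint_edge(1,2)[OF z] f(2)])
  then have "u \<in> frontier f" "z \<in> frontier f" using hull_subset[of "{u, z}" convex] by auto
  moreover obtain c where c: "V \<inter> frontier f \<subseteq> sphere c (h / 2)" using face_has_centre[OF f(1)] .
  ultimately have "dist c u = h / 2" "dist c z = h / 2" using neighbourD[OF z] by auto
  then show ?thesis using dist_triangle_half_r[of c u "2 * h" z] dist_triangle2[of u z c] by (simp add: dist_commute)
qed

text \<open>Edges have length at most \<open>h\<close> and vertices are locally finite, so only
  finitely many closed edges come near \<open>p\<close>; those missing \<open>p\<close> stay at a
  positive distance.\<close>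

lemma isolating_ball:
  obtains \<epsilon> where "\<epsilon> > 0" "\<And>e. e \<in> E \<Longrightarrow> convex hull e \<inter> ball p \<epsilon> \<noteq> {} \<Longrightarrow> p \<in> convex hull e"
    "\<And>v. v \<in> V \<Longrightarrow> v \<in> ball p \<epsilon> \<Longrightarrow> v = p"
proof -
  \<comment> \<open>An edge that meets the unit ball around \<open>p\<close> has both ends within 1
    + h of \<open>p\<close>.\<close>
  let ?W = "V \<inter> ball p (1 + h)"
  let ?E = "{e \<in> E. e \<subseteq> ?W}"
  have fin: "finite ?W" by (rule locally_finite) simp
  have finE: "finite ?E" by (rule finite_subset[of _ "Pow ?W"]) (use fin in \<open>blast, simp only: finite_Pow_iff\<close>)
  have near: "e \<in> ?E" if "e \<in> E" "q \<in> convex hull e" "q \<in> ball p 1" for e q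
  proof -
    obtain u z where e: "e = {u, z}" "convex hull e = closed_segment u z" using edge_cases[OF \<open>e \<in> E\<close>] by metis
    then have "dist u z \<le> h" using edge_length_le that by (auto simp: neighbours_def)
    moreover have "dist u q \<le> dist u z" "dist z q \<le> dist u z"
      using that(2) e segment_bound[of q u z] by (auto simp: dist_norm norm_minus_commute)
    ultimately have "dist q u \<le> h" "dist q z \<le> h" by (auto simp: dist_commute)
    moreover have "dist p u \<le> dist p q + dist q u" "dist p z \<le> dist p q + dist q z" by (rule dist_triangle)+
    ultimately have "u \<in> ball p (1 + h)" "z \<in> ball p (1 + h)" using that(3) by auto
    then show ?thesis using that(1) edge_subset_V[OF that(1)] e by auto
  qed
  define C where "C = (\<Union>e\<in>{e\<in>?E. p \<notin> convex hull e}. convex hull e) \<union> (?W - {p})"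
  have C_edge: "q \<in> C" if "e \<in> ?E" "p \<notin> convex hull e" "q \<in> convex hull e" for e q
    using that unfolding C_def by blast
  have C_vertex: "v \<in> C" if "v \<in> ?W" "v \<noteq> p" for v
    using that unfolding C_def by blast
  have "closed (convex hull e)" if "e \<in> ?E" for e
    using that finite_subset[OF _ fin, of e] finite_imp_compact_convex_hull compact_imp_closed by blast
  then have "closed (\<Union>e\<in>{e\<in>?E. p \<notin> convex hull e}. convex hull e)"
    by (intro closed_UN ballI finite_subset[OF _ finE]) (blast, blast)
  moreover have "closed (?W - {p})" using fin by (intro finite_imp_closed finite_Diff)
  ultimately have "closed C" unfolding C_def by (rule closed_Un)
  then have "open (- C)" by (rule open_Compl)
  moreover have "p \<in> - C" unfolding C_def by blast
  ultimately obtain \<delta> where \<delta>: "\<delta> > 0" "ball p \<delta> \<subseteq> - C"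
    by (rule openE)
  show ?thesis
  proof (rule that[of "min \<delta> 1"])
    show "p \<in> convex hull e" if e: "e \<in> E" "convex hull e \<inter> ball p (min \<delta> 1) \<noteq> {}" for e
    proof (rule ccontr)
      assume np: "p \<notin> convex hull e"
      obtain q where q: "q \<in> convex hull e" "q \<in> ball p (min \<delta> 1)" using e(2) by blast
      then have "q \<in> ball p \<delta>" "q \<in> ball p 1" by (simp_all only: mem_ball min_less_iff_conj)
      then show False using C_edge[OF near[OF e(1) q(1)] np q(1)] \<delta>(2) by blast
    qed
    show "v = p" if "v \<in> V" "v \<in> ball p (min \<delta> 1)" for v
    proof (rule ccontr)
      assume "v \<noteq> p"
      moreover have "v \<in> ball p \<delta>" "v \<in> ?W"
        using that h_pos by auto
      ultimately show False using \<delta>(2) C_vertex by blast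
    qed
  qed (use \<delta>(1) in simp)
qed

lemma face_open:
  assumes "f \<in> Faces"
  shows "open f"
proof -
  have "open (- (V \<union> (\<Union>e\<in>E. convex hull e)))"
    unfolding open_contains_ball
  proof (intro ballI)
    fix p assume p: "p \<in> - (V \<union> (\<Union>e\<in>E. convex hull e))"
    obtain \<epsilon> where "\<epsilon> > 0" "\<And>e. e \<in> E \<Longrightarrow> convex hull e \<inter> ball p \<epsilon> \<noteq> {} \<Longrightarrow> p \<in> convex hull e"
      "\<And>v. v \<in> V \<Longrightarrow> v \<in> ball p \<epsilon> \<Longrightarrow> v = p" using isolating_ball by metis
    then show "\<exists>\<epsilon>>0. ball p \<epsilon> \<subseteq> - (V \<union> (\<Union>e\<in>E. convex hull e))"
      using p by (intro exI[of _ \<epsilon>]) blast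
  qed
  then show ?thesis using assms open_components unfolding graph_faces_def by blast
qed

text \<open>The frontier consists of chords and so lies in the closed disc. A point of the face
  beyond the disc could be moved radially outwards, and as the face is bounded this ray would meet
  the frontier outside the disc.\<close>

lemma face_subset_ball:
  assumes f: "f \<in> Faces" and c: "c \<in> f" "V \<inter> frontier f \<subseteq> sphere c (h / 2)"
  shows "f \<subseteq> ball c (h / 2)"
proof -
  have fr: "frontier f \<subseteq> cball c (h / 2)"
  proof
    fix p assume "p \<in> frontier f"
    then obtain e where e: "e \<in> E" "p \<in> convex hull e" "convex hull e \<subseteq> frontier f"
      using frontier_edge[OF f] by blast
    have "e \<subseteq> sphere c (h / 2)" using e c edge_subset_V[OF e(1)] hull_subset[of e convex] by blast
    then have "convex hull e \<subseteq> cball c (h / 2)" by (intro hull_minimal) auto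
    then show "p \<in> cball c (h / 2)" using e by blast
  qed
  have "f \<subseteq> cball c (h / 2)"
  proof
    fix x assume x: "x \<in> f"
    show "x \<in> cball c (h / 2)"
    proof (rule ccontr)
      assume nx: "x \<notin> cball c (h / 2)"
      let ?R = "(\<lambda>s. c + s *\<^sub>R (x - c)) ` {1..}"
      have xc: "x \<noteq> c" using nx h_pos by auto
      have "connected ?R" by (intro connected_continuous_image continuous_intros) auto
      moreover have "?R \<inter> f \<noteq> {}" using x by (auto intro!: image_eqI[of _ _ 1])
      moreover have "?R - f \<noteq> {}"
      proof
        assume "?R - f = {}"
        then have "bounded ?R" using face_bounded[OF f] bounded_subset by blast
        then obtain B where B: "\<And>s. 1 \<le> s \<Longrightarrow> norm (c + s *\<^sub>R (x - c)) \<le> B" unfolding bounded_iff by auto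
        define s where "s = max 1 ((\<bar>B\<bar> + norm c + 1) / norm (x - c))"
        have n: "norm (x - c) > 0" using xc by simp
        have "\<bar>B\<bar> + norm c + 1 \<le> s * norm (x - c)"
          using n unfolding s_def by (simp add: pos_divide_le_eq[symmetric])
        moreover have "s * norm (x - c) \<le> norm (c + s *\<^sub>R (x - c)) + norm c"
          using norm_triangle_ineq4[of "c + s *\<^sub>R (x - c)" c] by (simp add: s_def)
        moreover have "norm (c + s *\<^sub>R (x - c)) \<le> B" by (rule B) (simp add: s_def)
        ultimately show False by linarith
      qed
      ultimately have "?R \<inter> frontier f \<noteq> {}" by (rule connected_Int_frontier)
      then obtain s where s: "1 \<le> s" "c + s *\<^sub>R (x - c) \<in> frontier f" by auto
      then have "dist c (c + s *\<^sub>R (x - c)) \<le> h / 2" using fr by auto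
      then have "s * norm (x - c) \<le> h / 2" using s by (simp add: dist_norm)
      moreover have "norm (x - c) \<le> s * norm (x - c)" using s by (simp add: mult_le_cancel_right1)
      ultimately show False using nx by (simp add: dist_norm norm_minus_commute)
    qed
  qed
  then have "f \<subseteq> interior (cball c (h / 2))" by (rule interior_maximal) (rule face_open[OF f])
  then show ?thesis by simp
qed

text \<open>A face lies in its circumdisc, and the line through one of its edges meets that disc only in the edge.\<close>

lemma face_side:
  assumes f: "f \<in> Faces" and z: "z \<in> N u" and e: "convex hull {u, z} \<subseteq> frontier f"
  shows "(\<forall>p\<in>f. cross u z p > 0) \<or> (\<forall>p\<in>f. cross u z p < 0)"
proof -
  obtain c where c: "c \<in> f" "V \<inter> frontier f \<subseteq> sphere c (h / 2)" using face_has_centre[OF f] .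
  have uz: "dist c u = h / 2" "dist c z = h / 2" "u \<noteq> z"
    using c(2) e neighbourD[OF z] hull_subset[of "{u,z}" convex] by auto
  have "cross u z p \<noteq> 0" if "p \<in> f" for p
  proof
    assume *: "cross u z p = 0"
    have n: "(norm (z - u))\<^sup>2 > 0" using uz by simp
    obtain s where p: "p = u + of_real s * (z - u)" using cross_zero_collinear[OF * uz(3)] .
    have "dist c p < h / 2" using face_subset_ball[OF f c] that by auto
    then have "(norm (p - c))\<^sup>2 < (h / 2)\<^sup>2"
      by (intro power_strict_mono) (auto simp: dist_norm norm_minus_commute)
    \<comment> \<open>Stewart's identity on the line through \<open>u\<close> and \<open>z\<close>:
      its points strictly inside the circle are those with s (1 - s) > 0.\<close>
    moreover have "(norm (p - c))\<^sup>2 = (1 - s) * (norm (u - c))\<^sup>2 + s * (norm (z - c))\<^sup>2 - s * (1 - s) * (norm (z - u))\<^sup>2"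
      unfolding p cmod_power2 by (simp add: algebra_simps power2_eq_square)
    moreover have "(norm (u - c))\<^sup>2 = (h / 2)\<^sup>2" "(norm (z - c))\<^sup>2 = (h / 2)\<^sup>2"
      using uz by (auto simp: dist_norm norm_minus_commute)
    ultimately have "0 < s * (1 - s) * (norm (z - u))\<^sup>2" by (simp add: algebra_simps)
    then have "0 < s * (1 - s)" using n by (simp add: zero_less_mult_iff)
    then have "0 < s" "s < 1" by (auto simp: zero_less_mult_iff)
    then have "p \<in> closed_segment u z"
      unfolding p closed_segment_def by (auto simp: scaleR_conv_of_real algebra_simps intro!: exI[of _ s])
    then show False using face_disjoint_edge[OF f neighbourD(1)[OF z] that] by (simp add: segment_convex_hull)
  qed
  moreover have "connected (cross u z ` f)"
    by (intro connected_continuous_image continuous_intros face_connected[OF f])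
  ultimately show ?thesis
  proof (intro ccontr[of "_ \<or> _"])
    assume nz: "\<And>p. p \<in> f \<Longrightarrow> cross u z p \<noteq> 0" and conn: "connected (cross u z ` f)"
      and "\<not> ((\<forall>p\<in>f. 0 < cross u z p) \<or> (\<forall>p\<in>f. cross u z p < 0))"
    then obtain p q where pq: "p \<in> f" "q \<in> f" "cross u z p \<le> 0" "0 \<le> cross u z q"
      by (auto simp: not_less)
    then have "0 \<in> cross u z ` f" using connectedD_interval[OF conn, of "cross u z p" "cross u z q" 0] by blast
    then show False using nz by auto
  qed
qed

end

section \<open>Circumcentres, dual edges and moments of the weights\<close>

lemma diameter_pair: "diameter {x, y :: 'a :: real_normed_vector} = dist x y"
proof (rule antisym)
  show "diameter {x, y} \<le> dist x y"
    by (rule diameter_le) (auto simp: dist_norm norm_minus_commute)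
  show "dist x y \<le> diameter {x, y}" by (rule diameter_bounded_bound) auto
qed

lemma Re_cnj_zero_collinear:
  assumes "Re (cnj n * w) = 0" "n \<noteq> 0"
  obtains \<beta> where "w = of_real \<beta> * (\<i> * n)"
proof -
  have "cross 0 (\<i> * n) w = 0" using assms(1) by (simp add: cross_def algebra_simps)
  moreover have "0 \<noteq> \<i> * n" using assms(2) by simp
  ultimately obtain \<beta> where "w = 0 + of_real \<beta> * (\<i> * n - 0)" using cross_zero_collinear by blast
  then show ?thesis by (intro that[of \<beta>]) simp
qed

text \<open>If the centres differed, the three points would lie on the radical axis, perpendicular
  to \<open>x - y\<close>, but a line meets a circle at most twice.\<close>

lemma circle_centre_unique:
  fixes x y :: complex
  assumes d: "a \<noteq> b" "a \<noteq> c" "b \<noteq> c" and x: "dist x a = r" "dist x b = r" "dist x c = r"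
    and y: "dist y a = s" "dist y b = s" "dist y c = s"
  shows "x = y"
proof (rule ccontr)
  assume ne: "x \<noteq> y"
  define n where "n = x - y"
  have n0: "n \<noteq> 0" using ne by (simp add: n_def)
  \<comment> \<open>\<open>\<beta>\<close> is the position along the axis, measured from
    \<open>a\<close>. A point of the circle has position 0 or one fixed other value, so
    \<open>b\<close> and \<open>c\<close>, both different from \<open>a\<close>, coincide.\<close>
  have key: "\<exists>\<beta>. p - a = of_real \<beta> * (\<i> * n) \<and> (\<beta> = 0 \<or> \<beta> * (norm n)\<^sup>2 = 2 * Re (cnj (\<i> * n) * (x - a)))"
    if "dist x p = r" "dist y p = s" for p
  proof -
    have e: "(norm (x - p))\<^sup>2 = (norm (x - a))\<^sup>2" "(norm (y - p))\<^sup>2 = (norm (y - a))\<^sup>2"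
      using that x y by (simp_all add: dist_norm)
    have "2 * Re (cnj n * (p - a)) = ((norm (x - a))\<^sup>2 - (norm (x - p))\<^sup>2) - ((norm (y - a))\<^sup>2 - (norm (y - p))\<^sup>2)"
      unfolding n_def cmod_power2 by (simp add: power2_eq_square algebra_simps)
    then have "Re (cnj n * (p - a)) = 0" using e by simp
    then obtain \<beta> where \<beta>: "p - a = of_real \<beta> * (\<i> * n)" using Re_cnj_zero_collinear n0 by blast
    have "(norm (x - p))\<^sup>2 = (norm (x - a))\<^sup>2 - 2 * Re (cnj (p - a) * (x - a)) + (norm (p - a))\<^sup>2"
      unfolding cmod_power2 by (simp add: power2_eq_square algebra_simps)
    then have "(norm (p - a))\<^sup>2 = 2 * Re (cnj (p - a) * (x - a))" using e by simp
    then have "\<beta>\<^sup>2 * (norm n)\<^sup>2 = \<beta> * (2 * Re (cnj (\<i> * n) * (x - a)))"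
      unfolding \<beta> by (simp add: norm_mult power_mult_distrib algebra_simps)
    then have "\<beta> = 0 \<or> \<beta> * (norm n)\<^sup>2 = 2 * Re (cnj (\<i> * n) * (x - a))"
      by (simp add: power2_eq_square mult.assoc)
    then show ?thesis using \<beta> by blast
  qed
  obtain \<beta> \<gamma> where *: "b - a = of_real \<beta> * (\<i> * n)" "c - a = of_real \<gamma> * (\<i> * n)"
    "\<beta> = 0 \<or> \<beta> * (norm n)\<^sup>2 = 2 * Re (cnj (\<i> * n) * (x - a))"
    "\<gamma> = 0 \<or> \<gamma> * (norm n)\<^sup>2 = 2 * Re (cnj (\<i> * n) * (x - a))"
    using key[OF x(2) y(2)] key[OF x(3) y(3)] by blast
  have "\<beta> \<noteq> 0" "\<gamma> \<noteq> 0" using * d by auto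
  then have "\<beta> * (norm n)\<^sup>2 = \<gamma> * (norm n)\<^sup>2" using *(3,4) by metis
  then have "\<beta> = \<gamma>" using n0 by simp
  then have "b - a = c - a" using *(1,2) by simp
  then show False using d(3) by simp
qed

context isoradial
begin

section \<open>The two faces at an edge\<close>

definition left_of :: "complex \<Rightarrow> complex \<Rightarrow> complex set \<Rightarrow> bool" where
  "left_of u z f \<longleftrightarrow> f \<in> Faces \<and> convex hull {u, z} \<subseteq> frontier f \<and> (\<forall>p\<in>f. 0 < cross u z p)"

text \<open>A small half disc at the midpoint of the edge, on the left side, avoids all vertices and
  edges. Being connected it lies in one face, and every face to the left of the edge has to enter
  it.\<close>

lemma left_of_ex1:
  assumes z: "z \<in> N u"
  shows "\<exists>!f. left_of u z f"
proof -
  let ?p = "midpoint u z"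
  obtain \<epsilon> where \<epsilon>: "\<epsilon> > 0" "\<And>e. e \<in> E \<Longrightarrow> convex hull e \<inter> ball ?p \<epsilon> \<noteq> {} \<Longrightarrow> ?p \<in> convex hull e"
    "\<And>v. v \<in> V \<Longrightarrow> v \<in> ball ?p \<epsilon> \<Longrightarrow> v = ?p" using isolating_ball by blast
  define H where "H = ball ?p \<epsilon> \<inter> {p. 0 < cross u z p}"
  have uz: "u \<noteq> z" by (rule neighbourD[OF z])
  \<comment> \<open>The point at distance \<open>\<delta>\<close> from the midpoint on the left
    perpendicular; it shows that the half disc accumulates at the midpoint.\<close>
  define q where "q = (\<lambda>\<delta>. ?p + of_real \<delta> * (\<i> * (z - u)) / of_real (norm (z - u)))"
  have q_cross: "0 < cross u z (q \<delta>)" if "\<delta> > 0" for \<delta>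
  proof -
    have "cross u z (q \<delta>) = cross u z ?p + Im (cnj (z - u) * (of_real \<delta> * (\<i> * (z - u)) / of_real (norm (z - u))))"
      by (simp only: cross_def q_def flip: plus_complex.sel distrib_left) (simp add: algebra_simps)
    also have "cnj (z - u) * (of_real \<delta> * (\<i> * (z - u)) / of_real (norm (z - u))) =
        of_real \<delta> * \<i> * ((z - u) * cnj (z - u)) / of_real (norm (z - u))" by (simp add: mult_ac)
    also have "\<dots> = of_real (\<delta> * norm (z - u)) * \<i>"
      unfolding complex_norm_square[symmetric] using uz by (simp add: power2_eq_square)
    finally show ?thesis using that uz by simp
  qed
  have q_dist: "dist (q \<delta>) ?p = \<delta>" if "\<delta> > 0" for \<delta>
    using that uz by (simp add: q_def dist_norm norm_mult norm_divide)
  have near: "\<exists>x\<in>H. dist x ?p < \<eta>" if "\<eta> > 0" for \<eta>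
  proof -
    let ?\<delta> = "min \<eta> \<epsilon> / 2"
    have \<delta>: "?\<delta> > 0" using that \<epsilon> by simp
    have "q ?\<delta> \<in> H" using q_cross[OF \<delta>] q_dist[OF \<delta>] that \<epsilon>(1) by (simp add: H_def dist_commute)
    then show ?thesis using q_dist[OF \<delta>] that \<epsilon>(1) by (intro bexI[of _ "q ?\<delta>"]) auto
  qed
  have "connected H" unfolding H_def by (intro convex_connected convex_Int convex_ball convex_cross_pos)
  moreover have "H \<noteq> {}" using near[of 1] by auto
  moreover have "H \<inter> V = {}"
  proof (rule ccontr)
    assume "H \<inter> V \<noteq> {}"
    then obtain x where "x \<in> V" "x \<in> ball ?p \<epsilon>" by (auto simp: H_def)
    then show False using \<epsilon>(3)[of x] midpoint_edge(3)[OF z] by simp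
  qed
  moreover have "H \<inter> convex hull e = {}" if "e \<in> E" for e
  proof (rule ccontr)
    assume "H \<inter> convex hull e \<noteq> {}"
    then obtain x where x: "x \<in> ball ?p \<epsilon>" "0 < cross u z x" "x \<in> convex hull e" by (auto simp: H_def)
    then have "convex hull e \<inter> ball ?p \<epsilon> \<noteq> {}" by blast
    then have "?p \<in> convex hull e" by (rule \<epsilon>(2)[OF that])
    then have "{u, z} = e" by (rule edges_meet[OF neighbourD(1)[OF z] that midpoint_edge(1)[OF z] _ midpoint_edge(2)[OF z]])
    then have "cross u z x = 0" using x(3) cross_segment by (auto simp: segment_convex_hull)
    then show False using x(2) by simp
  qed
  ultimately obtain f where f: "f \<in> Faces" "H \<subseteq> f" using face_maximal by metis
  show ?thesis
  proof (rule ex1I)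
    have "?p \<in> closure f"
      using near f(2) closure_approachable by blast
    moreover have "?p \<notin> f" using face_disjoint_edge[OF f(1) neighbourD(1)[OF z]] midpoint_edge(1)[OF z] by blast
    ultimately have "?p \<in> frontier f" using interior_subset by (auto simp: frontier_def)
    then have fr: "convex hull {u, z} \<subseteq> frontier f"
      by (rule edge_in_frontier[OF f(1) neighbourD(1)[OF z] midpoint_edge(1,2)[OF z]])
    obtain x where "x \<in> H" using \<open>H \<noteq> {}\<close> by auto
    then have "x \<in> f" "0 < cross u z x" using f by (auto simp: H_def)
    then show "left_of u z f" using face_side[OF f(1) z fr] f(1) fr unfolding left_of_def by fastforce
  next
    fix g assume g: "left_of u z g"
    then have "?p \<in> frontier g" using midpoint_edge(1)[OF z] by (auto simp: left_of_def)
    then obtain x where x: "x \<in> g" "dist x ?p < \<epsilon>"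
      using \<epsilon>(1) closure_approachable[of ?p g] by (auto simp: frontier_def)
    then have "x \<in> H" using g by (auto simp: H_def left_of_def dist_commute)
    then show "g = f" using faces_disjoint[of g f x] f g x by (auto simp: left_of_def)
  qed
qed

text \<open>The face to the right of the edge needs no name of its own: it is
  \<open>left_face z u\<close>.\<close>

definition left_face :: "complex \<Rightarrow> complex \<Rightarrow> complex set" where
  "left_face u z = (THE f. left_of u z f)"

lemma left_of_left_face: "z \<in> N u \<Longrightarrow> left_of u z (left_face u z)"
  unfolding left_face_def by (rule theI'[OF left_of_ex1])

lemma left_face_eqI: "z \<in> N u \<Longrightarrow> left_of u z f \<Longrightarrow> left_face u z = f"
  using left_of_ex1 left_of_left_face by blast

lemma left_face_face: "z \<in> N u \<Longrightarrow> left_face u z \<in> Faces"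
  and left_face_frontier: "z \<in> N u \<Longrightarrow> convex hull {u, z} \<subseteq> frontier (left_face u z)"
  and left_face_cross: "z \<in> N u \<Longrightarrow> p \<in> left_face u z \<Longrightarrow> 0 < cross u z p"
  using left_of_left_face by (auto simp: left_of_def)

lemma left_face_ends: "z \<in> N u \<Longrightarrow> u \<in> frontier (left_face u z)" "z \<in> N u \<Longrightarrow> z \<in> frontier (left_face u z)"
  using left_face_frontier hull_subset[of "{u, z}" convex] by blast+

lemma left_face_swap_neq: "z \<in> N u \<Longrightarrow> left_face u z \<noteq> left_face z u"
proof
  assume z: "z \<in> N u" and eq: "left_face u z = left_face z u"
  obtain p where p: "p \<in> left_face u z" using face_nonempty[OF left_face_face[OF z]] by auto
  then have "0 < cross u z p" "0 < cross z u p" using left_face_cross[OF z] left_face_cross[OF neighbourD(5)[OF z]] eq by auto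
  then show False using cross_swap[of z u p] by simp
qed

lemma incident_faces_eq:
  assumes z: "z \<in> N u"
  shows "incident_faces V E {u, z} = {left_face u z, left_face z u}"
proof -
  have "f = left_face u z \<or> f = left_face z u" if f: "f \<in> Faces" "convex hull {u, z} \<subseteq> frontier f" for f
    using face_side[OF f(1) z f(2)]
  proof
    assume "\<forall>p\<in>f. 0 < cross u z p"
    then have "left_of u z f" using f by (simp add: left_of_def)
    then show ?thesis using left_face_eqI[OF z] by simp
  next
    assume "\<forall>p\<in>f. cross u z p < 0"
    then have "left_of z u f" using f cross_swap[of z u] by (simp add: left_of_def insert_commute)
    then show ?thesis using left_face_eqI[OF neighbourD(5)[OF z]] by simp
  qed
  then show ?thesis
    using left_face_face[OF z] left_face_face[OF neighbourD(5)[OF z]] left_face_frontier[OF z] left_face_frontier[OF neighbourD(5)[OF z]]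
    unfolding incident_faces_def by (auto simp: insert_commute)
qed

section \<open>Circumcentres and the faces around a vertex\<close>

definition centre :: "complex set \<Rightarrow> complex" where "centre = circumcentre V"

text \<open>Three vertices of the boundary cycle determine the circle, so the description in
  \<open>circumcentre\<close> denotes the centre granted by isoradiality.\<close>

lemma centre_in: "f \<in> Faces \<Longrightarrow> centre f \<in> f"
  and centre_dist: "f \<in> Faces \<Longrightarrow> w \<in> V \<Longrightarrow> w \<in> frontier f \<Longrightarrow> dist (centre f) w = h / 2"
proof -
  assume f: "f \<in> Faces"
  obtain c where c: "c \<in> f" "V \<inter> frontier f \<subseteq> sphere c (h / 2)" using face_has_centre[OF f] .
  obtain vs where vs: "3 \<le> length vs" "distinct vs"
    "\<And>i. i < length vs \<Longrightarrow> {vs ! i, vs ! (Suc i mod length vs)} \<in> E"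
    "frontier f = (\<Union>i<length vs. closed_segment (vs ! i) (vs ! (Suc i mod length vs)))"
    by (rule face_cycle[OF f]) (rule that; assumption)
  have v: "vs ! i \<in> V \<inter> frontier f" if "i < length vs" for i
    using edge_subset_V[OF vs(3)[OF that]] vs(4) that by auto
  have len: "0 < length vs" "1 < length vs" "2 < length vs" using vs(1) by linarith+
  have "x = c" if "face_vertices V f \<subseteq> sphere x r" for x r
  proof (rule circle_centre_unique)
    note len
    then show "vs ! 0 \<noteq> vs ! 1" "vs ! 0 \<noteq> vs ! 2" "vs ! 1 \<noteq> vs ! 2"
      using vs(2) by (simp_all add: nth_eq_iff_index_eq)
    show "dist x (vs ! 0) = r" "dist x (vs ! 1) = r" "dist x (vs ! 2) = r"
      using that len v[of 0] v[of 1] v[of 2] by (auto simp: face_vertices_def)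
    show "dist c (vs ! 0) = h / 2" "dist c (vs ! 1) = h / 2" "dist c (vs ! 2) = h / 2"
      using c len v[of 0] v[of 1] v[of 2] by auto
  qed
  note uniq = this
  have centre: "centre f = c"
    unfolding centre_def circumcentre_def
  proof (rule the_equality)
    show "\<exists>r. face_vertices V f \<subseteq> sphere c r" unfolding face_vertices_def using c(2) by (rule exI)
  qed (erule exE, rule uniq)
  show "centre f \<in> f" using centre c by simp
  show "dist (centre f) w = h / 2" if "w \<in> V" "w \<in> frontier f" using centre c(2) that by auto
qed

text \<open>If the face is on the same side of both edges, each far end lies weakly on that side of
  the other edge. By antisymmetry u, z1, z2 are collinear, and they lie on one circle. The factor
  \<open>\<sigma>\<close> treats left and right together.\<close>

lemma same_side_unique:
  assumes f: "f \<in> Faces" and z1: "z1 \<in> N u" "convex hull {u, z1} \<subseteq> frontier f"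
    and z2: "z2 \<in> N u" "convex hull {u, z2} \<subseteq> frontier f"
    and s: "\<sigma> \<noteq> 0" "\<forall>p\<in>f. 0 < \<sigma> * cross u z1 p" "\<forall>p\<in>f. 0 < \<sigma> * cross u z2 p"
  shows "z1 = z2"
proof -
  have ends: "u \<in> frontier f" "z1 \<in> frontier f" "z2 \<in> frontier f"
    using z1(2) z2(2) hull_subset[of "{u, z1}" convex] hull_subset[of "{u, z2}" convex] by auto
  have cl: "0 \<le> \<sigma> * cross u z q" if "\<forall>p\<in>f. 0 < \<sigma> * cross u z p" "q \<in> frontier f" for z q
  proof -
    have "closed {p. 0 \<le> \<sigma> * cross u z p}"
      by (intro closed_Collect_le continuous_intros)
    moreover have "f \<subseteq> {p. 0 \<le> \<sigma> * cross u z p}" using that by (auto intro: less_imp_le)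
    ultimately have "closure f \<subseteq> {p. 0 \<le> \<sigma> * cross u z p}" by (rule closure_minimal[rotated])
    then show ?thesis using that(2) by (auto simp: frontier_def)
  qed
  have "0 \<le> \<sigma> * cross u z1 z2" "0 \<le> \<sigma> * cross u z2 z1" using cl s ends by auto
  moreover have "cross u z2 z1 = - cross u z1 z2" by (simp add: cross_def algebra_simps)
  ultimately have "cross u z1 z2 = 0" using s(1) by (auto simp: mult_le_0_iff zero_le_mult_iff)
  then obtain t where t: "z2 = u + of_real t * (z1 - u)" using cross_zero_collinear neighbourD(2)[OF z1(1)] by blast
  have eq: "(norm (u - centre f))\<^sup>2 = (h / 2)\<^sup>2" "(norm (z1 - centre f))\<^sup>2 = (h / 2)\<^sup>2" "(norm (z2 - centre f))\<^sup>2 = (h / 2)\<^sup>2"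
    using centre_dist[OF f neighbourD(3)[OF z1(1)]] centre_dist[OF f neighbourD(4)[OF z1(1)]] centre_dist[OF f neighbourD(4)[OF z2(1)]] ends
    by (simp_all only: dist_norm norm_minus_commute)
  have "(norm (z2 - centre f))\<^sup>2 = (1 - t) * (norm (u - centre f))\<^sup>2 + t * (norm (z1 - centre f))\<^sup>2 - t * (1 - t) * (norm (z1 - u))\<^sup>2"
    unfolding t cmod_power2 by (simp add: algebra_simps power2_eq_square)
  then have "t * (1 - t) * (norm (z1 - u))\<^sup>2 = 0" unfolding eq by (simp add: algebra_simps)
  then have "t = 0 \<or> t = 1" using neighbourD(2)[OF z1(1)] by auto
  then show ?thesis using t neighbourD(2)[OF z2(1)] by auto
qed

text \<open>The neighbours of \<open>u\<close> before and after it on the boundary cycle. The face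
  cannot be on the same side of both edges, so it is to the left of one and to the right of the
  other; the orientation of the cycle is unknown, which leaves two cases.\<close>

lemma corner:
  assumes f: "f \<in> Faces" and u: "u \<in> V" "u \<in> frontier f"
  obtains z1 z2 where "z1 \<in> N u" "left_face u z1 = f" "z2 \<in> N u" "left_face z2 u = f"
proof -
  obtain vs where vs: "3 \<le> length vs" "distinct vs"
    "\<And>i. i < length vs \<Longrightarrow> {vs ! i, vs ! (Suc i mod length vs)} \<in> E"
    "frontier f = (\<Union>i<length vs. closed_segment (vs ! i) (vs ! (Suc i mod length vs)))"
    by (rule face_cycle[OF f]) (rule that; assumption)
  let ?n = "length vs"
  obtain i where i: "i < ?n" "u \<in> closed_segment (vs ! i) (vs ! (Suc i mod ?n))" using u(2) vs(4) by auto
  then have "u \<in> {vs ! i, vs ! (Suc i mod ?n)}"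
    using vertex_on_edge[OF vs(3)[OF i(1)]] u(1) by (simp add: segment_convex_hull)
  moreover have "Suc i mod ?n < ?n" using vs(1) by (intro mod_less_divisor) linarith
  ultimately obtain j where j: "j < ?n" "u = vs ! j" using i(1) by auto
  \<comment> \<open>Cyclic predecessor of \<open>j\<close>. As the cycle has at least three
    vertices, it differs from the successor.\<close>
  define k where "k = (if j = 0 then ?n - 1 else j - 1)"
  have k: "k < ?n" "Suc k mod ?n = j" using j vs(1) by (auto simp: k_def)
  let ?a = "vs ! (Suc j mod ?n)" and ?b = "vs ! k"
  have "Suc j mod ?n \<noteq> k" using j(1) vs(1) by (auto simp: k_def mod_Suc)
  then have ab: "?a \<noteq> ?b" using k(1) vs(2) mod_less_divisor[of ?n "Suc j"] order.strict_trans1[OF le0 j(1)]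
    by (subst nth_eq_iff_index_eq) simp_all
  have a: "?a \<in> N u" "convex hull {u, ?a} \<subseteq> frontier f"
    using vs(3)[OF j(1)] vs(4) j by (auto simp: neighbours_def segment_convex_hull)
  have "{?b, u} \<in> E" "convex hull {?b, u} \<subseteq> frontier f"
    using vs(3)[OF k(1)] vs(4) k j(2) by (auto simp flip: segment_convex_hull)
  then have b: "?b \<in> N u" "convex hull {u, ?b} \<subseteq> frontier f"
    by (auto simp: neighbours_def insert_commute)
  have neg: "left_of z u f" if "convex hull {u, z} \<subseteq> frontier f" "\<forall>p\<in>f. cross u z p < 0" for z
    using that f cross_swap[of z u] by (simp add: left_of_def insert_commute)
  have pos: "left_of u z f" if "convex hull {u, z} \<subseteq> frontier f" "\<forall>p\<in>f. 0 < cross u z p" for z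
    using that f by (simp add: left_of_def)
  have LFz: "left_face u z = f" if "z \<in> N u" "left_of u z f" for z using left_face_eqI that by blast
  have LFz': "left_face z u = f" if "z \<in> N u" "left_of z u f" for z using left_face_eqI[OF neighbourD(5)] that by blast
  consider "\<forall>p\<in>f. 0 < cross u ?a p" "\<forall>p\<in>f. 0 < cross u ?b p"
    | "\<forall>p\<in>f. cross u ?a p < 0" "\<forall>p\<in>f. cross u ?b p < 0"
    | "\<forall>p\<in>f. 0 < cross u ?a p" "\<forall>p\<in>f. cross u ?b p < 0"
    | "\<forall>p\<in>f. cross u ?a p < 0" "\<forall>p\<in>f. 0 < cross u ?b p"
    using face_side[OF f a] face_side[OF f b] by blast
  then show ?thesis
  proof cases
    case 1
    then show ?thesis using same_side_unique[OF f a b, of 1] ab by simp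
  next
    case 2
    then show ?thesis using same_side_unique[OF f a b, of "-1"] ab by simp
  next
    case 3
    then show ?thesis using that[of ?a ?b] LFz[OF a(1) pos[OF a(2)]] LFz'[OF b(1) neg[OF b(2)]] a(1) b(1) by blast
  next
    case 4
    then show ?thesis using that[of ?b ?a] LFz[OF b(1) pos[OF b(2)]] LFz'[OF a(1) neg[OF a(2)]] a(1) b(1) by blast
  qed
qed

lemma left_face_inj:
  assumes z: "z \<in> N u" and z': "z' \<in> N u" and eq: "left_face u z = left_face u z'"
  shows "z = z'"
  using left_face_face[OF z] z left_face_frontier[OF z] z'
proof (rule same_side_unique[of _ _ _ _ 1])
  show "convex hull {u, z'} \<subseteq> frontier (left_face u z)" using left_face_frontier[OF z'] eq by simp
  show "\<forall>p\<in>left_face u z. 0 < 1 * cross u z p" using left_face_cross[OF z] by simp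
  show "\<forall>p\<in>left_face u z. 0 < 1 * cross u z' p" using left_face_cross[OF z'] eq by simp
qed simp

lemma left_face_inj':
  assumes z: "z \<in> N u" and z': "z' \<in> N u" and eq: "left_face z u = left_face z' u"
  shows "z = z'"
  using left_face_face[OF neighbourD(5)[OF z]] z
proof (rule same_side_unique[of _ _ _ _ "-1"])
  show "convex hull {u, z} \<subseteq> frontier (left_face z u)" "convex hull {u, z'} \<subseteq> frontier (left_face z u)"
    using left_face_frontier[OF neighbourD(5)[OF z]] left_face_frontier[OF neighbourD(5)[OF z']] eq by (simp_all add: insert_commute)
  show "\<forall>p\<in>left_face z u. 0 < - 1 * cross u z p" "\<forall>p\<in>left_face z u. 0 < - 1 * cross u z' p"
    using left_face_cross[OF neighbourD(5)[OF z]] left_face_cross[OF neighbourD(5)[OF z']] eq cross_swap[of u] by simp_all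
qed (use z' in simp_all)

lemma bij_left_face:
  assumes u: "u \<in> V"
  shows "bij_betw (left_face u) (N u) {f \<in> Faces. u \<in> frontier f}"
    and "bij_betw (\<lambda>z. left_face z u) (N u) {f \<in> Faces. u \<in> frontier f}"
proof -
  have "left_face u z \<in> {f \<in> Faces. u \<in> frontier f}" "left_face z u \<in> {f \<in> Faces. u \<in> frontier f}" if "z \<in> N u" for z
    using left_face_face left_face_ends that neighbourD(5)[OF that] by auto
  moreover have "\<exists>z\<in>N u. f = left_face u z" "\<exists>z\<in>N u. f = left_face z u" if f: "f \<in> {f \<in> Faces. u \<in> frontier f}" for f
  proof -
    obtain z1 z2 where "z1 \<in> N u" "left_face u z1 = f" "z2 \<in> N u" "left_face z2 u = f"
      using corner[of f u] f u by blast
    then show "\<exists>z\<in>N u. f = left_face u z" "\<exists>z\<in>N u. f = left_face z u" by blast+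
  qed
  ultimately show "bij_betw (left_face u) (N u) {f \<in> Faces. u \<in> frontier f}"
    and "bij_betw (\<lambda>z. left_face z u) (N u) {f \<in> Faces. u \<in> frontier f}"
    by (auto simp: bij_betw_def inj_on_def image_iff intro: left_face_inj left_face_inj')
qed

text \<open>The telescoping around a vertex, expressed without enumerating its neighbours in cyclic
  order: left faces and right faces run through the same set.\<close>

lemma sum_left_face_swap: "u \<in> V \<Longrightarrow> (\<Sum>z\<in>N u. g (left_face u z)) = (\<Sum>z\<in>N u. g (left_face z u))"
  using sum.reindex_bij_betw[OF bij_left_face(1), of u g] sum.reindex_bij_betw[OF bij_left_face(2), of u g] by simp

lemma finite_N: "finite (N u)"
  by (rule finite_subset[OF _ locally_finite[of "cball u h"]]) (use neighbourD(4) edge_length_le in auto)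

lemma N_nonempty:
  assumes "u \<in> V"
  shows "N u \<noteq> {}"
proof -
  obtain f where f: "f \<in> Faces" "u \<in> frontier f" using on_frontier[OF disjI1[OF assms]] .
  obtain z1 z2 where "z1 \<in> N u" "left_face u z1 = f" "z2 \<in> N u" "left_face z2 u = f"
    using corner[OF f(1) assms f(2)] .
  then show ?thesis by blast
qed

section \<open>The rhombus of an edge and the moments of the weights\<close>

definition rad :: "complex \<Rightarrow> complex \<Rightarrow> complex" where "rad u z = centre (left_face u z) - u"
definition rad' :: "complex \<Rightarrow> complex \<Rightarrow> complex" where "rad' u z = centre (left_face z u) - u"

text \<open>Ends and circumcentres form a rhombus of side h / 2. Multiplying by the conjugate of d =
  z - u turns the edge into the real axis: both centres get the same real part because they are on
  the bisector, and opposite imaginary parts because they have equal modulus and lie on different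
  sides.\<close>

lemma kite:
  assumes z: "z \<in> N u"
  shows "norm (rad u z) = h / 2" "norm (rad' u z) = h / 2"
    and "rad u z + rad' u z = z - u"
    and "0 < Im (cnj (z - u) * rad u z)"
    and "edge_weight V E u z = norm (rad u z - rad' u z) / norm (z - u)"
    and "rad u z - rad' u z = \<i> * of_real (edge_weight V E u z) * (z - u)"
    and "0 < edge_weight V E u z"
    and "edge_weight V E u z * (norm (z - u))\<^sup>2 = 2 * Im (cnj (z - u) * rad u z)"
proof -
  note z' = neighbourD(5)[OF z]
  define a b d where "a = rad u z" "b = rad' u z" "d = z - u"
  have d0: "d \<noteq> 0" using neighbourD(2)[OF z] by (simp add: a_b_d_def)
  have "dist (centre (left_face u z)) u = h / 2" "dist (centre (left_face u z)) z = h / 2"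
    "dist (centre (left_face z u)) u = h / 2" "dist (centre (left_face z u)) z = h / 2"
    using centre_dist left_face_face left_face_ends neighbourD(3,4)[OF z] z z' by blast+
  then have n: "norm a = h / 2" "norm (d - a) = h / 2" "norm b = h / 2" "norm (d - b) = h / 2"
    by (auto simp: a_b_d_def rad_def rad'_def dist_norm norm_minus_commute algebra_simps)
  then show "norm (rad u z) = h / 2" "norm (rad' u z) = h / 2" by (simp_all add: a_b_d_def)
  have pos: "0 < Im (cnj d * a)" using left_face_cross[OF z centre_in[OF left_face_face[OF z]]]
    by (simp add: a_b_d_def rad_def cross_def)
  then show "0 < Im (cnj (z - u) * rad u z)" by (simp add: a_b_d_def)
  have neg: "Im (cnj d * b) < 0" using left_face_cross[OF z' centre_in[OF left_face_face[OF z']]] cross_swap[of z u]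
    by (simp add: a_b_d_def rad'_def cross_def)
  have re: "2 * Re (cnj d * w) = (norm d)\<^sup>2" if "norm w = h / 2" "norm (d - w) = h / 2" for w
  proof -
    have "(norm (d - w))\<^sup>2 = (norm d)\<^sup>2 - 2 * Re (cnj d * w) + (norm w)\<^sup>2"
      unfolding cmod_power2 by (simp add: power2_eq_square algebra_simps)
    then show ?thesis using that by simp
  qed
  have "(norm (cnj d * a))\<^sup>2 = (norm (cnj d * b))\<^sup>2" using n by (simp add: norm_mult)
  then have "(Im (cnj d * a))\<^sup>2 = (Im (cnj d * b))\<^sup>2"
    using re[OF n(1,2)] re[OF n(3,4)] cmod_power2[of "cnj d * a"] cmod_power2[of "cnj d * b"]
    by (smt (verit))
  \<comment> \<open>The squares agree; that the faces lie on opposite sides of the edge decides the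
    sign.\<close>
  then have im: "Im (cnj d * b) = - Im (cnj d * a)" using pos neg by (auto simp: power2_eq_iff)
  have dd: "d * cnj d = of_real ((norm d)\<^sup>2)" by (simp add: complex_norm_square[symmetric])
  have "cnj d * (a + b) = cnj d * d"
    using re[OF n(1,2)] re[OF n(3,4)] im dd by (simp add: complex_eq_iff distrib_left mult.commute[of d])
  then have ab: "a + b = d" using d0 by simp
  then show "rad u z + rad' u z = z - u" by (simp add: a_b_d_def)
  define w where "w = 2 * Im (cnj d * a) / (norm d)\<^sup>2"
  have w: "0 < w" using pos d0 by (simp add: w_def)
  have "cnj d * (a - b) = \<i> * of_real (2 * Im (cnj d * a))"
    using re[OF n(1,2)] re[OF n(3,4)] im by (simp add: complex_eq_iff right_diff_distrib)
  also have "\<dots> = \<i> * of_real w * (d * cnj d)" unfolding dd using d0 by (simp add: w_def)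
  finally have "cnj d * (a - b) = cnj d * (\<i> * of_real w * d)" by (simp add: mult_ac)
  then have amb: "a - b = \<i> * of_real w * d" using d0 by simp
  have ew: "edge_weight V E u z = norm (a - b) / norm d"
    by (simp add: edge_weight_def dual_edge_def incident_faces_eq[OF z] diameter_pair a_b_d_def rad_def rad'_def
        dist_norm norm_minus_commute flip: centre_def)
  then have ww: "edge_weight V E u z = w" using amb w d0 by (simp add: norm_mult)
  show "edge_weight V E u z = norm (rad u z - rad' u z) / norm (z - u)" using ew by (simp add: a_b_d_def)
  show "rad u z - rad' u z = \<i> * of_real (edge_weight V E u z) * (z - u)" using amb ww by (simp add: a_b_d_def)
  show "0 < edge_weight V E u z" using w ww by simp
  show "edge_weight V E u z * (norm (z - u))\<^sup>2 = 2 * Im (cnj (z - u) * rad u z)"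
    using d0 unfolding ww w_def by (simp add: a_b_d_def)
qed

lemma weight_first_moment:
  assumes u: "u \<in> V"
  shows "(\<Sum>z\<in>N u. of_real (edge_weight V E u z) * (z - u)) = 0"
proof -
  have "(\<Sum>z\<in>N u. of_real (edge_weight V E u z) * (z - u)) = (\<Sum>z\<in>N u. - \<i> * rad u z - - \<i> * rad' u z)"
  proof (intro sum.cong refl)
    fix z assume "z \<in> N u"
    have "- \<i> * rad u z - - \<i> * rad' u z = - \<i> * (rad u z - rad' u z)" by (simp add: algebra_simps)
    then show "of_real (edge_weight V E u z) * (z - u) = - \<i> * rad u z - - \<i> * rad' u z"
      unfolding kite(6)[OF \<open>z \<in> N u\<close>] by (simp flip: mult.assoc)
  qed
  also have "\<dots> = 0"
    unfolding sum_subtractf rad_def rad'_def using sum_left_face_swap[OF u, of "\<lambda>f. - \<i> * (centre f - u)"] by simp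
  finally show ?thesis .
qed

text \<open>Since z - u is the sum of the two radii and \<omega> (z - u) is - \<i> times their
  difference, each summand is - \<i> times a difference of squares.\<close>

lemma weight_second_moment:
  assumes u: "u \<in> V"
  shows "(\<Sum>z\<in>N u. of_real (edge_weight V E u z) * (z - u)\<^sup>2) = 0"
proof -
  have "of_real (edge_weight V E u z) * (z - u)\<^sup>2 = - \<i> * (rad u z)\<^sup>2 - - \<i> * (rad' u z)\<^sup>2" if "z \<in> N u" for z
  proof -
    have "- \<i> * (rad u z)\<^sup>2 - - \<i> * (rad' u z)\<^sup>2 = - \<i> * (rad u z - rad' u z) * (rad u z + rad' u z)"
      by (simp add: power2_eq_square algebra_simps)
    then show ?thesis unfolding kite(3,6)[OF that] by (simp add: power2_eq_square flip: mult.assoc)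
  qed
  then have "(\<Sum>z\<in>N u. of_real (edge_weight V E u z) * (z - u)\<^sup>2) =
      (\<Sum>z\<in>N u. - \<i> * (rad u z)\<^sup>2 - - \<i> * (rad' u z)\<^sup>2)" by (intro sum.cong) auto
  also have "\<dots> = 0"
    unfolding sum_subtractf rad_def rad'_def using sum_left_face_swap[OF u, of "\<lambda>f. - \<i> * (centre f - u)\<^sup>2"] by simp
  finally show ?thesis .
qed

end

section \<open>Dual faces\<close>

text \<open>Carries the area formula \<open>content_triangle\<close> over to the complex
  plane.\<close>

lemma lborel_complex_eq: "(lborel :: complex measure) = distr (lborel :: (real ^ 2) measure) borel (\<lambda>v. Complex (v $ 1) (v $ 2))"
proof (rule lborel_eqI)
  let ?f = "\<lambda>v :: real ^ 2. Complex (v $ 1) (v $ 2)"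
  have f[measurable]: "?f \<in> borel_measurable borel"
    by (intro borel_measurable_continuous_onI) (intro continuous_intros continuous_on_Complex)
  fix l u :: complex assume le: "\<And>b. b \<in> Basis \<Longrightarrow> l \<bullet> b \<le> u \<bullet> b"
  let ?l = "vector [Re l, Im l] :: real ^ 2" and ?u = "vector [Re u, Im u] :: real ^ 2"
  have "?f -` box l u = box ?l ?u"
    by (auto simp: mem_box_cart in_box_complex_iff forall_2)
  moreover have "emeasure lborel (box ?l ?u) = (\<Prod>b\<in>Basis. (u - l) \<bullet> b)"
  proof -
    have "emeasure lborel (box ?l ?u) = (\<Prod>b\<in>Basis. (?u - ?l) \<bullet> b)"
    proof (rule emeasure_lborel_box)
      have "?l $ i \<le> ?u $ i" for i :: 2
        using exhaust_2[of i] le[of 1] le[of \<i>] by (auto simp: Basis_complex_def)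
      then show "?l \<bullet> b \<le> ?u \<bullet> b" if "b \<in> Basis" for b
        using that by (auto simp: Basis_vec_def inner_axis)
    qed
    also have "(Basis :: (real ^ 2) set) = {axis 1 1, axis 2 1}" by (auto simp: Basis_vec_def UNIV_2)
    finally show ?thesis by (simp add: Basis_complex_def inner_axis axis_eq_axis)
  qed
  ultimately show "emeasure (distr lborel borel ?f) (box l u) = (\<Prod>b\<in>Basis. (u - l) \<bullet> b)"
    by (simp add: emeasure_distr)
qed simp

lemma measure_triangle:
  fixes A B C :: complex
  shows "measure lebesgue (convex hull {A, B, C}) = \<bar>Im (cnj (B - A) * (C - A))\<bar> / 2"
proof -
  let ?f = "\<lambda>v :: real ^ 2. Complex (v $ 1) (v $ 2)" and ?g = "\<lambda>z. vector [Re z, Im z] :: real ^ 2"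
  have f[measurable]: "?f \<in> borel_measurable borel"
    by (intro borel_measurable_continuous_onI) (intro continuous_intros continuous_on_Complex)
  have lin: "linear ?f" by (rule linearI) (auto simp: complex_eq_iff)
  have fg: "?f (?g z) = z" for z by simp
  have "?f ` (convex hull {?g A, ?g B, ?g C}) = convex hull {A, B, C}"
    by (subst convex_hull_linear_image[OF lin]) simp
  then have "?f -` (convex hull {A, B, C}) = convex hull {?g A, ?g B, ?g C}"
    using inj_vimage_image_eq[of ?f "convex hull {?g A, ?g B, ?g C}"]
    by (simp add: inj_def vec_eq_iff forall_2)
  moreover have m: "convex hull {A, B, C} \<in> sets borel"
    by (intro borel_compact finite_imp_compact_convex_hull) auto
  ultimately have "measure lborel (convex hull {A, B, C}) = measure lborel (convex hull {?g A, ?g B, ?g C})"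
    by (subst lborel_complex_eq) (simp add: measure_distr)
  moreover have "measure lebesgue (convex hull {A, B, C}) = measure lborel (convex hull {A, B, C})"
    using m by simp
  ultimately show ?thesis by (simp add: content_triangle algebra_simps abs_minus_commute)
qed

text \<open>After weighting and summing over neighbours the last term vanishes by the second moment,
  leaving a positive multiple of the squared norm of \<open>w\<close>.\<close>

lemma Re_cnj_squared: "2 * (Re (cnj d * w))\<^sup>2 = (norm d)\<^sup>2 * (norm w)\<^sup>2 + Re (cnj (d\<^sup>2) * w\<^sup>2)"
  unfolding cmod_power2 by (simp add: power2_eq_square algebra_simps)

lemma negligible_Im_cnj: "w \<noteq> 0 \<Longrightarrow> negligible {p. Im (cnj w * (p - u)) = 0}"
proof -
  assume "w \<noteq> 0"
  then have "negligible {p. (\<i> * w) \<bullet> p = (\<i> * w) \<bullet> u}" by (intro negligible_hyperplane) auto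
  moreover have "{p. (\<i> * w) \<bullet> p = (\<i> * w) \<bullet> u} = {p. Im (cnj w * (p - u)) = 0}"
    by (auto simp: inner_complex_def algebra_simps)
  ultimately show ?thesis by simp
qed

lemma negligible_cross: "u \<noteq> z \<Longrightarrow> negligible {p. cross u z p = 0}"
  using negligible_Im_cnj[of "z - u" u] by (simp add: cross_def)

context isoradial
begin

text \<open>The intersection \<open>H\<close> of the open half planes belonging to the edges of
  \<open>f\<close> is connected, contains \<open>f\<close> and cannot meet its frontier, hence
  equals \<open>f\<close>.\<close>

lemma face_convex:
  assumes f: "f \<in> Faces"
  shows "convex f"
proof -
  define H where "H = (\<Inter>(u, z)\<in>{(u, z). z \<in> N u \<and> left_face u z = f}. {p. 0 < cross u z p})"
  have "convex H" unfolding H_def by (intro convex_INT) (auto intro: convex_cross_pos)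
  have fH: "f \<subseteq> H" using left_face_cross by (auto simp: H_def)
  have "H \<inter> frontier f = {}"
  proof (rule ccontr)
    assume "H \<inter> frontier f \<noteq> {}"
    then obtain p where p: "p \<in> H" "p \<in> frontier f" by auto
    obtain e where e: "e \<in> E" "p \<in> convex hull e" "convex hull e \<subseteq> frontier f"
      using frontier_edge[OF f p(2)] .
    obtain u z where uz: "e = {u, z}" using edge_cases[OF e(1)] by metis
    then have z: "z \<in> N u" using e(1) by (simp add: neighbours_def)
    have "f \<in> incident_faces V E {u, z}" using f e(3) uz by (simp add: incident_faces_def)
    then have "left_face u z = f \<or> left_face z u = f" using incident_faces_eq[OF z] by auto
    then have "cross u z p \<noteq> 0"
      using p(1) z neighbourD(5)[OF z] cross_swap[of z u p] unfolding H_def by fastforce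
    moreover have "cross u z p = 0" using e(2) uz cross_segment by (simp add: segment_convex_hull)
    ultimately show False by simp
  qed
  moreover have "H \<inter> f \<noteq> {}" using fH face_nonempty[OF f] by auto
  ultimately have "H \<subseteq> f" using connected_Int_frontier[of H f] convex_connected[OF \<open>convex H\<close>] by blast
  then have "f = H" using fH by auto
  then show ?thesis using \<open>convex H\<close> by simp
qed

text \<open>A point of the triangle spanned by \<open>u\<close>, \<open>z\<close> and the
  circumcentre has positive weight at the circumcentre, which is interior; by convexity it is
  interior too.\<close>

lemma in_face:
  assumes f: "f \<in> Faces" and ends: "u \<in> frontier f" "z \<in> frontier f"
    and c: "0 < \<alpha>" "0 \<le> \<beta>" "\<alpha> + \<beta> \<le> 1"
  shows "u + of_real \<alpha> * (centre f - u) + of_real \<beta> * (z - u) \<in> f"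
proof -
  have cl: "convex (closure f)" by (intro convex_closure face_convex f)
  have uz: "u \<in> closure f" "z \<in> closure f" using ends by (auto simp: frontier_def)
  \<comment> \<open>The point of the edge onto which the given point projects from the circumcentre.
    For \<open>\<alpha> = 1\<close> the given point is the circumcentre, and \<open>u\<close> serves
    as a default.\<close>
  define q where "q = (if \<alpha> = 1 then u else u + of_real (\<beta> / (1 - \<alpha>)) * (z - u))"
  have q: "q \<in> closure f"
  proof (cases "\<alpha> = 1")
    case False
    define t where "t = \<beta> / (1 - \<alpha>)"
    have t: "0 \<le> t" "t \<le> 1" using c False by (auto simp: t_def divide_simps)
    have "(1 - t) *\<^sub>R u + t *\<^sub>R z \<in> closure f" using cl uz t by (auto simp: convex_alt)
    then show ?thesis using False by (simp add: q_def scaleR_conv_of_real algebra_simps flip: t_def)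
  qed (simp add: q_def uz)
  have "q - \<alpha> *\<^sub>R (q - centre f) \<in> interior f"
    by (rule mem_interior_closure_convex_shrink[OF face_convex[OF f] _ q c(1)])
       (use c centre_in[OF f] face_open[OF f] in \<open>auto simp: interior_open\<close>)
  moreover have "q - \<alpha> *\<^sub>R (q - centre f) = u + of_real \<alpha> * (centre f - u) + of_real \<beta> * (z - u)"
  proof (cases "\<alpha> = 1")
    case True
    then have "\<beta> = 0" using c by simp
    then show ?thesis using True by (simp add: scaleR_conv_of_real)
  next
    case False
    then have "of_real (1 - \<alpha>) * (q - u) = of_real \<beta> * (z - u)" by (simp add: q_def del: of_real_diff)
    then show ?thesis by (simp add: scaleR_conv_of_real algebra_simps)
  qed
  ultimately show ?thesis using interior_subset by auto
qed

section \<open>Coordinates around a vertex\<close>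

abbreviation "\<omega> \<equiv> edge_weight V E"

lemma rad_eq:
  assumes "z \<in> N u"
  shows "rad u z = (1 + \<i> * of_real (\<omega> u z)) / 2 * (z - u)"
    and "rad' u z = (1 - \<i> * of_real (\<omega> u z)) / 2 * (z - u)"
proof -
  have "2 * rad u z = (rad u z + rad' u z) + (rad u z - rad' u z)" "2 * rad' u z = (rad u z + rad' u z) - (rad u z - rad' u z)"
    by simp_all
  then show "rad u z = (1 + \<i> * of_real (\<omega> u z)) / 2 * (z - u)"
    "rad' u z = (1 - \<i> * of_real (\<omega> u z)) / 2 * (z - u)"
    unfolding kite(3,6)[OF assms] by (simp_all add: field_simps)
qed

text \<open>Coordinates along the two radii: (1, 0) and (0, 1) are the circumcentres, (1, 1) is
  \<open>z\<close>, the edge is the diagonal x = y and the dual edge has x + y = 1.\<close>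

definition kite_point :: "complex \<Rightarrow> complex \<Rightarrow> real \<Rightarrow> real \<Rightarrow> complex" where
  "kite_point u z x y = u + of_real x * rad u z + of_real y * rad' u z"

lemma kite_point_in_face:
  assumes z: "z \<in> N u"
  shows "0 \<le> y \<Longrightarrow> y < x \<Longrightarrow> x \<le> 1 \<Longrightarrow> kite_point u z x y \<in> left_face u z"
    and "0 \<le> x \<Longrightarrow> x < y \<Longrightarrow> y \<le> 1 \<Longrightarrow> kite_point u z x y \<in> left_face z u"
proof -
  note z' = neighbourD(5)[OF z]
  have s: "z - u = rad u z + rad' u z" using kite(3)[OF z] by simp
  have "kite_point u z x y = u + of_real (x - y) * (centre (left_face u z) - u) + of_real y * (z - u)"
    unfolding s kite_point_def by (simp add: rad_def algebra_simps)
  then show "kite_point u z x y \<in> left_face u z" if "0 \<le> y" "y < x" "x \<le> 1"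
    using in_face[OF left_face_face[OF z] left_face_ends[OF z], of "x - y" y] that by simp
  have "kite_point u z x y = u + of_real (y - x) * (centre (left_face z u) - u) + of_real x * (z - u)"
    unfolding s kite_point_def by (simp add: rad'_def algebra_simps)
  then show "kite_point u z x y \<in> left_face z u" if "0 \<le> x" "x < y" "y \<le> 1"
    using in_face[OF left_face_face[OF z'] left_face_ends(2)[OF z'] left_face_ends(1)[OF z'], of "y - x" x] that by simp
qed

lemma kite_point_Re:
  assumes z: "z \<in> N u"
  shows "2 * Re (cnj (z - u) * (kite_point u z x y - u)) = (x + y) * (norm (z - u))\<^sup>2"
  unfolding kite_point_def rad_eq[OF z] cmod_power2 by (simp add: power2_eq_square field_simps)

lemma kite_point_cross:
  assumes z: "z \<in> N u"
  shows "2 * cross u z (kite_point u z x y) = (x - y) * \<omega> u z * (norm (z - u))\<^sup>2"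
    and "2 * cross u (centre (left_face u z)) (kite_point u z x y) = - y * \<omega> u z * (norm (z - u))\<^sup>2"
    and "2 * cross u (centre (left_face z u)) (kite_point u z x y) = x * \<omega> u z * (norm (z - u))\<^sup>2"
  unfolding cross_def kite_point_def rad_def[symmetric] rad'_def[symmetric] rad_eq[OF z] cmod_power2
  by (simp_all add: power2_eq_square field_simps)

text \<open>Normalised so that the value 1 is the perpendicular bisector of \<open>u\<close> and
  \<open>z\<close>, the line carrying the dual edge; values below 1 mean closer to \<open>u\<close>
  than to \<open>z\<close>.\<close>

definition gauge :: "complex \<Rightarrow> complex \<Rightarrow> complex \<Rightarrow> real" where
  "gauge u z p = 2 * Re (cnj (z - u) * (p - u)) / (norm (z - u))\<^sup>2"

text \<open>The neighbour of largest gauge is the one whose sector between its two radii contains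
  \<open>p\<close>. Leaving the sector across either radius would give the next neighbour on that
  side a larger gauge, as both gauges agree on the common radius.\<close>

lemma kite_point_of_max_gauge:
  assumes z: "z \<in> N u" and max: "\<And>z'. z' \<in> N u \<Longrightarrow> gauge u z' p \<le> gauge u z p"
  obtains x y where "0 \<le> x" "0 \<le> y" "x + y = gauge u z p" "p = kite_point u z x y"
proof -
  define d a b w where "d = z - u" "a = rad u z" "b = rad' u z" "w = \<omega> u z"
  note defs = d_a_b_w_def
  define m where "m = gauge u z p"
  have d0: "d \<noteq> 0" using neighbourD(2)[OF z] by (simp add: defs)
  have w: "0 < w" using kite(7)[OF z] by (simp add: defs)
  have a: "a = (1 + \<i> * of_real w) / 2 * d" and b: "b = (1 - \<i> * of_real w) / 2 * d"
    using rad_eq[OF z] by (simp_all add: defs)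
  have nz: "1 + \<i> * of_real t \<noteq> 0" "1 - \<i> * of_real t \<noteq> 0" for t :: real
    by (simp_all add: complex_eq_iff)
  have ab0: "a \<noteq> 0" "b \<noteq> 0" using d0 nz[of w] unfolding a b by simp_all
  have gauge_mult: "2 * Re (cnj (z' - u) * (p - u)) \<le> m * (norm (z' - u))\<^sup>2" if "z' \<in> N u" for z'
    using max[OF that] neighbourD(2)[OF that] by (simp add: gauge_def m_def pos_divide_le_eq)
  have gm: "2 * Re (cnj d * (p - u)) = m * (norm d)\<^sup>2"
    using d0 by (simp add: m_def gauge_def defs)
  have "2 * Re (cnj d * a) = (norm d)\<^sup>2"
    unfolding a cmod_power2 by (simp add: power2_eq_square field_simps)
  moreover have "Re (cnj d * (p - u - of_real m * a)) = Re (cnj d * (p - u)) - m * Re (cnj d * a)"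
    by (simp add: algebra_simps)
  ultimately have "2 * Re (cnj d * (p - u - of_real m * a)) = m * (norm d)\<^sup>2 - m * (norm d)\<^sup>2"
    using gm by (metis mult.left_commute right_diff_distrib)
  then have "Re (cnj d * (p - u - of_real m * a)) = 0" by simp
  then obtain \<beta> where \<beta>: "p - u - of_real m * a = of_real \<beta> * (\<i> * d)"
    using Re_cnj_zero_collinear d0 by blast
  define \<beta>' where "\<beta>' = \<beta> + m * w"
  have "a = b + \<i> * of_real w * d" unfolding a b by (simp add: field_simps)
  then have \<beta>': "p - u - of_real m * b = of_real \<beta>' * (\<i> * d)"
    using \<beta> by (simp add: \<beta>'_def algebra_simps)
  have f: "left_face u z \<in> Faces" "u \<in> V" "u \<in> frontier (left_face u z)" and g: "left_face z u \<in> Faces" "u \<in> frontier (left_face z u)"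
    using z left_face_face left_face_ends neighbourD[OF z] by auto
  have im_mult: "Im (of_real c * w) = c * Im w" for c w by simp
  have inv_im: "Im (inverse ((1 + \<i> * of_real s) * (1 + \<i> * of_real t))) = - (s + t) / (norm ((1 + \<i> * of_real s) * (1 + \<i> * of_real t)))\<^sup>2"
    for s t :: real by (simp add: inverse_complex.simps cmod_power2 algebra_simps)
  have "\<beta> \<le> 0"
  proof -
    \<comment> \<open>The next neighbour counterclockwise: its right face is the left face of the
      edge to \<open>z\<close>, so both edges share the radius \<open>a\<close>.\<close>
    obtain z1 z' where z': "z' \<in> N u" "left_face z' u = left_face u z" using corner[OF f] by metis
    define d' w' where "d' = z' - u" "w' = \<omega> u z'"
    have w': "0 < w'" using kite(7)[OF z'(1)] by (simp add: d'_w'_def)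
    have a': "a = (1 - \<i> * of_real w') / 2 * d'"
      using rad_eq(2)[OF z'(1)] z'(2) by (simp add: d'_w'_def rad'_def defs rad_def)
    have "2 * Re (cnj d' * a) = (norm d')\<^sup>2"
      unfolding a' cmod_power2 by (simp add: power2_eq_square field_simps)
    moreover have pu: "p - u = of_real m * a + of_real \<beta> * (\<i> * d)" using \<beta> by (simp add: algebra_simps)
    have "2 * Re (cnj d' * (p - u)) = m * (2 * Re (cnj d' * a)) + 2 * Re (cnj d' * (of_real \<beta> * (\<i> * d)))"
      unfolding pu by (simp add: algebra_simps)
    ultimately have "2 * Re (cnj d' * (of_real \<beta> * (\<i> * d))) \<le> 0"
      using gauge_mult[OF z'(1)] unfolding d'_w'_def(1)[symmetric] by simp
    then have "0 \<le> \<beta> * Im (cnj d' * d)" by (simp add: algebra_simps)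
    \<comment> \<open>Relative to \<open>a\<close> the direction \<open>d\<close> is turned
      clockwise and \<open>d'\<close> counterclockwise, by the arctangents of \<open>w\<close> and
      \<open>w'\<close>; the angle between them is less than \<pi>.\<close>
    moreover have "Im (cnj d' * d) < 0"
    proof -
      have dd: "d = 2 * a / (1 + \<i> * of_real w)" using nz[of w] unfolding a by simp
      have "d' = 2 * a / (1 - \<i> * of_real w')" using nz[of w'] unfolding a' by simp
      then have dd': "cnj d' = 2 * cnj a / (1 + \<i> * of_real w')" by simp
      have "cnj d' * d = of_real (4 * (norm a)\<^sup>2) * inverse ((1 + \<i> * of_real w') * (1 + \<i> * of_real w))"
        unfolding dd dd' using complex_norm_square[of a] by (simp add: divide_inverse mult_ac)
      then have "Im (cnj d' * d) = 4 * (norm a)\<^sup>2 * (- (w' + w) / (norm ((1 + \<i> * of_real w') * (1 + \<i> * of_real w)))\<^sup>2)"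
        by (simp only: im_mult inv_im)
      also have "\<dots> < 0" using ab0 w w' nz by (intro mult_pos_neg divide_neg_pos) auto
      finally show ?thesis .
    qed
    ultimately show ?thesis by (simp add: zero_le_mult_iff)
  qed
  moreover have "0 \<le> \<beta>'"
  proof -
    obtain z' z2 where z': "z' \<in> N u" "left_face u z' = left_face z u" using corner[OF g(1) f(2) g(2)] by metis
    define d' w' where "d' = z' - u" "w' = \<omega> u z'"
    have w': "0 < w'" using kite(7)[OF z'(1)] by (simp add: d'_w'_def)
    have b': "b = (1 + \<i> * of_real w') / 2 * d'"
      using rad_eq(1)[OF z'(1)] z'(2) by (simp add: d'_w'_def rad'_def defs rad_def)
    have "2 * Re (cnj d' * b) = (norm d')\<^sup>2"
      unfolding b' cmod_power2 by (simp add: power2_eq_square field_simps)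
    moreover have pu: "p - u = of_real m * b + of_real \<beta>' * (\<i> * d)" using \<beta>' by (simp add: algebra_simps)
    have "2 * Re (cnj d' * (p - u)) = m * (2 * Re (cnj d' * b)) + 2 * Re (cnj d' * (of_real \<beta>' * (\<i> * d)))"
      unfolding pu by (simp add: algebra_simps)
    ultimately have "2 * Re (cnj d' * (of_real \<beta>' * (\<i> * d))) \<le> 0"
      using gauge_mult[OF z'(1)] unfolding d'_w'_def(1)[symmetric] by simp
    then have "0 \<le> \<beta>' * Im (cnj d' * d)" by (simp add: algebra_simps)
    moreover have "0 < Im (cnj d' * d)"
    proof -
      have dd: "d = 2 * b / (1 - \<i> * of_real w)" using nz[of w] unfolding b by simp
      have "d' = 2 * b / (1 + \<i> * of_real w')" using nz[of w'] unfolding b' by simp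
      then have dd': "cnj d' = 2 * cnj b / (1 - \<i> * of_real w')" by simp
      have "cnj d' * d = of_real (4 * (norm b)\<^sup>2) * inverse ((1 + \<i> * of_real (- w')) * (1 + \<i> * of_real (- w)))"
        unfolding dd dd' using complex_norm_square[of b] by (simp add: divide_inverse mult_ac)
      then have "Im (cnj d' * d) = 4 * (norm b)\<^sup>2 * (- (- w' + - w) / (norm ((1 + \<i> * of_real (- w')) * (1 + \<i> * of_real (- w))))\<^sup>2)"
        by (simp only: im_mult inv_im)
      also have "\<dots> > 0" using ab0 w w' nz[of w] nz[of w'] by (intro mult_pos_pos divide_pos_pos) auto
      finally show ?thesis .
    qed
    ultimately show ?thesis by (simp add: zero_le_mult_iff)
  qed
  ultimately show ?thesis
  \<comment> \<open>Since a - b = \<i> w d, moving by \<open>\<beta>\<close> times \<i> d from m a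
    adds \<beta> / w to the coordinate along \<open>a\<close> and subtracts it from the one along
    \<open>b\<close>.\<close>
  proof (intro that[of "\<beta>' / w" "- \<beta> / w"])
    show "\<beta>' / w + - \<beta> / w = gauge u z p" using w by (simp add: \<beta>'_def m_def field_simps)
    have "kite_point u z (\<beta>' / w) (- \<beta> / w) = u + of_real (m + \<beta> / w) * a - of_real (\<beta> / w) * b"
      using w by (simp add: kite_point_def \<beta>'_def defs field_simps)
    also have "\<dots> = u + of_real m * a + of_real (\<beta> / w) * (a - b)"
      by (simp add: algebra_simps diff_divide_distrib)
    also have "a - b = of_real w * (\<i> * d)" unfolding a b by (simp add: field_simps)
    also have "u + of_real m * a + of_real (\<beta> / w) * (of_real w * (\<i> * d)) = p"
      using \<beta> w by (simp add: algebra_simps)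
    finally show "p = kite_point u z (\<beta>' / w) (- \<beta> / w)" by simp
  qed (use w in \<open>auto simp: divide_nonpos_pos\<close>)
qed

text \<open>It remains to see that the largest gauge is positive, that is, that the neighbours of
  \<open>u\<close> do not all lie in a closed half plane facing away from \<open>p\<close>. Both
  moments of the weights enter.\<close>

lemma ex_kite_point:
  assumes u: "u \<in> V" and p: "p \<noteq> u"
  obtains z x y where "z \<in> N u" "0 \<le> x" "0 \<le> y" "0 < x + y" "p = kite_point u z x y"
    "\<And>z'. z' \<in> N u \<Longrightarrow> gauge u z' p \<le> x + y"
proof -
  let ?G = "(\<lambda>z. gauge u z p) ` N u"
  have fin: "finite ?G" "?G \<noteq> {}" using finite_N N_nonempty[OF u] by auto
  obtain z where z: "z \<in> N u" "gauge u z p = Max ?G" using Max_in[OF fin] by auto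
  have max: "gauge u z' p \<le> gauge u z p" if "z' \<in> N u" for z' using z fin that by simp
  have "0 < gauge u z p"
  proof (rule ccontr)
    assume neg: "\<not> 0 < gauge u z p"
    define r where "r z = Re (cnj (z - u) * (p - u))" for z
    have r: "r z' \<le> 0" if "z' \<in> N u" for z'
    proof -
      have "gauge u z' p \<le> 0" using max[OF that] neg by simp
      then show ?thesis using neighbourD(2)[OF that] by (simp add: gauge_def divide_le_0_iff r_def)
    qed
    have re_mult: "Re (of_real c * w) = c * Re w" for c w by simp
    \<comment> \<open>The first moment makes a sum of nonnegative terms vanish, so every edge would
      be perpendicular to p - u.\<close>
    have "(\<Sum>z\<in>N u. - (\<omega> u z * r z)) = - Re (cnj (\<Sum>z\<in>N u. of_real (\<omega> u z) * (z - u)) * (p - u))"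
      by (simp only: r_def cnj_sum sum_distrib_right Re_sum sum_negf complex_cnj_mult complex_cnj_complex_of_real
          mult.assoc re_mult)
    also have "\<dots> = 0" by (simp add: weight_first_moment[OF u])
    finally have "\<forall>z\<in>N u. - (\<omega> u z * r z) = 0"
    proof (subst (asm) sum_nonneg_eq_0_iff)
      show "0 \<le> - (\<omega> u z * r z)" if "z \<in> N u" for z
        using mult_nonneg_nonpos[OF less_imp_le[OF kite(7)[OF that]] r[OF that]] by simp
    qed (use finite_N in auto)
    then have r0: "r z' = 0" if "z' \<in> N u" for z' using kite(7)[OF that] that by force
    \<comment> \<open>The second moment excludes this: the weights are isotropic, so the quadratic
      form is positive in every direction.\<close>
    have "0 = (\<Sum>z\<in>N u. \<omega> u z * (2 * (r z)\<^sup>2))" using r0 by simp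
    also have "\<dots> = (\<Sum>z\<in>N u. \<omega> u z * (norm (z - u))\<^sup>2 * (norm (p - u))\<^sup>2 + Re (of_real (\<omega> u z) * (cnj ((z - u)\<^sup>2) * (p - u)\<^sup>2)))"
      by (intro sum.cong refl) (simp only: r_def Re_cnj_squared distrib_left re_mult mult.assoc)
    also have "\<dots> = (\<Sum>z\<in>N u. \<omega> u z * (norm (z - u))\<^sup>2 * (norm (p - u))\<^sup>2) +
        Re (cnj (\<Sum>z\<in>N u. of_real (\<omega> u z) * (z - u)\<^sup>2) * (p - u)\<^sup>2)"
      by (simp only: cnj_sum sum_distrib_right Re_sum sum.distrib complex_cnj_mult complex_cnj_complex_of_real mult.assoc)
    also have "\<dots> = (\<Sum>z\<in>N u. \<omega> u z * (norm (z - u))\<^sup>2 * (norm (p - u))\<^sup>2)"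
      by (simp add: weight_second_moment[OF u])
    also have "\<dots> > 0"
    proof (intro sum_pos finite_N N_nonempty u)
      show "0 < \<omega> u z * (norm (z - u))\<^sup>2 * (norm (p - u))\<^sup>2" if "z \<in> N u" for z
        using kite(7)[OF that] neighbourD(2)[OF that] p by simp
    qed
    finally show False by simp
  qed
  moreover obtain x y where "0 \<le> x" "0 \<le> y" "x + y = gauge u z p" "p = kite_point u z x y"
    using kite_point_of_max_gauge[OF z(1) max] by blast
  ultimately show ?thesis using that[of z x y] z(1) max by simp
qed

text \<open>Otherwise \<open>v\<close> would lie in the closed dual face of \<open>u\<close>, which is covered by faces and edges at \<open>u\<close>.\<close>

lemma closer_neighbour:
  assumes u: "u \<in> V" and v: "v \<in> V" and neq: "u \<noteq> v"
  obtains z where "z \<in> N u" "dist z v < dist u v"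
proof (rule ccontr)
  assume no: "\<not> thesis"
  have far: "dist u v \<le> dist z v" if z: "z \<in> N u" for z using no \<open>\<And>z. z \<in> N u \<Longrightarrow> dist z v < dist u v \<Longrightarrow> thesis\<close>[OF z] by linarith
  have g: "gauge u z v \<le> 1" if "z \<in> N u" for z
  proof -
    have "(norm (v - u))\<^sup>2 \<le> (norm (v - z))\<^sup>2"
      using far[OF that] by (intro power_mono) (auto simp: dist_norm norm_minus_commute)
    moreover have "(norm (v - z))\<^sup>2 = (norm (v - u))\<^sup>2 - 2 * Re (cnj (z - u) * (v - u)) + (norm (z - u))\<^sup>2"
      unfolding cmod_power2 by (simp add: power2_eq_square algebra_simps)
    ultimately show ?thesis using neighbourD(2)[OF that] by (simp add: gauge_def divide_le_eq_1)
  qed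
  obtain z x y where z: "z \<in> N u" and xy: "0 \<le> x" "0 \<le> y" "0 < x + y" and veq: "v = kite_point u z x y"
    by (rule ex_kite_point[OF u neq[symmetric]]) (rule that; assumption)
  have "gauge u z v = x + y"
    using kite_point_Re[OF z, of x y] neighbourD(2)[OF z] by (simp add: gauge_def veq)
  then have le: "x + y \<le> 1" using g[OF z] by simp
  \<comment> \<open>Off the diagonal \<open>v\<close> would be inside a face, which contains no
    vertices.\<close>
  consider "y < x" | "x < y" | "x = y" by linarith
  then show False
  proof cases
    case 1
    then show False using kite_point_in_face(1)[OF z, of y x] xy le veq v face_disjoint_V[OF left_face_face[OF z]] by auto
  next
    case 2
    then show False using kite_point_in_face(2)[OF z, of x y] xy le veq v face_disjoint_V[OF left_face_face[OF neighbourD(5)[OF z]]] by auto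
  next
    case 3
    then have "v = u + of_real x * (z - u)"
      unfolding kite(3)[OF z, symmetric] veq kite_point_def by (simp add: algebra_simps)
    then have eq: "v = u + x *\<^sub>R (z - u)" by (simp add: scaleR_conv_of_real)
    \<comment> \<open>On the diagonal \<open>v\<close> lies on the half of the edge nearer to
      \<open>u\<close>, whereas the only other vertex of the edge is its far end.\<close>
    have x: "0 < x" "x \<le> 1 / 2" using 3 xy le by auto
    then have "v \<in> convex hull {u, z}"
      unfolding eq segment_convex_hull[symmetric] closed_segment_def
      by (auto simp: algebra_simps intro!: exI[of _ x])
    then have "v = z" using vertex_on_edge[OF neighbourD(1)[OF z] _ v] neq by auto
    have "(1 - x) *\<^sub>R (z - u) = z - (u + x *\<^sub>R (z - u))" by (simp add: scaleR_diff_left)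
    then have "(1 - x) *\<^sub>R (z - u) = 0" using eq \<open>v = z\<close> by simp
    then show False using x neighbourD(2)[OF z] by simp
  qed
qed

section \<open>The shape and the area of a dual face\<close>

definition tri :: "complex \<Rightarrow> complex \<Rightarrow> complex set" where
  "tri u z = {kite_point u z x y | x y. 0 \<le> x \<and> 0 \<le> y \<and> x + y \<le> 1}"

lemma kite_point_combination:
  "kite_point u z x y = (1 - x - y) *\<^sub>R u + x *\<^sub>R centre (left_face u z) + y *\<^sub>R centre (left_face z u)"
  by (simp add: kite_point_def rad_def rad'_def scaleR_conv_of_real algebra_simps)

lemma tri_eq_hull: "tri u z = convex hull {u, centre (left_face u z), centre (left_face z u)}"
proof (intro set_eqI iffI)
  fix p assume "p \<in> tri u z"
  then obtain x y where "p = kite_point u z x y" "0 \<le> x" "0 \<le> y" "x + y \<le> 1" by (auto simp: tri_def)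
  then show "p \<in> convex hull {u, centre (left_face u z), centre (left_face z u)}"
    unfolding convex_hull_3 kite_point_combination mem_Collect_eq
    by (intro exI[of _ "1 - x - y"] exI[of _ x] exI[of _ y]) auto
next
  fix p assume "p \<in> convex hull {u, centre (left_face u z), centre (left_face z u)}"
  then obtain a x y where p: "p = a *\<^sub>R u + x *\<^sub>R centre (left_face u z) + y *\<^sub>R centre (left_face z u)"
    and c: "0 \<le> a" "0 \<le> x" "0 \<le> y" "a + x + y = 1" unfolding convex_hull_3 by blast
  have "a = 1 - x - y" using c(4) by simp
  then have "p = kite_point u z x y" using p by (simp add: kite_point_combination)
  then show "p \<in> tri u z" using c unfolding tri_def by (intro CollectI exI[of _ x] exI[of _ y]) auto
qed

lemma dual_edge_point:
  "p \<in> closed_segment (centre (left_face u z)) (centre (left_face z u)) \<longleftrightarrow> (\<exists>x y. 0 \<le> x \<and> 0 \<le> y \<and> x + y = 1 \<and> p = kite_point u z x y)"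
proof
  assume "p \<in> closed_segment (centre (left_face u z)) (centre (left_face z u))"
  then obtain t where "0 \<le> t" "t \<le> 1" "p = (1 - t) *\<^sub>R centre (left_face u z) + t *\<^sub>R centre (left_face z u)"
    unfolding closed_segment_def by blast
  then show "\<exists>x y. 0 \<le> x \<and> 0 \<le> y \<and> x + y = 1 \<and> p = kite_point u z x y"
    by (intro exI[of _ "1 - t"] exI[of _ t]) (simp add: kite_point_combination)
next
  assume "\<exists>x y. 0 \<le> x \<and> 0 \<le> y \<and> x + y = 1 \<and> p = kite_point u z x y"
  then obtain x y where "0 \<le> x" "0 \<le> y" "x + y = 1" "p = kite_point u z x y" by blast
  moreover have "x = 1 - y" using \<open>x + y = 1\<close> by simp
  ultimately show "p \<in> closed_segment (centre (left_face u z)) (centre (left_face z u))"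
    unfolding closed_segment_def by (auto simp: kite_point_combination intro!: exI[of _ y])
qed

lemma gauge_kite_point: "z \<in> N u \<Longrightarrow> gauge u z (kite_point u z x y) = x + y"
  using kite_point_Re[of z u x y] neighbourD(2)[of z u] by (simp add: gauge_def)

lemma gauge_le_iff:
  assumes "z \<in> N u"
  shows "gauge u z p \<le> c \<longleftrightarrow> (z - u) \<bullet> p \<le> c * (norm (z - u))\<^sup>2 / 2 + (z - u) \<bullet> u"
    and "gauge u z p < c \<longleftrightarrow> (z - u) \<bullet> p < c * (norm (z - u))\<^sup>2 / 2 + (z - u) \<bullet> u"
proof -
  have pos: "0 < (norm (z - u))\<^sup>2" using neighbourD(2)[OF assms] by simp
  have "2 * Re (cnj (z - u) * (p - u)) = 2 * ((z - u) \<bullet> p) - 2 * ((z - u) \<bullet> u)"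
    by (simp add: inner_complex_def algebra_simps)
  then show "gauge u z p \<le> c \<longleftrightarrow> (z - u) \<bullet> p \<le> c * (norm (z - u))\<^sup>2 / 2 + (z - u) \<bullet> u"
    "gauge u z p < c \<longleftrightarrow> (z - u) \<bullet> p < c * (norm (z - u))\<^sup>2 / 2 + (z - u) \<bullet> u"
    unfolding gauge_def pos_divide_le_eq[OF pos] pos_divide_less_eq[OF pos] by linarith+
qed

text \<open>The points closer to \<open>u\<close> than to each of its neighbours: an open convex
  description of the dual face, which is itself defined as a component of a complement.\<close>

definition cell :: "complex \<Rightarrow> complex set" where
  "cell u = {p. \<forall>z\<in>N u. gauge u z p < 1}"

lemma cell_open: "open (cell u)" and cell_convex: "convex (cell u)"
proof -
  have eq: "cell u = (\<Inter>z\<in>N u. {p. (z - u) \<bullet> p < 1 * (norm (z - u))\<^sup>2 / 2 + (z - u) \<bullet> u})"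
    unfolding cell_def using gauge_le_iff(2) by auto
  show "open (cell u)" unfolding eq by (intro open_INT finite_N ballI open_halfspace_lt)
  show "convex (cell u)" unfolding eq by (intro convex_INT convex_halfspace_lt)
qed

lemma cell_closure: "p \<in> closure (cell u) \<Longrightarrow> z \<in> N u \<Longrightarrow> gauge u z p \<le> 1"
proof -
  assume p: "p \<in> closure (cell u)" and z: "z \<in> N u"
  have "cell u \<subseteq> {p. (z - u) \<bullet> p \<le> 1 * (norm (z - u))\<^sup>2 / 2 + (z - u) \<bullet> u}"
    unfolding cell_def using z gauge_le_iff(1)[OF z, of _ 1] by (auto intro: less_imp_le)
  then have "closure (cell u) \<subseteq> {p. (z - u) \<bullet> p \<le> 1 * (norm (z - u))\<^sup>2 / 2 + (z - u) \<bullet> u}"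
    by (intro closure_minimal closed_halfspace_le)
  then show "gauge u z p \<le> 1" using p gauge_le_iff(1)[OF z, of p 1] by blast
qed

lemma vertex_in_cell: "u \<in> cell u"
  by (simp add: cell_def gauge_def)

lemma dual_edges_at:
  assumes u: "u \<in> V"
  shows "(\<Union>e\<in>{e \<in> E. u \<in> e}. convex hull (dual_edge V E e)) =
    (\<Union>z\<in>N u. closed_segment (centre (left_face u z)) (centre (left_face z u)))"
proof -
  have de: "convex hull (dual_edge V E {u, z}) = closed_segment (centre (left_face u z)) (centre (left_face z u))" if "z \<in> N u" for z
    by (simp add: dual_edge_def incident_faces_eq[OF that] segment_convex_hull flip: centre_def)
  have ed: "\<exists>z\<in>N u. e = {u, z}" if "e \<in> E" "u \<in> e" for e
  proof -
    obtain a b where "e = {a, b}" using edge_cases[OF \<open>e \<in> E\<close>] by metis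
    then show ?thesis using that by (auto simp: neighbours_def insert_commute)
  qed
  show ?thesis
  proof (intro set_eqI iffI)
    fix p assume "p \<in> (\<Union>e\<in>{e \<in> E. u \<in> e}. convex hull (dual_edge V E e))"
    then obtain e where e: "e \<in> E" "u \<in> e" "p \<in> convex hull (dual_edge V E e)" by auto
    then obtain z where "z \<in> N u" "e = {u, z}" using ed by blast
    then show "p \<in> (\<Union>z\<in>N u. closed_segment (centre (left_face u z)) (centre (left_face z u)))" using e de by auto
  next
    fix p assume "p \<in> (\<Union>z\<in>N u. closed_segment (centre (left_face u z)) (centre (left_face z u)))"
    then obtain z where z: "z \<in> N u" "p \<in> closed_segment (centre (left_face u z)) (centre (left_face z u))" by auto
    then show "p \<in> (\<Union>e\<in>{e \<in> E. u \<in> e}. convex hull (dual_edge V E e))"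
      using neighbourD(1)[OF z(1)] de[OF z(1)] by (intro UN_I[of "{u, z}"]) auto
  qed
qed

text \<open>The cell is convex and avoids the dual edges at \<open>u\<close>, hence lies in the
  component. A component reaching further would cross the frontier of the cell, all of which is
  covered by those dual edges.\<close>

lemma dual_face_eq_cell:
  assumes u: "u \<in> V"
  shows "dual_face V E u = cell u"
proof -
  define B where "B = (\<Union>z\<in>N u. closed_segment (centre (left_face u z)) (centre (left_face z u)))"
  have df: "dual_face V E u = connected_component_set (- B) u"
    by (simp only: dual_face_def dual_edges_at[OF u] B_def)
  have disj: "cell u \<inter> B = {}"
  proof (rule ccontr)
    assume "cell u \<inter> B \<noteq> {}"
    then obtain p z where p: "p \<in> cell u" "z \<in> N u" "p \<in> closed_segment (centre (left_face u z)) (centre (left_face z u))"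
      by (auto simp: B_def)
    then obtain x y where "x + y = 1" "p = kite_point u z x y" unfolding dual_edge_point by blast
    then have "gauge u z p = 1" using gauge_kite_point[OF p(2)] by simp
    then show False using p(1,2) by (auto simp: cell_def)
  qed
  have "cell u \<subseteq> connected_component_set (- B) u"
    by (rule connected_component_maximal[OF vertex_in_cell convex_connected[OF cell_convex]])
       (use disj in auto)
  moreover have "connected_component_set (- B) u \<subseteq> cell u"
  proof (rule ccontr)
    let ?C = "connected_component_set (- B) u"
    assume "\<not> ?C \<subseteq> cell u"
    moreover have "u \<in> ?C" using vertex_in_cell[of u] disj by auto
    ultimately have "?C \<inter> frontier (cell u) \<noteq> {}"
      using vertex_in_cell[of u] by (intro connected_Int_frontier connected_connected_component) blast+
    then obtain q where q: "q \<in> ?C" "q \<in> frontier (cell u)" by auto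
    have "q \<notin> cell u" using q(2) cell_open interior_open by (auto simp: frontier_def)
    then obtain z where z: "z \<in> N u" "1 \<le> gauge u z q" by (auto simp: cell_def not_less)
    have le: "gauge u z' q \<le> 1" if "z' \<in> N u" for z'
      using cell_closure[OF _ that] q(2) by (auto simp: frontier_def)
    \<comment> \<open>The frontier point has maximal gauge 1 among all neighbours, so its
      coordinates with respect to \<open>z\<close> are nonnegative with sum 1.\<close>
    have "gauge u z q = 1" using z le[OF z(1)] by simp
    then obtain x y where "0 \<le> x" "0 \<le> y" "x + y = 1" "q = kite_point u z x y"
      using kite_point_of_max_gauge[OF z(1), of q] le by metis
    then have "q \<in> B" unfolding B_def using z(1) dual_edge_point by blast
    moreover have "q \<notin> B" using q(1) connected_component_subset[of "- B" u] by blast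
    ultimately show False by simp
  qed
  ultimately show ?thesis using df by simp
qed

text \<open>The kite triangles \<open>tri u z\<close> at \<open>u\<close> overlap only in null sets: off the seams, each half of such a
  triangle lies in a face, and within a face the two halves at \<open>u\<close> are separated by the ray to the circumcentre.\<close>

definition seams :: "complex \<Rightarrow> complex \<Rightarrow> complex set" where
  "seams u z = {p. cross u z p = 0} \<union> {p. cross u (centre (left_face u z)) p = 0} \<union> {p. cross u (centre (left_face z u)) p = 0}"

lemma seams_negligible:
  assumes z: "z \<in> N u"
  shows "negligible (seams u z)"
proof -
  have "rad u z \<noteq> 0" "rad' u z \<noteq> 0" using kite(1,2)[OF z] h_pos by auto
  then have "u \<noteq> centre (left_face u z)" "u \<noteq> centre (left_face z u)" by (auto simp: rad_def rad'_def)
  then show ?thesis unfolding seams_def using neighbourD(2)[OF z] by (intro negligible_Un negligible_cross)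
qed

lemma tri_in_face:
  assumes z: "z \<in> N u" and p: "p \<in> tri u z" "p \<notin> seams u z"
  shows "p \<in> left_face u z \<and> cross u (centre (left_face u z)) p < 0 \<or> p \<in> left_face z u \<and> 0 < cross u (centre (left_face z u)) p"
proof -
  obtain x y where xy: "0 \<le> x" "0 \<le> y" "x + y \<le> 1" and peq: "p = kite_point u z x y"
    using p(1) unfolding tri_def by blast
  have pos: "0 < \<omega> u z * (norm (z - u))\<^sup>2" using kite(7)[OF z] neighbourD(2)[OF z] by simp
  note c = kite_point_cross[OF z, of x y, folded peq]
  have "x \<noteq> y" using p(2) c(1) by (auto simp: seams_def)
  then consider "y < x" | "x < y" by linarith
  then show ?thesis
  proof cases
    case 1
    have "y \<noteq> 0" using p(2) c(2) by (auto simp: seams_def)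
    then have "0 < y * (\<omega> u z * (norm (z - u))\<^sup>2)" using xy(2) by (intro mult_pos_pos[OF _ pos]) auto
    then have "cross u (centre (left_face u z)) p < 0" using c(2) by (simp add: mult.assoc)
    moreover have "p \<in> left_face u z" using kite_point_in_face(1)[OF z, of y x] 1 xy peq by simp
    ultimately show ?thesis by simp
  next
    case 2
    have "x \<noteq> 0" using p(2) c(3) by (auto simp: seams_def)
    then have "0 < x * (\<omega> u z * (norm (z - u))\<^sup>2)" using xy(1) by (intro mult_pos_pos[OF _ pos]) auto
    then have "0 < cross u (centre (left_face z u)) p" using c(3) by (simp add: mult.assoc)
    moreover have "p \<in> left_face z u" using kite_point_in_face(2)[OF z, of x y] 2 xy peq by simp
    ultimately show ?thesis by simp
  qed
qed

lemma tri_overlap: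
  assumes z: "z \<in> N u" and z': "z' \<in> N u" and neq: "z \<noteq> z'" and p: "p \<in> tri u z" "p \<in> tri u z'"
  shows "p \<in> seams u z \<union> seams u z'"
proof (rule ccontr)
  assume n: "p \<notin> seams u z \<union> seams u z'"
  have 1: "p \<in> left_face u z \<and> cross u (centre (left_face u z)) p < 0 \<or> p \<in> left_face z u \<and> 0 < cross u (centre (left_face z u)) p"
    using tri_in_face[OF z p(1)] n by blast
  have 2: "p \<in> left_face u z' \<and> cross u (centre (left_face u z')) p < 0 \<or> p \<in> left_face z' u \<and> 0 < cross u (centre (left_face z' u)) p"
    using tri_in_face[OF z' p(2)] n by blast
  note F = left_face_face[OF z] left_face_face[OF neighbourD(5)[OF z]] left_face_face[OF z'] left_face_face[OF neighbourD(5)[OF z']]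
  from 1 2 show False
  proof (elim disjE conjE)
    assume a: "p \<in> left_face u z" "p \<in> left_face u z'"
    show False using faces_disjoint[OF F(1,3) a] left_face_inj[OF z z'] neq by blast
  next
    assume a: "p \<in> left_face u z" "cross u (centre (left_face u z)) p < 0" "p \<in> left_face z' u" "0 < cross u (centre (left_face z' u)) p"
    show False using faces_disjoint[OF F(1,4) a(1,3)] a by simp
  next
    assume a: "p \<in> left_face z u" "0 < cross u (centre (left_face z u)) p" "p \<in> left_face u z'" "cross u (centre (left_face u z')) p < 0"
    show False using faces_disjoint[OF F(2,3) a(1,3)] a by simp
  next
    assume a: "p \<in> left_face z u" "p \<in> left_face z' u"
    show False using faces_disjoint[OF F(2,4) a] left_face_inj'[OF z z'] neq by blast
  qed
qed

text \<open>Seams are lines through \<open>u\<close>, so they are preserved by scaling about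
  \<open>u\<close>.\<close>

lemma seams_ray: "t \<noteq> 0 \<Longrightarrow> u + of_real t * (p - u) \<in> seams u z \<longleftrightarrow> p \<in> seams u z"
proof -
  assume t: "t \<noteq> 0"
  have "cross u w (u + of_real t * (p - u)) = t * cross u w p" for w
    by (simp add: cross_def algebra_simps)
  then show ?thesis using t by (auto simp: seams_def)
qed

lemma cell_subset_tri:
  assumes u: "u \<in> V"
  shows "cell u \<subseteq> (\<Union>z\<in>N u. tri u z)"
proof
  fix p assume p: "p \<in> cell u"
  show "p \<in> (\<Union>z\<in>N u. tri u z)"
  proof (cases "p = u")
    case True
    obtain z where z: "z \<in> N u" using N_nonempty[OF u] by auto
    have "p = kite_point u z 0 0" using True by (simp add: kite_point_def)
    then have "p \<in> tri u z" unfolding tri_def by (intro CollectI exI[of _ 0]) simp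
    then show ?thesis using z by blast
  next
    case False
    obtain z x y where z: "z \<in> N u" and xy: "0 \<le> x" "0 \<le> y" "0 < x + y" and peq: "p = kite_point u z x y"
      by (rule ex_kite_point[OF u False]) (rule that; assumption)
    have "x + y < 1" using p z gauge_kite_point[OF z, of x y] by (auto simp: cell_def peq)
    then have "p \<in> tri u z" unfolding tri_def peq using xy by (intro CollectI exI[of _ x] exI[of _ y]) auto
    then show ?thesis using z by blast
  qed
qed

text \<open>Outside the cell some neighbour has gauge at least 1. If the maximal one is
  \<open>z\<close>, the point is on the dual edge of \<open>z\<close>; otherwise it belongs to the
  sectors of two different neighbours.\<close>

lemma tri_diff_cell:
  assumes u: "u \<in> V" and z: "z \<in> N u" and p: "p \<in> tri u z" "p \<notin> cell u"
  shows "p \<in> (\<Union>z\<in>N u. seams u z) \<union> {p. (z - u) \<bullet> p = (norm (z - u))\<^sup>2 / 2 + (z - u) \<bullet> u}"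
proof -
  obtain x y where xy: "0 \<le> x" "0 \<le> y" "x + y \<le> 1" and peq: "p = kite_point u z x y"
    using p(1) unfolding tri_def by blast
  have "p \<noteq> u" using p(2) vertex_in_cell by auto
  obtain z' x' y' where z': "z' \<in> N u" and xy': "0 \<le> x'" "0 \<le> y'" "0 < x' + y'" and peq': "p = kite_point u z' x' y'"
    and max: "\<And>w. w \<in> N u \<Longrightarrow> gauge u w p \<le> x' + y'"
    by (rule ex_kite_point[OF u \<open>p \<noteq> u\<close>]) (rule that; assumption)
  have ge: "1 \<le> x' + y'"
  proof (rule ccontr)
    assume n: "\<not> 1 \<le> x' + y'"
    have "gauge u w p < 1" if "w \<in> N u" for w using max[OF that] n by linarith
    then have "p \<in> cell u" unfolding cell_def by blast
    then show False using p(2) by simp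
  qed
  show ?thesis
  proof (cases "z' = z")
    case True
    have "x + y = x' + y'" using gauge_kite_point[OF z] peq peq' True by metis
    then have "gauge u z p \<le> 1" "\<not> gauge u z p < 1" using ge xy(3) gauge_kite_point[OF z, of x y] peq by auto
    then have "(z - u) \<bullet> p = (norm (z - u))\<^sup>2 / 2 + (z - u) \<bullet> u"
      unfolding gauge_le_iff[OF z] by simp
    then show ?thesis by simp
  next
    case False
    \<comment> \<open>Shrinking towards \<open>u\<close> until the maximal gauge is 1 puts the point
      into both triangles, where \<open>tri_overlap\<close> applies.\<close>
    define s where "s = 1 / (x' + y')"
    have s: "0 < s" "s \<le> 1" using ge by (auto simp: s_def)
    let ?q = "u + of_real s * (p - u)"
    have "?q = kite_point u z (s * x) (s * y)" by (simp add: peq kite_point_def algebra_simps)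
    moreover have "s * x + s * y \<le> 1" using s xy mult_mono[of s 1 "x + y" 1] by (simp add: distrib_left)
    ultimately have "?q \<in> tri u z" using s xy unfolding tri_def by (intro CollectI exI[of _ "s * x"] exI[of _ "s * y"]) auto
    moreover have "?q \<in> tri u z'"
    proof -
      have "?q = kite_point u z' (s * x') (s * y')" by (simp add: peq' kite_point_def algebra_simps)
      moreover have "s * x' + s * y' = 1" using ge by (simp add: s_def add_divide_distrib[symmetric])
      ultimately show ?thesis
        using s xy' unfolding tri_def by (intro CollectI exI[of _ "s * x'"] exI[of _ "s * y'"]) auto
    qed
    ultimately have "?q \<in> seams u z \<union> seams u z'" using tri_overlap[OF z z'] False by blast
    then have "p \<in> seams u z \<union> seams u z'" using seams_ray[of s u p] s by auto
    then show ?thesis using z z' by blast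
  qed
qed

lemma measure_tri:
  assumes z: "z \<in> N u"
  shows "measure lebesgue (tri u z) = \<omega> u z * (norm (z - u))\<^sup>2 / 4"
proof -
  have "measure lebesgue (tri u z) = \<bar>Im (cnj (rad u z) * rad' u z)\<bar> / 2"
    unfolding tri_eq_hull measure_triangle rad_def rad'_def by simp
  also have "Im (cnj (rad u z) * rad' u z) = - (\<omega> u z * (norm (z - u))\<^sup>2 / 2)"
    unfolding rad_eq[OF z] cmod_power2 by (simp add: power2_eq_square field_simps)
  finally show ?thesis using kite(7)[OF z] by simp
qed

lemma vertex_area_eq:
  assumes u: "u \<in> V"
  shows "vertex_area V E u = (\<Sum>z\<in>N u. \<omega> u z * (norm (z - u))\<^sup>2) / 4"
proof -
  let ?T = "\<Union>z\<in>N u. tri u z"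
  have lm: "tri u z \<in> lmeasurable" for z
    unfolding tri_eq_hull by (intro lmeasurable_compact finite_imp_compact_convex_hull) auto
  have neg: "negligible (\<Union>z\<in>N u. seams u z)" by (intro negligible_Union finite_imageI finite_N) (auto intro: seams_negligible)
  have "measure lebesgue (cell u) = measure lebesgue ?T"
  proof (rule measure_negligible_symdiff)
    show "?T \<in> lmeasurable" using lm by (intro fmeasurable.finite_UN finite_N) auto
    have "negligible ((\<Union>z\<in>N u. seams u z) \<union> (\<Union>z\<in>N u. {p. (z - u) \<bullet> p = (norm (z - u))\<^sup>2 / 2 + (z - u) \<bullet> u}))"
    proof (intro negligible_Un neg negligible_Union finite_imageI finite_N)
      fix T assume "T \<in> (\<lambda>z. {p. (z - u) \<bullet> p = (norm (z - u))\<^sup>2 / 2 + (z - u) \<bullet> u}) ` N u"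
      then obtain z where z: "z \<in> N u" and T: "T = {p. (z - u) \<bullet> p = (norm (z - u))\<^sup>2 / 2 + (z - u) \<bullet> u}"
        by blast
      have "z - u \<noteq> 0" using neighbourD(2)[OF z] by simp
      then show "negligible T" unfolding T by (intro negligible_hyperplane) simp
    qed
    then show "negligible (?T - cell u \<union> (cell u - ?T))"
      by (rule negligible_subset) (use tri_diff_cell[OF u] cell_subset_tri[OF u] in blast)
  qed
  also have "\<dots> = (\<Sum>z\<in>N u. measure lebesgue (tri u z))"
  proof (rule measure_negligible_finite_Union_image[OF finite_N lm])
    show "pairwise (\<lambda>x y. negligible (tri u x \<inter> tri u y)) (N u)"
    proof (rule pairwiseI)
      fix z z' assume zz: "z \<in> N u" "z' \<in> N u" "z \<noteq> z'"
      have "negligible (seams u z \<union> seams u z')" by (intro negligible_Un seams_negligible zz)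
      then show "negligible (tri u z \<inter> tri u z')"
        by (rule negligible_subset) (use tri_overlap[OF zz] in blast)
    qed
  qed
  finally show ?thesis
    unfolding vertex_area_def dual_face_eq_cell[OF u] by (simp add: measure_tri sum_divide_distrib)
qed

lemma vertex_area_le:
  assumes u: "u \<in> V"
  shows "vertex_area V E u \<le> h\<^sup>2"
proof -
  have "tri u z \<subseteq> cball u (h / 2)" if "z \<in> N u" for z
    unfolding tri_eq_hull
  proof (intro hull_minimal convex_cball)
    show "{u, centre (left_face u z), centre (left_face z u)} \<subseteq> cball u (h / 2)"
      using kite(1,2)[OF that] h_pos by (auto simp: rad_def rad'_def dist_norm norm_minus_commute)
  qed
  then have "cell u \<subseteq> cball u (h / 2)" using cell_subset_tri[OF u] by blast
  also have "cball u (h / 2) \<subseteq> cbox (u - Complex (h / 2) (h / 2)) (u + Complex (h / 2) (h / 2))"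
  proof
    fix p assume "p \<in> cball u (h / 2)"
    then have "norm (p - u) \<le> h / 2" by (simp add: dist_norm norm_minus_commute)
    then have "\<bar>Re (p - u)\<bar> \<le> h / 2" "\<bar>Im (p - u)\<bar> \<le> h / 2"
      using abs_Re_le_cmod[of "p - u"] abs_Im_le_cmod[of "p - u"] by linarith+
    then have "Re p - Re u \<le> h / 2" "- (h / 2) \<le> Re p - Re u" "Im p - Im u \<le> h / 2" "- (h / 2) \<le> Im p - Im u"
      unfolding abs_le_iff minus_complex.sel by linarith+
    then show "p \<in> cbox (u - Complex (h / 2) (h / 2)) (u + Complex (h / 2) (h / 2))"
      unfolding in_cbox_complex_iff by simp
  qed
  finally have sub: "cell u \<subseteq> cbox (u - Complex (h / 2) (h / 2)) (u + Complex (h / 2) (h / 2))" .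
  then have "measure lebesgue (cell u) \<le> measure lebesgue (cbox (u - Complex (h / 2) (h / 2)) (u + Complex (h / 2) (h / 2)))"
    by (intro measure_mono_fmeasurable lmeasurable_cbox) (simp_all add: cell_open lmeasurable_open fmeasurableD bounded_subset[OF bounded_cbox])
  also have "\<dots> = h\<^sup>2"
    using h_pos by (simp add: content_cbox_if Basis_complex_def power2_eq_square box_ne_empty inner_complex_def in_cbox_complex_iff)
  finally show ?thesis unfolding vertex_area_def dual_face_eq_cell[OF u] .
qed

text \<open>A face whose closure contains \<open>x\<close> lies in a disc of diameter
  \<open>h\<close> with a vertex on its boundary circle.\<close>

lemma face_meets_vertex:
  obtains v where "v \<in> V" "dist x v \<le> h"
proof -
  obtain f where f: "f \<in> Faces" "x \<in> closure f" using cover by blast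
  obtain c where c: "c \<in> f" "V \<inter> frontier f \<subseteq> sphere c (h / 2)" using face_has_centre[OF f(1)] .
  obtain vs where vs: "3 \<le> length vs" "distinct vs"
    "\<And>i. i < length vs \<Longrightarrow> {vs ! i, vs ! (Suc i mod length vs)} \<in> E"
    "frontier f = (\<Union>i<length vs. closed_segment (vs ! i) (vs ! (Suc i mod length vs)))"
    by (rule face_cycle[OF f(1)]) (rule that; assumption)
  have l: "0 < length vs" using vs(1) by linarith
  have v: "vs ! 0 \<in> V" using edge_subset_V[OF vs(3)[OF l]] by simp
  have "vs ! 0 \<in> frontier f" unfolding vs(4) using l by (intro UN_I[of 0]) auto
  then have "dist c (vs ! 0) = h / 2" using v c(2) by auto
  moreover have "x \<in> cball c (h / 2)"
    using closure_mono[OF face_subset_ball[OF f(1) c]] f(2) h_pos by auto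
  ultimately have "dist x (vs ! 0) \<le> h" using dist_triangle[of x "vs ! 0" c] by (auto simp: dist_commute)
  then show ?thesis using that v by blast
qed

end

section \<open>Exponential tilting\<close>

lemma exp_quadratic_bounds:
  fixes y :: real
  assumes "\<bar>y\<bar> \<le> \<eta>"
  shows "1 + y + y\<^sup>2 / 2 * exp (- \<eta>) \<le> exp y" "exp y \<le> 1 + y + y\<^sup>2 / 2 * exp \<eta>"
proof -
  obtain t where t: "\<bar>t\<bar> \<le> \<bar>y\<bar>" "exp y = (\<Sum>m<2. y ^ m / fact m) + exp t / fact 2 * y ^ 2"
    using Maclaurin_exp_le[of y 2] by blast
  have e: "exp y = 1 + y + y\<^sup>2 / 2 * exp t" using t(2) by (simp add: numeral_2_eq_2)
  have "exp (- \<eta>) \<le> exp t" "exp t \<le> exp \<eta>" using t(1) assms by auto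
  then show "1 + y + y\<^sup>2 / 2 * exp (- \<eta>) \<le> exp y" "exp y \<le> 1 + y + y\<^sup>2 / 2 * exp \<eta>"
    unfolding e by (intro add_left_mono mult_left_mono; simp)+
qed

text \<open>What the estimates retain of the graph. \<open>mean_zero\<close>,
  \<open>square_zero\<close> and \<open>variance\<close> say that each step is centred and isotropic
  with the same variance everywhere; \<open>c0\<close>, \<open>separated\<close> and
  \<open>closer\<close> serve only to hit a prescribed vertex.\<close>

locale planar_walk = markov_kernel V S p
  for V :: "complex set" and S p +
  fixes h \<kappa> c0 \<delta> :: real
  assumes h_pos: "0 < h" and kappa: "1 \<le> \<kappa>" and c0_pos: "0 < c0" and delta_pos: "0 < \<delta>"
    and self_in: "u \<in> V \<Longrightarrow> u \<in> S u"
    and p_ge: "u \<in> V \<Longrightarrow> z \<in> S u \<Longrightarrow> c0 \<le> p u z"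
    and step_le: "u \<in> V \<Longrightarrow> z \<in> S u \<Longrightarrow> norm (z - u) \<le> h"
    and mean_zero: "u \<in> V \<Longrightarrow> (\<Sum>z\<in>S u. of_real (p u z) * (z - u)) = 0"
    and square_zero: "u \<in> V \<Longrightarrow> (\<Sum>z\<in>S u. of_real (p u z) * (z - u)\<^sup>2) = 0"
    and variance: "u \<in> V \<Longrightarrow> (\<Sum>z\<in>S u. p u z * (norm (z - u))\<^sup>2) = 2 * h\<^sup>2 / \<kappa>"
    and separated: "u \<in> V \<Longrightarrow> v \<in> V \<Longrightarrow> u \<noteq> v \<Longrightarrow> \<delta> * h \<le> dist u v"
    and closer: "u \<in> V \<Longrightarrow> v \<in> V \<Longrightarrow> u \<noteq> v \<Longrightarrow> \<exists>z\<in>S u. dist z v < dist u v"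
begin

text \<open>Time per step: one step has the covariance of planar Brownian motion at time
  \<open>dt\<close>. For the lazy kernel of the graph it is 1 / \<open>Q\<close>.\<close>

definition dt :: real where "dt = h\<^sup>2 / \<kappa>"

lemma dt_pos: "0 < dt" using h_pos kappa by (simp add: dt_def)

lemma dt_le: "dt \<le> h\<^sup>2" using h_pos kappa by (simp add: dt_def divide_le_eq mult_le_cancel_left1)

section \<open>Moments of one step\<close>

lemma linear_moment: "u \<in> V \<Longrightarrow> (\<Sum>z\<in>S u. p u z * (l \<bullet> (z - u))) = 0"
proof -
  assume u: "u \<in> V"
  have "(\<Sum>z\<in>S u. p u z * (l \<bullet> (z - u))) = l \<bullet> (\<Sum>z\<in>S u. of_real (p u z) * (z - u))"
    by (simp add: inner_sum_right scaleR_conv_of_real[symmetric])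
  then show ?thesis by (simp add: mean_zero[OF u])
qed

lemma vector_moment: "u \<in> V \<Longrightarrow> (\<Sum>z\<in>S u. (p u z * (l \<bullet> (z - u))) *\<^sub>R (z - u)) = dt *\<^sub>R l"
proof -
  assume u: "u \<in> V"
  have "(P * (l \<bullet> d)) *\<^sub>R d =
      (1 / 2) * (cnj l * (of_real P * d\<^sup>2) + l * of_real (P * (norm d)\<^sup>2))" for d P
  proof -
    \<comment> \<open>This splits (l \<bullet> d) d into a multiple of the square of d, removed by
      \<open>square_zero\<close>, and \<open>l\<close> times half the squared norm of d, governed by
      \<open>variance\<close>.\<close>
    have "of_real (l \<bullet> d) = (cnj l * d + l * cnj d) / 2"
      by (simp add: complex_eq_iff inner_complex_def)
    then have "(P * (l \<bullet> d)) *\<^sub>R d = of_real P * ((cnj l * d + l * cnj d) / 2) * d"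
      by (simp only: scaleR_conv_of_real of_real_mult)
    also have "\<dots> = (1 / 2) * (cnj l * (of_real P * d\<^sup>2) + l * (of_real P * (d * cnj d)))"
      by (simp add: power2_eq_square field_simps)
    finally show ?thesis unfolding complex_norm_square[symmetric] by simp
  qed
  then have "(\<Sum>z\<in>S u. (p u z * (l \<bullet> (z - u))) *\<^sub>R (z - u)) =
      (1 / 2) * (cnj l * (\<Sum>z\<in>S u. of_real (p u z) * (z - u)\<^sup>2) + l * of_real (\<Sum>z\<in>S u. p u z * (norm (z - u))\<^sup>2))"
    by (simp only: sum.distrib of_real_sum flip: sum_distrib_left)
  also have "\<dots> = dt *\<^sub>R l"
    unfolding square_zero[OF u] variance[OF u] by (simp add: dt_def scaleR_conv_of_real)
  finally show ?thesis .
qed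

lemma quadratic_moment: "u \<in> V \<Longrightarrow> (\<Sum>z\<in>S u. p u z * (l \<bullet> (z - u))\<^sup>2) = dt * (norm l)\<^sup>2"
proof -
  assume u: "u \<in> V"
  have "(\<Sum>z\<in>S u. p u z * (l \<bullet> (z - u))\<^sup>2) = l \<bullet> (\<Sum>z\<in>S u. (p u z * (l \<bullet> (z - u))) *\<^sub>R (z - u))"
    by (simp add: inner_sum_right power2_eq_square mult.assoc)
  then show ?thesis by (simp add: vector_moment[OF u] power2_norm_eq_inner)
qed

lemma inner_step_le: "u \<in> V \<Longrightarrow> z \<in> S u \<Longrightarrow> \<bar>l \<bullet> (z - u)\<bar> \<le> norm l * h"
  using Cauchy_Schwarz_ineq2[of l "z - u"] mult_left_mono[OF step_le[of u z], of "norm l"] by simp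

section \<open>Exponential moments and the Chernoff bound\<close>

definition mgf :: "complex \<Rightarrow> complex \<Rightarrow> real" where
  "mgf l u = (\<Sum>z\<in>S u. p u z * exp (l \<bullet> (z - u)))"

text \<open>The second order expansion only involves the exact moments, so the bounds do not depend
  on \<open>u\<close> and can be iterated.\<close>

lemma mgf_bounds:
  assumes u: "u \<in> V"
  shows "1 + dt * (norm l)\<^sup>2 / 2 * exp (- (norm l * h)) \<le> mgf l u"
    and "mgf l u \<le> 1 + dt * (norm l)\<^sup>2 / 2 * exp (norm l * h)"
proof -
  let ?y = "\<lambda>z. l \<bullet> (z - u)"
  have eq: "(\<Sum>z\<in>S u. p u z * (1 + ?y z + (?y z)\<^sup>2 / 2 * E)) = 1 + dt * (norm l)\<^sup>2 / 2 * E" for E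
  proof -
    have "(\<Sum>z\<in>S u. p u z * (1 + ?y z + (?y z)\<^sup>2 / 2 * E)) =
      (\<Sum>z\<in>S u. p u z) + (\<Sum>z\<in>S u. p u z * ?y z) + (\<Sum>z\<in>S u. p u z * (?y z)\<^sup>2) * (E / 2)"
      by (simp add: distrib_left sum.distrib sum_distrib_right mult.assoc)
    then show ?thesis by (simp add: p_sum[OF u] linear_moment[OF u] quadratic_moment[OF u])
  qed
  show "1 + dt * (norm l)\<^sup>2 / 2 * exp (- (norm l * h)) \<le> mgf l u"
    unfolding mgf_def eq[symmetric]
    by (intro sum_mono mult_left_mono exp_quadratic_bounds inner_step_le p_nonneg u)
  show "mgf l u \<le> 1 + dt * (norm l)\<^sup>2 / 2 * exp (norm l * h)"
    unfolding mgf_def eq[symmetric]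
    by (intro sum_mono mult_left_mono exp_quadratic_bounds inner_step_le p_nonneg u)
qed

text \<open>The indicator of \<open>v\<close> is dominated by z \<mapsto> exp (l \<bullet> (z - v)),
  on which each averaging costs at most the factor bounding \<open>mgf\<close>.\<close>

lemma iter_le_exp:
  assumes u: "u \<in> V"
  shows "(avg ^^ k) (indicator {v}) u \<le> exp (l \<bullet> (u - v)) * (1 + dt * (norm l)\<^sup>2 / 2 * exp (norm l * h)) ^ k"
  using u
proof (induction k arbitrary: u)
  case 0
  then show ?case by (auto simp: indicator_def)
next
  case (Suc k)
  let ?r = "1 + dt * (norm l)\<^sup>2 / 2 * exp (norm l * h)"
  have r: "0 \<le> ?r" using dt_pos by (intro add_nonneg_nonneg) auto
  have "(avg ^^ Suc k) (indicator {v}) u \<le> avg (\<lambda>z. exp (l \<bullet> (z - v)) * ?r ^ k) u"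
    unfolding funpow.simps o_apply by (rule avg_mono[OF Suc.IH Suc.prems])
  also have "\<dots> = exp (l \<bullet> (u - v)) * ?r ^ k * mgf l u"
    unfolding avg_def mgf_def sum_distrib_left
  proof (intro sum.cong refl)
    fix z
    have "exp (l \<bullet> (z - v)) = exp (l \<bullet> (u - v)) * exp (l \<bullet> (z - u))"
      by (simp add: inner_diff_right flip: exp_add)
    then show "p u z * (exp (l \<bullet> (z - v)) * ?r ^ k) = exp (l \<bullet> (u - v)) * ?r ^ k * (p u z * exp (l \<bullet> (z - u)))"
      by (simp only: mult_ac)
  qed
  also have "\<dots> \<le> exp (l \<bullet> (u - v)) * ?r ^ k * ?r"
    using r by (intro mult_left_mono mgf_bounds Suc.prems) auto
  finally show ?case by (simp add: mult_ac)
qed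

text \<open>Exponential change of measure, renormalised separately at each vertex; to first order
  its drift per step is \<open>dt\<close> times \<open>l\<close>.\<close>

definition tilt :: "complex \<Rightarrow> complex \<Rightarrow> complex \<Rightarrow> real" where
  "tilt l u z = p u z * exp (l \<bullet> (z - u)) / mgf l u"

lemma mgf_ge_1: "u \<in> V \<Longrightarrow> 1 \<le> mgf l u"
proof -
  assume u: "u \<in> V"
  have "0 \<le> dt * (norm l)\<^sup>2 / 2 * exp (- (norm l * h))" using dt_pos by simp
  then show ?thesis using mgf_bounds(1)[OF u, of l] by linarith
qed

lemma tilt_kernel: "markov_kernel V S (tilt l)"
proof
  fix u assume u: "u \<in> V"
  show "S u \<subseteq> V" by (rule S_subset[OF u])
  show "0 \<le> tilt l u z" if "z \<in> S u" for z
    using p_nonneg[OF u that] mgf_ge_1[OF u, of l] by (simp add: tilt_def)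
  show "(\<Sum>z\<in>S u. tilt l u z) = 1"
    using mgf_ge_1[OF u, of l] by (simp add: tilt_def flip: sum_divide_distrib mgf_def)
qed

text \<open>Along a path the exponential factors telescope to the endpoints, and each of the
  \<open>k\<close> normalisations is at least \<open>\<alpha>\<close>.\<close>

lemma tilt_compare:
  fixes l :: complex
  assumes u: "u \<in> V" and f: "\<And>z. z \<in> V \<Longrightarrow> 0 \<le> f z"
  defines "\<alpha> \<equiv> 1 + dt * (norm l)\<^sup>2 / 2 * exp (- (norm l * h))"
  shows "\<alpha> ^ k * exp (l \<bullet> u) * (markov_kernel.avg S (tilt l) ^^ k) (\<lambda>z. f z / exp (l \<bullet> z)) u \<le> (avg ^^ k) f u"
  using u
proof (induction k arbitrary: u)
  case 0
  then show ?case by simp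
next
  case (Suc k)
  interpret T: markov_kernel V S "tilt l" by (rule tilt_kernel)
  let ?G = "(T.avg ^^ k) (\<lambda>z. f z / exp (l \<bullet> z))"
  have G: "0 \<le> ?G z" if "z \<in> V" for z
  proof -
    have "(T.avg ^^ k) (\<lambda>z. 0) z \<le> ?G z" by (rule T.iter_mono[OF _ that]) (simp add: f)
    then show ?thesis by (simp add: T.iter_const[OF that])
  qed
  have \<alpha>: "0 \<le> \<alpha>" using dt_pos unfolding \<alpha>_def by (intro add_nonneg_nonneg) auto
  have m: "0 < mgf l u" using mgf_ge_1[OF Suc.prems, of l] by simp
  have "T.avg (\<lambda>_. 0) u \<le> T.avg ?G u" by (rule T.avg_mono[OF G Suc.prems])
  moreover have "T.avg (\<lambda>_. 0) u = 0" by (simp add: T.avg_def)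
  ultimately have T0: "0 \<le> T.avg ?G u" by simp
  have "\<alpha> ^ Suc k * exp (l \<bullet> u) * T.avg ?G u \<le> mgf l u * (\<alpha> ^ k * exp (l \<bullet> u) * T.avg ?G u)"
    using mult_right_mono[OF mgf_bounds(1)[OF Suc.prems, of l, folded \<alpha>_def], of "\<alpha> ^ k * exp (l \<bullet> u) * T.avg ?G u"] \<alpha> T0
    by (simp add: mult_ac)
  also have "\<dots> = avg (\<lambda>z. \<alpha> ^ k * exp (l \<bullet> z) * ?G z) u"
    using m by (simp add: T.avg_def avg_def tilt_def sum_distrib_left inner_diff_right exp_diff mult_ac)
  also have "\<dots> \<le> avg ((avg ^^ k) f) u" by (rule avg_mono[OF Suc.IH Suc.prems])
  finally show ?case by simp
qed

lemma tilt_drift: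
  assumes u: "u \<in> V" and small: "norm l * h \<le> 1"
  shows "norm ((\<Sum>z\<in>S u. tilt l u z *\<^sub>R (z - u)) - dt *\<^sub>R l) \<le> 3 * norm l * (norm l * h) * dt"
    and "(\<Sum>z\<in>S u. tilt l u z * (norm (z - u))\<^sup>2) \<le> 6 * dt"
proof -
  let ?y = "\<lambda>z. l \<bullet> (z - u)" and ?\<eta> = "norm l * h" and ?Z = "mgf l u"
  have Z: "1 \<le> ?Z" by (rule mgf_ge_1[OF u])
  have e3: "exp ?\<eta> \<le> 3" using small exp_le order_trans[of "exp ?\<eta>" "exp 1" 3] by simp
  have \<eta>0: "0 \<le> ?\<eta>" using h_pos by simp
  have l2: "dt * (norm l)\<^sup>2 \<le> ?\<eta>"
  proof -
    have "dt * (norm l)\<^sup>2 \<le> h\<^sup>2 * (norm l)\<^sup>2" by (intro mult_right_mono dt_le) simp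
    also have "\<dots> = ?\<eta> * ?\<eta>" by (simp add: power2_eq_square)
    also have "\<dots> \<le> ?\<eta> * 1" using small \<eta>0 by (intro mult_left_mono) auto
    finally show ?thesis by simp
  qed
  have Z1: "?Z - 1 \<le> 3 / 2 * ?\<eta>"
  proof -
    have "?Z - 1 \<le> dt * (norm l)\<^sup>2 / 2 * exp ?\<eta>" using mgf_bounds(2)[OF u, of l] by simp
    also have "\<dots> \<le> ?\<eta> / 2 * 3" using l2 e3 dt_pos \<eta>0 by (intro mult_mono) auto
    finally show ?thesis by simp
  qed
  \<comment> \<open>Second order remainder of the exponential. The linear term produces the drift
    \<open>dt *\<^sub>R l\<close> through the covariance.\<close>
  define \<rho> where "\<rho> z = exp (?y z) - 1 - ?y z" for z
  have \<rho>: "\<bar>\<rho> z\<bar> \<le> 3 / 2 * (?y z)\<^sup>2" if "z \<in> S u" for z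
  proof -
    have "?y z \<le> exp (?y z) - 1" using exp_ge_add_one_self[of "?y z"] by linarith
    moreover have "exp (?y z) - 1 - ?y z \<le> (?y z)\<^sup>2 / 2 * exp ?\<eta>"
      using exp_quadratic_bounds(2)[OF inner_step_le[OF u that, of l]] by linarith
    moreover have "(?y z)\<^sup>2 / 2 * exp ?\<eta> \<le> (?y z)\<^sup>2 / 2 * 3" using e3 by (intro mult_left_mono) auto
    ultimately show ?thesis unfolding \<rho>_def by (simp add: abs_if)
  qed
  let ?e = "\<Sum>z\<in>S u. (p u z * \<rho> z) *\<^sub>R (z - u)"
  have "norm ?e \<le> (\<Sum>z\<in>S u. p u z * (3 / 2 * (?y z)\<^sup>2) * h)"
  proof (rule order_trans[OF norm_sum sum_mono])
    fix z assume z: "z \<in> S u"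
    show "norm ((p u z * \<rho> z) *\<^sub>R (z - u)) \<le> p u z * (3 / 2 * (?y z)\<^sup>2) * h"
      unfolding norm_scaleR abs_mult
      by (intro mult_mono mult_nonneg_nonneg abs_ge_zero norm_ge_zero)
         (use p_nonneg[OF u z] \<rho>[OF z] step_le[OF u z] in auto)
  qed
  also have "\<dots> = 3 / 2 * h * (\<Sum>z\<in>S u. p u z * (?y z)\<^sup>2)"
    by (simp add: sum_distrib_left mult_ac)
  also have "\<dots> = 3 / 2 * norm l * ?\<eta> * dt"
    unfolding quadratic_moment[OF u] by (simp add: power2_eq_square)
  finally have e: "norm ?e \<le> 3 / 2 * norm l * ?\<eta> * dt" .
  have "(\<Sum>z\<in>S u. (p u z * exp (?y z)) *\<^sub>R (z - u)) = (\<Sum>z\<in>S u. of_real (p u z) * (z - u)) +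
      (\<Sum>z\<in>S u. (p u z * ?y z) *\<^sub>R (z - u)) + ?e"
    by (simp add: \<rho>_def scaleR_conv_of_real algebra_simps flip: sum.distrib)
  then have me: "(\<Sum>z\<in>S u. (p u z * exp (?y z)) *\<^sub>R (z - u)) = dt *\<^sub>R l + ?e"
    by (simp add: mean_zero[OF u] vector_moment[OF u])
  have "(\<Sum>z\<in>S u. tilt l u z *\<^sub>R (z - u)) = (1 / ?Z) *\<^sub>R (\<Sum>z\<in>S u. (p u z * exp (?y z)) *\<^sub>R (z - u))"
    by (simp add: tilt_def scaleR_sum_right)
  also have "\<dots> - dt *\<^sub>R l = (1 / ?Z) *\<^sub>R (?e - (?Z - 1) *\<^sub>R (dt *\<^sub>R l))"
    unfolding me using Z by (simp add: algebra_simps)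
  also have "norm \<dots> \<le> norm (?e - (?Z - 1) *\<^sub>R (dt *\<^sub>R l))"
    using Z by (simp add: divide_le_eq mult_le_cancel_left1)
  also have "\<dots> \<le> norm ?e + norm ((?Z - 1) *\<^sub>R (dt *\<^sub>R l))" by (rule norm_triangle_ineq4)
  also have "\<dots> \<le> 3 / 2 * norm l * ?\<eta> * dt + (3 / 2 * ?\<eta>) * (dt * norm l)"
  proof -
    have "norm ((?Z - 1) *\<^sub>R (dt *\<^sub>R l)) = (?Z - 1) * (dt * norm l)" using Z dt_pos by simp
    also have "\<dots> \<le> (3 / 2 * ?\<eta>) * (dt * norm l)" using dt_pos by (intro mult_right_mono Z1) simp
    finally show ?thesis using e by linarith
  qed
  finally show "norm ((\<Sum>z\<in>S u. tilt l u z *\<^sub>R (z - u)) - dt *\<^sub>R l) \<le> 3 * norm l * ?\<eta> * dt"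
    by (simp add: mult_ac)
  have "(\<Sum>z\<in>S u. tilt l u z * (norm (z - u))\<^sup>2) \<le> (\<Sum>z\<in>S u. 3 * (p u z * (norm (z - u))\<^sup>2))"
  proof (rule sum_mono)
    fix z assume z: "z \<in> S u"
    have "exp (?y z) \<le> exp ?\<eta>" using inner_step_le[OF u z, of l] by simp
    then have "exp (?y z) \<le> 3" using e3 by linarith
    then have "exp (?y z) / ?Z \<le> 3" using Z by (simp add: divide_le_eq)
    then have "exp (?y z) / ?Z * (p u z * (norm (z - u))\<^sup>2) \<le> 3 * (p u z * (norm (z - u))\<^sup>2)"
      using p_nonneg[OF u z] by (intro mult_right_mono) auto
    then show "tilt l u z * (norm (z - u))\<^sup>2 \<le> 3 * (p u z * (norm (z - u))\<^sup>2)" by (simp add: tilt_def mult_ac)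
  qed
  also have "\<dots> = 6 * dt" by (simp add: variance[OF u] dt_def flip: sum_distrib_left)
  finally show "(\<Sum>z\<in>S u. tilt l u z * (norm (z - u))\<^sup>2) \<le> 6 * dt" .
qed

text \<open>Up to the drift error, a step moves by \<open>dt *\<^sub>R l\<close> on average, so the
  distance to \<open>w\<close> is compared with the distance to \<open>w\<close> moved back by that
  amount. \<open>K\<close> becomes the number of steps in \<open>hop\<close>, where the factors 1 +
  1 / K multiply to at most e.\<close>

lemma tilt_second_moment:
  assumes u: "u \<in> V" and small: "norm l * h \<le> 1" and K: "0 < K"
  shows "markov_kernel.avg S (tilt l) (\<lambda>z. (dist z w)\<^sup>2) u \<le>
    (1 + 1 / K) * (dist u (w - dt *\<^sub>R l))\<^sup>2 + (K * (3 * norm l * (norm l * h) * dt)\<^sup>2 + 12 * dt)"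
proof -
  interpret T: markov_kernel V S "tilt l" by (rule tilt_kernel)
  define \<epsilon> where "\<epsilon> = 3 * norm l * (norm l * h) * dt"
  define g where "g = (\<Sum>z\<in>S u. tilt l u z *\<^sub>R (z - u)) - dt *\<^sub>R l"
  define U where "U = u - (w - dt *\<^sub>R l)"
  have g: "norm g \<le> \<epsilon>" using tilt_drift(1)[OF u small] by (simp add: g_def \<epsilon>_def)
  have "T.avg (\<lambda>z. (dist z w)\<^sup>2) u = (\<Sum>z\<in>S u. tilt l u z * ((norm (u - w))\<^sup>2 + 2 * ((u - w) \<bullet> (z - u)) + (norm (z - u))\<^sup>2))"
    unfolding T.avg_def
  proof (intro sum.cong refl arg_cong2[where f="(*)"])
    fix z
    show "(dist z w)\<^sup>2 = (norm (u - w))\<^sup>2 + 2 * ((u - w) \<bullet> (z - u)) + (norm (z - u))\<^sup>2"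
    proof -
      have "(norm (a + b))\<^sup>2 = (norm a)\<^sup>2 + 2 * (a \<bullet> b) + (norm b)\<^sup>2" for a b :: complex
        by (simp add: power2_norm_eq_inner inner_add_left inner_add_right inner_commute)
      from this[of "u - w" "z - u"] show ?thesis by (simp add: dist_norm)
    qed
  qed
  also have "\<dots> = (norm (u - w))\<^sup>2 + 2 * ((u - w) \<bullet> (dt *\<^sub>R l + g)) + (\<Sum>z\<in>S u. tilt l u z * (norm (z - u))\<^sup>2)"
  proof -
    have "(u - w) \<bullet> (dt *\<^sub>R l + g) = (\<Sum>z\<in>S u. tilt l u z * ((u - w) \<bullet> (z - u)))"
      by (simp add: g_def inner_sum_right)
    then show ?thesis
      using T.p_sum[OF u] by (simp add: distrib_left sum.distrib sum_distrib_left mult_ac flip: sum_distrib_right)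
  qed
  also have "\<dots> \<le> (norm (u - w))\<^sup>2 + 2 * ((u - w) \<bullet> (dt *\<^sub>R l + g)) + 6 * dt"
    using tilt_drift(2)[OF u small] by simp
  also have "\<dots> = (norm U)\<^sup>2 - (norm (dt *\<^sub>R l))\<^sup>2 + 2 * (U \<bullet> g) - 2 * ((dt *\<^sub>R l) \<bullet> g) + 6 * dt"
  proof -
    have e: "u - w = U - dt *\<^sub>R l" by (simp add: U_def)
    show ?thesis unfolding e power2_norm_eq_inner
      by (simp only: inner_add_left inner_add_right inner_diff_left inner_diff_right inner_commute[of "dt *\<^sub>R l" U] inner_commute) (simp add: algebra_simps)
  qed
  also have "\<dots> \<le> (norm U)\<^sup>2 + 2 * (norm U * \<epsilon>) + 2 * (norm (dt *\<^sub>R l) * \<epsilon>) + 6 * dt"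
  proof -
    have "U \<bullet> g \<le> norm U * \<epsilon>"
      using Cauchy_Schwarz_ineq2[of U g] mult_left_mono[OF g norm_ge_zero, of U] by linarith
    moreover have "- ((dt *\<^sub>R l) \<bullet> g) \<le> norm (dt *\<^sub>R l) * \<epsilon>"
      using Cauchy_Schwarz_ineq2[of "dt *\<^sub>R l" g] mult_left_mono[OF g norm_ge_zero, of "dt *\<^sub>R l"] by linarith
    ultimately show ?thesis using zero_le_power2[of "norm (dt *\<^sub>R l)"] by linarith
  qed
  \<comment> \<open>Young's inequality with parameter \<open>K\<close>.\<close>
  also have "2 * (norm U * \<epsilon>) \<le> (norm U)\<^sup>2 / K + K * \<epsilon>\<^sup>2"
  proof -
    have "0 \<le> (norm U - K * \<epsilon>)\<^sup>2 / K" using K by simp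
    also have "\<dots> = (norm U)\<^sup>2 / K + K * \<epsilon>\<^sup>2 - 2 * (norm U * \<epsilon>)"
      using K by (simp add: power2_eq_square field_simps)
    finally show ?thesis by simp
  qed
  also have "2 * (norm (dt *\<^sub>R l) * \<epsilon>) \<le> 6 * dt"
  proof -
    have "norm (dt *\<^sub>R l) * \<epsilon> = 3 * (dt * (norm l)\<^sup>2) * (norm l * h) * dt"
      using dt_pos by (simp add: \<epsilon>_def power2_eq_square mult_ac)
    also have "\<dots> \<le> 3 * 1 * 1 * dt"
    proof -
      have "dt * (norm l)\<^sup>2 \<le> h\<^sup>2 * (norm l)\<^sup>2" by (intro mult_right_mono dt_le) simp
      also have "\<dots> = (norm l * h)\<^sup>2" by (simp add: power_mult_distrib mult.commute)
      also have "\<dots> \<le> 1" using small h_pos by (simp add: power_le_one)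
      finally show ?thesis using small h_pos dt_pos by (intro mult_mono mult_nonneg_nonneg) auto
    qed
    finally have "norm (dt *\<^sub>R l) * \<epsilon> \<le> 3 * 1 * 1 * dt" .
    then show ?thesis by linarith
  qed
  finally have "T.avg (\<lambda>z. (dist z w)\<^sup>2) u \<le> (norm U)\<^sup>2 + ((norm U)\<^sup>2 / K + K * \<epsilon>\<^sup>2) + 6 * dt + 6 * dt"
    by simp
  then show ?thesis by (simp add: \<epsilon>_def U_def dist_norm algebra_simps)
qed

lemma tilt_iter_second_moment:
  assumes small: "norm l * h \<le> 1" and K: "0 < K" and u: "u \<in> V"
  defines "B \<equiv> K * (3 * norm l * (norm l * h) * dt)\<^sup>2 + 12 * dt"
  shows "(markov_kernel.avg S (tilt l) ^^ j) (\<lambda>z. (dist z w)\<^sup>2) u \<le>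
    (1 + 1 / K) ^ j * ((dist u (w - (real j * dt) *\<^sub>R l))\<^sup>2 + real j * B)"
proof (induction j arbitrary: w)
  case 0
  then show ?case by simp
next
  case (Suc j)
  interpret T: markov_kernel V S "tilt l" by (rule tilt_kernel)
  let ?c = "1 + 1 / K"
  have c: "1 \<le> ?c" using K by simp
  have B: "0 \<le> B" using K dt_pos by (simp add: B_def)
  have "(T.avg ^^ Suc j) (\<lambda>z. (dist z w)\<^sup>2) u = (T.avg ^^ j) (T.avg (\<lambda>z. (dist z w)\<^sup>2)) u"
    by (simp add: funpow_Suc_right del: funpow.simps)
  also have "\<dots> \<le> (T.avg ^^ j) (\<lambda>z. ?c * (dist z (w - dt *\<^sub>R l))\<^sup>2 + B) u"
    unfolding B_def by (rule T.iter_mono[OF tilt_second_moment[OF _ small K] u])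
  also have "\<dots> = ?c * (T.avg ^^ j) (\<lambda>z. (dist z (w - dt *\<^sub>R l))\<^sup>2) u + B"
    by (rule T.iter_affine[OF u])
  also have "\<dots> \<le> ?c * (?c ^ j * ((dist u (w - dt *\<^sub>R l - (real j * dt) *\<^sub>R l))\<^sup>2 + real j * B)) + ?c ^ Suc j * B"
    using c B one_le_power[OF c, of "Suc j"] by (intro add_mono mult_left_mono Suc.IH) (auto simp: mult_le_cancel_right1)
  also have "w - dt *\<^sub>R l - (real j * dt) *\<^sub>R l = w - (real (Suc j) * dt) *\<^sub>R l"
    by (simp add: algebra_simps)
  finally show ?case by (simp add: algebra_simps)
qed

text \<open>With tilt (v - u) / s the drift leads from \<open>u\<close> to \<open>v\<close> in
  \<open>k\<close> steps, and a second moment bound leaves mass at least 1 / 2 within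
  \<open>r\<close> of \<open>v\<close>. Undoing the tilt costs D^2 / s, of which the normalisations
  give back about half; \<open>r\<close> enters because the endpoint is only near
  \<open>v\<close>.\<close>

lemma hop:
  fixes v :: complex
  assumes u: "u \<in> V" and k: "0 < k"
  defines "s \<equiv> real k * dt" and "D \<equiv> dist u v"
  assumes small: "D * h \<le> s" and r: "0 < r" "54 * (D * (D * h / s))\<^sup>2 + 72 * s \<le> r\<^sup>2"
  shows "exp (- D\<^sup>2 / (2 * s) * (1 + 2 * (D * h / s)) - D * r / s) / 2 \<le> (avg ^^ k) (indicator (cball v r)) u"
proof -
  define l where "l = (1 / s) *\<^sub>R (v - u)"
  interpret T: markov_kernel V S "tilt l" by (rule tilt_kernel)
  define \<eta> where "\<eta> = D * h / s"
  have s: "0 < s" using k dt_pos by (simp add: s_def)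
  have D0: "0 \<le> D" by (simp add: D_def)
  have nl: "norm l = D / s" using s by (simp add: l_def D_def dist_norm norm_minus_commute)
  have \<eta>: "norm l * h = \<eta>" by (simp add: nl \<eta>_def)
  have \<eta>1: "0 \<le> \<eta>" "\<eta> \<le> 1" using small s D0 h_pos by (auto simp: \<eta>_def)
  have kR: "0 < real k" using k by simp
  have ksl: "real k * dt * norm l = D" using s by (simp add: nl flip: s_def)
  define \<alpha> where "\<alpha> = 1 + dt * (norm l)\<^sup>2 / 2 * exp (- \<eta>)"
  let ?f = "indicator (cball v r) :: complex \<Rightarrow> real"
  have conc: "1 / 2 \<le> (T.avg ^^ k) ?f u"
  proof -
    \<comment> \<open>With at most e \<le> 3 from the growth factors, the second moment is at most 3
      (9 (D \<eta>)^2 + 12 s); the hypothesis on \<open>r\<close> asks for twice this.\<close>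
    let ?m = "(T.avg ^^ k) (\<lambda>z. (dist z v)\<^sup>2) u"
    have "?m \<le> (1 + 1 / real k) ^ k * ((dist u (v - (real k * dt) *\<^sub>R l))\<^sup>2 +
        real k * (real k * (3 * norm l * (norm l * h) * dt)\<^sup>2 + 12 * dt))"
      by (rule tilt_iter_second_moment[OF _ kR u]) (simp add: \<eta> \<eta>1)
    also have "v - (real k * dt) *\<^sub>R l = u" using s by (simp add: l_def flip: s_def)
    also have "real k * (real k * (3 * norm l * (norm l * h) * dt)\<^sup>2 + 12 * dt) = (3 * D * \<eta>)\<^sup>2 + 12 * s"
      unfolding \<eta> ksl[symmetric] by (simp add: s_def power2_eq_square algebra_simps)
    also have "(1 + 1 / real k) ^ k * ((dist u u)\<^sup>2 + ((3 * D * \<eta>)\<^sup>2 + 12 * s)) \<le> 3 * ((3 * D * \<eta>)\<^sup>2 + 12 * s)"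
    proof -
      have "(1 + 1 / real k) ^ k \<le> exp (1 / real k) ^ k"
        by (intro power_mono exp_ge_add_one_self) auto
      also have "\<dots> = exp 1" using k by (simp flip: exp_of_nat_mult)
      also have "\<dots> \<le> 3" by (rule exp_le)
      finally have "(1 + 1 / real k) ^ k * ((3 * D * \<eta>)\<^sup>2 + 12 * s) \<le> 3 * ((3 * D * \<eta>)\<^sup>2 + 12 * s)"
        using s by (intro mult_right_mono) auto
      then show ?thesis by simp
    qed
    finally have m: "?m \<le> 27 * (D * \<eta>)\<^sup>2 + 36 * s" by (simp add: power_mult_distrib)
    \<comment> \<open>Chebyshev's inequality, by comparing the indicator with 1 - (dist z v)^2 /
      r^2.\<close>
    have "1 - (1 / r\<^sup>2) * ?m = (T.avg ^^ k) (\<lambda>z. - (1 / r\<^sup>2) * (dist z v)\<^sup>2 + 1) u"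
      unfolding T.iter_affine[OF u] by simp
    also have "\<dots> \<le> (T.avg ^^ k) ?f u"
    proof (rule T.iter_mono[OF _ u])
      fix z
      show "- (1 / r\<^sup>2) * (dist z v)\<^sup>2 + 1 \<le> ?f z"
      proof (cases "z \<in> cball v r")
        case False
        then have "r\<^sup>2 \<le> (dist z v)\<^sup>2" using r by (intro power_mono) (auto simp: dist_commute)
        then show ?thesis using False r by simp
      qed simp
    qed
    finally have "1 - ?m / r\<^sup>2 \<le> (T.avg ^^ k) ?f u" by simp
    moreover have "?m / r\<^sup>2 \<le> 1 / 2"
      using m r by (simp add: divide_le_eq \<eta>_def)
    ultimately show ?thesis by linarith
  qed
  define C where "C = exp (- (l \<bullet> v) - norm l * r)"
  have le: "C * ?f z \<le> ?f z / exp (l \<bullet> z)" for z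
  proof (cases "z \<in> cball v r")
    case True
    then have "norm (z - v) \<le> r" by (simp add: dist_norm norm_minus_commute)
    then have "l \<bullet> (z - v) \<le> norm l * r"
      using norm_cauchy_schwarz[of l "z - v"] mult_left_mono[of "norm (z - v)" r "norm l"] by simp
    then have "- (l \<bullet> v) - norm l * r \<le> - (l \<bullet> z)" by (simp add: inner_diff_right)
    then have "C \<le> exp (- (l \<bullet> z))" by (simp add: C_def)
    then show ?thesis using True by (simp add: exp_minus divide_inverse)
  qed simp
  have "C * (1 / 2) \<le> C * (T.avg ^^ k) ?f u" using conc by (intro mult_left_mono) (auto simp: C_def)
  also have "\<dots> = (T.avg ^^ k) (\<lambda>z. C * ?f z) u" by (rule T.iter_cmult[OF u, symmetric])
  also have "\<dots> \<le> (T.avg ^^ k) (\<lambda>z. ?f z / exp (l \<bullet> z)) u" by (rule T.iter_mono[OF le u])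
  finally have "\<alpha> ^ k * exp (l \<bullet> u) * (C * (1 / 2)) \<le> \<alpha> ^ k * exp (l \<bullet> u) * (T.avg ^^ k) (\<lambda>z. ?f z / exp (l \<bullet> z)) u"
    using dt_pos by (intro mult_left_mono) (auto simp: \<alpha>_def)
  also have "\<dots> \<le> (avg ^^ k) ?f u"
    unfolding \<alpha>_def \<eta>[symmetric] by (rule tilt_compare[OF u]) simp
  finally have main: "\<alpha> ^ k * exp (l \<bullet> u) * C / 2 \<le> (avg ^^ k) ?f u" by simp
  define x where "x = dt * (norm l)\<^sup>2 / 2 * exp (- \<eta>)"
  have dl: "dt * (norm l)\<^sup>2 \<le> \<eta>\<^sup>2"
    using mult_right_mono[OF dt_le, of "(norm l)\<^sup>2"] by (simp add: power_mult_distrib mult.commute flip: \<eta>)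
  have x0: "0 \<le> x" using dt_pos by (simp add: x_def)
  have xle: "x \<le> dt * (norm l)\<^sup>2 / 2" using \<eta>1 dt_pos mult_left_mono[of "exp (- \<eta>)" 1 "dt * (norm l)\<^sup>2 / 2"] by (simp add: x_def)
  have e2: "\<eta>\<^sup>2 \<le> \<eta>" using \<eta>1 by (simp add: power2_eq_square mult_left_le)
  have x1: "x \<le> \<eta> / 2" using xle dl e2 by linarith
  have kd: "real k * (dt * (norm l)\<^sup>2) = D\<^sup>2 / s"
    using s by (simp add: nl power_divide power2_eq_square flip: s_def) (simp add: s_def)
  \<comment> \<open>One \<open>\<eta>\<close> is lost to exp (- \<eta>) in the moment bound, the
    other to the quadratic term of ln (1 + x).\<close>
  have "D\<^sup>2 / (2 * s) * (1 - 2 * \<eta>) \<le> real k * (x - x\<^sup>2)"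
  proof -
    have "D\<^sup>2 / (2 * s) * (1 - 2 * \<eta>) \<le> D\<^sup>2 / (2 * s) * (exp (- \<eta>) - \<eta>)"
      using s exp_ge_add_one_self[of "- \<eta>"] by (intro mult_left_mono) auto
    also have "\<dots> = real k * x - real k * (dt * (norm l)\<^sup>2 / 2) * \<eta>"
    proof -
      have e: "D\<^sup>2 / (2 * s) = real k * (dt * (norm l)\<^sup>2) / 2" unfolding kd by simp
      show ?thesis unfolding e x_def by (simp add: field_simps)
    qed
    also have "\<dots> \<le> real k * x - real k * x * x"
    proof -
      have "real k * x * x \<le> real k * (dt * (norm l)\<^sup>2 / 2) * \<eta>"
        using xle x1 x0 \<eta>1 dt_pos by (intro mult_mono mult_left_mono) auto
      then show ?thesis by simp
    qed
    finally show ?thesis by (simp add: power2_eq_square algebra_simps)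
  qed
  also have "real k * (x - x\<^sup>2) \<le> real k * ln (1 + x)"
    using ln_one_plus_pos_lower_bound[OF x0] x1 \<eta>1 by (intro mult_left_mono) auto
  also have "\<dots> = ln (\<alpha> ^ k)" using x0 by (simp add: ln_realpow \<alpha>_def x_def)
  finally have "exp (D\<^sup>2 / (2 * s) * (1 - 2 * \<eta>)) \<le> \<alpha> ^ k"
    using x0 by (subst (asm) ln_ge_iff) (auto simp: \<alpha>_def x_def)
  moreover have "exp (l \<bullet> u) * C = exp (- D\<^sup>2 / s - D * r / s)"
  proof -
    have "l \<bullet> (u - v) = l \<bullet> (- (v - u))" by simp
    also have "\<dots> = - ((norm (v - u))\<^sup>2 / s)"
      unfolding l_def inner_minus_right inner_scaleR_left power2_norm_eq_inner by simp
    finally have "l \<bullet> (u - v) = - D\<^sup>2 / s" by (simp add: D_def dist_norm norm_minus_commute)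
    then have "l \<bullet> u + (- (l \<bullet> v) - norm l * r) = - D\<^sup>2 / s - D * r / s" by (simp add: nl inner_diff_right)
    then show ?thesis unfolding C_def by (simp flip: exp_add)
  qed
  ultimately have "exp (D\<^sup>2 / (2 * s) * (1 - 2 * \<eta>)) * exp (- D\<^sup>2 / s - D * r / s) / 2 \<le> \<alpha> ^ k * exp (l \<bullet> u) * C / 2"
    by (simp add: mult.assoc)
  moreover have "exp (D\<^sup>2 / (2 * s) * (1 - 2 * \<eta>)) * exp (- D\<^sup>2 / s - D * r / s) = exp (- D\<^sup>2 / (2 * s) * (1 + 2 * \<eta>) - D * r / s)"
    unfolding exp_add[symmetric] using s by (simp add: field_simps)
  ultimately show ?thesis using main by (simp add: \<eta>_def)
qed

end

section \<open>Hitting a single vertex\<close>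

text \<open>Balls of radius d / 2 around the points are disjoint and fit into the ball of radius R +
  d; compare areas.\<close>

lemma packing_finite_card:
  fixes A :: "complex set"
  assumes A: "finite A" "A \<subseteq> cball v R" and d: "0 < d" and R: "0 \<le> R"
    and sep: "\<And>x y. x \<in> A \<Longrightarrow> y \<in> A \<Longrightarrow> x \<noteq> y \<Longrightarrow> d \<le> dist x y"
  shows "real (card A) \<le> (2 * R / d + 2)\<^sup>2"
proof -
  let ?c = "unit_ball_vol (real DIM(complex))"
  have c: "0 < ?c" by (rule unit_ball_vol_pos) simp
  have lm: "ball x r \<in> lmeasurable" for x :: complex and r by simp
  have "(\<Sum>x\<in>A. measure lebesgue (ball x (d / 2))) = measure lebesgue (\<Union>x\<in>A. ball x (d / 2))"
  proof (rule measure_negligible_finite_Union_image[symmetric, OF A(1) lm])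
    show "pairwise (\<lambda>x y. negligible (ball x (d / 2) \<inter> ball y (d / 2))) A"
    proof (rule pairwiseI)
      fix x y assume "x \<in> A" "y \<in> A" "x \<noteq> y"
      then have "d \<le> dist x y" by (rule sep)
      then have "ball x (d / 2) \<inter> ball y (d / 2) = {}" by (intro disjoint_ballI) simp
      then show "negligible (ball x (d / 2) \<inter> ball y (d / 2))" by simp
    qed
  qed
  also have "\<dots> \<le> measure lebesgue (ball v (R + d))"
  proof (rule measure_mono_fmeasurable[OF _ _ lm])
    show "(\<Union>x\<in>A. ball x (d / 2)) \<subseteq> ball v (R + d)"
    proof safe
      fix x y assume "x \<in> A" "y \<in> ball x (d / 2)"
      moreover have "dist v y \<le> dist v x + dist x y" by (rule dist_triangle)
      ultimately show "y \<in> ball v (R + d)" using A(2) d by auto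
    qed
    show "(\<Union>x\<in>A. ball x (d / 2)) \<in> sets lebesgue" by (intro sets.finite_UN A(1) fmeasurableD lm)
  qed
  finally have "real (card A) * (?c * (d / 2)\<^sup>2) \<le> ?c * (R + d)\<^sup>2"
    using d R by (simp add: content_ball)
  then have "real (card A) * (d / 2)\<^sup>2 \<le> (R + d)\<^sup>2" using c by (simp add: mult.left_commute)
  then have "real (card A) \<le> (R + d)\<^sup>2 / (d / 2)\<^sup>2" using d by (simp add: pos_le_divide_eq)
  also have "\<dots> = (2 * R / d + 2)\<^sup>2" using d by (simp add: field_simps power2_eq_square)
  finally show ?thesis .
qed

lemma packing_bound:
  fixes A :: "complex set"
  assumes A: "A \<subseteq> cball v R" and d: "0 < d" and R: "0 \<le> R"
    and sep: "\<And>x y. x \<in> A \<Longrightarrow> y \<in> A \<Longrightarrow> x \<noteq> y \<Longrightarrow> d \<le> dist x y"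
  shows "finite A" "real (card A) \<le> (2 * R / d + 2)\<^sup>2"
proof -
  let ?M = "(2 * R / d + 2)\<^sup>2"
  have bound: "real (card B) \<le> ?M" if "finite B" "B \<subseteq> A" for B
    using that A sep by (intro packing_finite_card[OF that(1) _ d R]) blast+
  show "finite A"
  proof (rule ccontr)
    assume "infinite A"
    then obtain B where "B \<subseteq> A" "finite B" "card B = nat \<lceil>?M\<rceil> + 1" using infinite_arbitrarily_large by blast
    then have "real (nat \<lceil>?M\<rceil>) + 1 \<le> ?M" using bound[of B] by simp
    then show False using real_nat_ceiling_ge[of ?M] by linarith
  qed
  then show "real (card A) \<le> ?M" using bound by blast
qed

lemma exp_minus_1_le_half: "exp (- 1) \<le> (1 / 2 :: real)"
proof -
  have "2 \<le> exp (1::real)" using exp_ge_add_one_self[of 1] by simp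
  then have "inverse (exp 1) \<le> inverse (2::real)" by (rule le_imp_inverse_le) simp
  then show ?thesis by (simp add: exp_minus)
qed

text \<open>An elementary form of Stirling's bound, n! \<le> e n (n / e)^n, gives a loss of order
  \<open>x\<close>, which is polynomial and therefore harmless.\<close>

lemma poisson_mode_lower:
  fixes x :: real
  assumes "1 \<le> x"
  shows "exp (- 2) / x \<le> exp (- x) * x ^ nat \<lfloor>x\<rfloor> / fact (nat \<lfloor>x\<rfloor>)"
proof -
  define n where "n = nat \<lfloor>x\<rfloor>"
  have n: "1 \<le> n" "real n \<le> x" "x \<le> real n + 1"
    using assms by (auto simp: n_def le_nat_iff le_floor_iff)
  have fact_le: "fact n \<le> real n * (real n ^ n * exp (1 - real n))"
    using n(1)
  proof (induction n rule: dec_induct)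
    case base
    then show ?case by simp
  next
    case (step m)
    have m: "0 < real m" using step by simp
    have "exp 1 = exp (1 / real (Suc m)) ^ Suc m"
      by (subst exp_of_nat_mult[symmetric]) simp
    \<comment> \<open>The induction step amounts to e \<le> (1 + 1 / m)^(m + 1).\<close>
    also have "exp (1 / real (Suc m)) \<le> real (Suc m) / real m"
    proof -
      define y where "y = 1 / real (Suc m)"
      have y: "1 - y = real m / real (Suc m)" by (simp add: y_def field_simps)
      have "exp y * (1 - y) \<le> exp y * exp (- y)"
        using exp_ge_add_one_self[of "- y"] by (intro mult_left_mono) auto
      then have "exp y * (real m / real (Suc m)) \<le> 1" unfolding y by (simp flip: exp_add)
      then have "exp y \<le> real (Suc m) / real m" using m by (simp add: pos_le_divide_eq pos_divide_le_eq del: of_nat_Suc)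
      then show ?thesis by (simp only: y_def)
    qed
    then have "exp (1 / real (Suc m)) ^ Suc m \<le> (real (Suc m) / real m) ^ Suc m" by (intro power_mono) auto
    finally have e: "exp 1 * real m ^ Suc m \<le> real (Suc m) ^ Suc m"
      using m by (simp add: power_divide pos_le_divide_eq del: power_Suc)
    have "fact (Suc m) \<le> real (Suc m) * (real m * (real m ^ m * exp (1 - real m)))"
      using step.IH by (simp add: mult_left_mono del: of_nat_Suc)
    also have "real m * (real m ^ m * exp (1 - real m)) = (exp 1 * real m ^ Suc m) * exp (1 - real (Suc m))"
      by (simp add: mult_ac exp_diff exp_add exp_minus divide_inverse)
    also have "real (Suc m) * \<dots> \<le> real (Suc m) * (real (Suc m) ^ Suc m * exp (1 - real (Suc m)))"
      using e by (intro mult_left_mono mult_right_mono) auto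
    finally show ?case .
  qed
  have x: "0 < x" using assms by simp
  have "exp (- 2) / x * fact n \<le> exp (- 2) / x * (real n * (real n ^ n * exp (1 - real n)))"
    using fact_le x by (intro mult_left_mono) auto
  also have "\<dots> = exp (- real n - 1) * real n ^ n * (real n / x)"
  proof -
    have "exp (- 2) * exp (1 - real n) = exp (- real n - 1)" by (simp flip: exp_add)
    then show ?thesis by (metis (no_types, opaque_lifting) mult.assoc mult.commute times_divide_eq_left)
  qed
  also have "\<dots> \<le> exp (- x) * x ^ n * 1"
    using n x by (intro mult_mono power_mono) (auto simp: divide_le_eq_1)
  finally show ?thesis by (simp add: n_def[symmetric] pos_le_divide_eq)
qed

context planar_walk
begin

lemma finite_vertices: "0 \<le> r \<Longrightarrow> finite {z \<in> V. dist z v \<le> r * h}"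
  and card_vertices: "0 \<le> r \<Longrightarrow> real (card {z \<in> V. dist z v \<le> r * h}) \<le> (2 * r / \<delta> + 2)\<^sup>2"
proof -
  assume r: "0 \<le> r"
  have "{z \<in> V. dist z v \<le> r * h} \<subseteq> cball v (r * h)" by (auto simp: dist_commute)
  from packing_bound[OF this, of "\<delta> * h"] separated r h_pos delta_pos
  show "finite {z \<in> V. dist z v \<le> r * h}"
    "real (card {z \<in> V. dist z v \<le> r * h}) \<le> (2 * r / \<delta> + 2)\<^sup>2" by auto
qed

lemma avg_ge_single: "u \<in> V \<Longrightarrow> z \<in> S u \<Longrightarrow> (\<And>w. w \<in> V \<Longrightarrow> 0 \<le> f w) \<Longrightarrow> c0 * f z \<le> avg f u"
proof -
  assume u: "u \<in> V" and z: "z \<in> S u" and f: "\<And>w. w \<in> V \<Longrightarrow> 0 \<le> f w"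
  \<comment> \<open>Sums over infinite sets are 0 by convention, so total mass 1 forces
    \<open>S u\<close> to be finite.\<close>
  have fin: "finite (S u)" using p_sum[OF u] sum.infinite by fastforce
  have "c0 * f z \<le> p u z * f z" using p_ge[OF u z] f z S_subset[OF u] by (intro mult_right_mono) auto
  also have "\<dots> \<le> avg f u"
    unfolding avg_def using S_subset[OF u] f p_nonneg[OF u] by (intro member_le_sum fin z) auto
  finally show "c0 * f z \<le> avg f u" .
qed

lemma iter_nonneg: "u \<in> V \<Longrightarrow> (\<And>w. w \<in> V \<Longrightarrow> 0 \<le> f w) \<Longrightarrow> 0 \<le> (avg ^^ k) f u"
  using iter_mono[of "\<lambda>_. 0" f u k] iter_const[of u k 0] by simp

lemma iter_stay: "u \<in> V \<Longrightarrow> (\<And>w. w \<in> V \<Longrightarrow> 0 \<le> f w) \<Longrightarrow> c0 ^ k * f u \<le> (avg ^^ k) f u"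
proof (induction k)
  case (Suc k)
  have "c0 ^ Suc k * f u \<le> c0 * (avg ^^ k) f u" using Suc c0_pos by simp
  also have "\<dots> \<le> avg ((avg ^^ k) f) u"
    by (rule avg_ge_single[OF Suc.prems(1) self_in[OF Suc.prems(1)] iter_nonneg[OF _ Suc.prems(2)]])
  finally show ?case by simp
qed simp

text \<open>Each greedy step lowers the number of vertices strictly closer to \<open>v\<close>.
  Surplus steps are spent by staying at \<open>v\<close>.\<close>

lemma reach:
  assumes "u \<in> V" "v \<in> V" "dist u v \<le> r * h" "0 \<le> r" "card {z \<in> V. dist z v < dist u v} \<le> j"
  shows "c0 ^ j \<le> (avg ^^ j) (indicator {v}) u"
  using assms
proof (induction j arbitrary: u)
  case 0
  have "finite {z \<in> V. dist z v < dist u v}"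
    by (rule finite_subset[OF _ finite_vertices[OF \<open>0 \<le> r\<close>, of v]]) (use 0 in auto)
  then have "{z \<in> V. dist z v < dist u v} = {}" using 0 by simp
  then have "u = v" using 0(2) by fastforce
  then show ?case by simp
next
  case (Suc j)
  show ?case
  proof (cases "u = v")
    case True
    then show ?thesis using iter_stay[OF Suc.prems(1), of "indicator {v}" "Suc j"] by simp
  next
    case False
    obtain z where z: "z \<in> S u" "dist z v < dist u v" using closer[OF Suc.prems(1,2) False] by blast
    have zV: "z \<in> V" using z S_subset[OF Suc.prems(1)] by auto
    have fin: "finite {z \<in> V. dist z v < dist u v}"
      by (rule finite_subset[OF _ finite_vertices[OF \<open>0 \<le> r\<close>, of v]]) (use Suc in auto)
    have "{w \<in> V. dist w v < dist z v} \<subset> {w \<in> V. dist w v < dist u v}" using z zV by auto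
    then have "card {w \<in> V. dist w v < dist z v} < card {w \<in> V. dist w v < dist u v}"
      using fin by (rule psubset_card_mono[rotated])
    then have "c0 ^ j \<le> (avg ^^ j) (indicator {v}) z"
      using Suc z zV by (intro Suc.IH) auto
    then have "c0 ^ Suc j \<le> c0 * (avg ^^ j) (indicator {v}) z" using c0_pos by simp
    also have "\<dots> \<le> avg ((avg ^^ j) (indicator {v})) u"
      by (rule avg_ge_single[OF Suc.prems(1) z(1) iter_nonneg]) simp_all
    finally show ?thesis by simp
  qed
qed

lemma c0_le_1: "u \<in> V \<Longrightarrow> c0 \<le> 1"
  using avg_ge_single[OF _ self_in, of u "\<lambda>_. 1"] iter_const[of u 1 1] by simp

text \<open>The numerical constants below leave room for the induction in \<open>reach_ball\<close>, which halves the number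
  of steps: the distance to the target shrinks by a factor below one half relative to the square root
  of the remaining time, up to an additive constant.\<close>

definition min_steps :: real where "min_steps = 10 ^ 7 * \<kappa>"
text \<open>Packing bound for the vertices within 3 * 10^5 * h of the target, which also bounds the
  length of a greedy path.\<close>

definition near_steps :: nat where "near_steps = nat \<lceil>(2 * (3 * 10 ^ 5) / \<delta> + 2)\<^sup>2\<rceil>"
text \<open>Cost of standing still for 3 * \<open>min_steps\<close> steps.\<close>

definition ball_cost :: real where "ball_cost = - 3 * min_steps * ln c0"

text \<open>The term in the squared distance pays for the current hop. The logarithm decreases by at
  least 1 / 3 at each halving, and its factor 3000 turns this into a budget for the additive
  losses.\<close>

lemma reach_ball:
  assumes "3 \<le> min_steps"
  shows "u \<in> V \<Longrightarrow> min_steps \<le> real k \<Longrightarrow> dist u v * h \<le> real k * dt / 100 \<Longrightarrow>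
   exp (- (10 * (dist u v)\<^sup>2 / (real k * dt) + 3000 * ln (real k) + ball_cost)) \<le>
   (avg ^^ k) (indicator (cball v (3 * 10 ^ 5 * h))) u"
proof (induction k arbitrary: u rule: less_induct)
  case (less k)
  let ?B = "cball v (3 * 10 ^ 5 * h)"
  define D s where "D = dist u v" and "s = real k * dt"
  have k0: "0 < real k" using less.prems(2) assms by linarith
  have s: "0 < s" using k0 dt_pos by (simp add: s_def)
  have D0: "0 \<le> D" by (simp add: D_def)
  have Dh: "D * h \<le> s / 100" using less.prems(3) by (simp add: D_def s_def)
  show ?case
  proof (cases "real k < 3 * min_steps")
    \<comment> \<open>Here s < 3 * 10^7 * h^2, and D h \<le> s / 100 gives D \<le> 3 * 10^5 * h: the
      walk is in the ball already and only has to wait.\<close>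
    case True
    have "real k * dt \<le> 3 * min_steps * dt" using True dt_pos by (intro mult_right_mono) auto
    then have "D * h \<le> 3 * min_steps * dt / 100" using Dh unfolding s_def by linarith
    also have "\<dots> = (3 * 10 ^ 5 * h) * h"
      using kappa by (simp add: min_steps_def dt_def power2_eq_square)
    finally have "D \<le> 3 * 10 ^ 5 * h" using h_pos by simp
    then have "u \<in> ?B" by (simp add: D_def dist_commute)
    then have "c0 ^ k \<le> (avg ^^ k) (indicator ?B) u" using iter_stay[OF less.prems(1), of "indicator ?B" k] by simp
    moreover have "exp (- (10 * D\<^sup>2 / s + 3000 * ln (real k) + ball_cost)) \<le> c0 ^ k"
    proof -
      have l: "ln c0 \<le> 0" using c0_pos c0_le_1[OF less.prems(1)] by simp
      have "real k * ln c0 \<ge> 3 * min_steps * ln c0" using True l by (intro mult_right_mono_neg) auto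
      moreover have "0 \<le> 10 * D\<^sup>2 / s" "0 \<le> 3000 * ln (real k)" using s k0 by auto
      ultimately have "- (10 * D\<^sup>2 / s + 3000 * ln (real k) + ball_cost) \<le> real k * ln c0"
        unfolding ball_cost_def by linarith
      also have "exp (real k * ln c0) = c0 ^ k" using c0_pos by (simp add: exp_of_nat_mult)
      finally show ?thesis by simp
    qed
    ultimately show ?thesis by (simp add: D_def s_def)
  next
    case False
    define k1 k2 where "k1 = k div 2" and "k2 = k - k div 2"
    have k9: "9 \<le> real k" using False assms by linarith
    have k12: "real k1 + real k2 = real k" "real k / 3 \<le> real k1" "real k1 \<le> real k / 2" "real k / 2 \<le> real k2"
      "real k2 \<le> 2 / 3 * real k" "k = k1 + k2"
      using k9 by (auto simp: k1_def k2_def of_nat_diff)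
    define s1 s2 where "s1 = real k1 * dt" and "s2 = real k2 * dt"
    have ss: "s / 3 \<le> s1" "s1 \<le> s / 2" "s / 2 \<le> s2"
      using k12(2,3,4) dt_pos mult_right_mono[of _ _ dt] by (auto simp: s_def s1_def s2_def)
    have s12: "0 < s1" "0 < s2" using s ss by auto
    define \<eta> where "\<eta> = D * h / s1"
    have \<eta>: "0 \<le> \<eta>" "\<eta> \<le> 3 / 100"
      using Dh s12 ss D0 h_pos by (auto simp: \<eta>_def divide_le_eq)
    define r where "r = sqrt (54 * (D * \<eta>)\<^sup>2 + 72 * s1)"
    have r2: "r\<^sup>2 = 54 * (D * \<eta>)\<^sup>2 + 72 * s1" using s12 by (simp add: r_def)
    have r0: "0 < r" unfolding r_def using s12 by (intro real_sqrt_gt_zero add_nonneg_pos) auto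
    have r2_le: "r\<^sup>2 \<le> 486 / 10000 * D\<^sup>2 + 36 * s"
    proof -
      have "(D * \<eta>)\<^sup>2 \<le> (D * (3 / 100))\<^sup>2" using D0 \<eta> by (intro power_mono mult_left_mono) auto
      then show ?thesis unfolding r2 using ss(2) by (simp add: power_mult_distrib power_divide)
    qed
    have hop: "exp (- D\<^sup>2 / (2 * s1) * (1 + 2 * \<eta>) - D * r / s1) / 2 \<le> (avg ^^ k1) (indicator (cball v r)) u"
      unfolding D_def s1_def \<eta>_def
    proof (rule hop[OF less.prems(1) _ _ r0])
      show "0 < k1" using k12(2) k9 by (auto intro: gr0I)
      show "dist u v * h \<le> real k1 * dt" using \<eta>(2) s12 by (simp add: \<eta>_def D_def s1_def divide_le_eq)
      show "54 * (dist u v * (dist u v * h / (real k1 * dt)))\<^sup>2 + 72 * (real k1 * dt) \<le> r\<^sup>2"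
        unfolding r2 by (simp add: D_def \<eta>_def s1_def)
    qed
    define c where "c = exp (- (10 * r\<^sup>2 / s2 + 3000 * ln (real k2) + ball_cost))"
    have K2: "min_steps \<le> real k2" using k12(4) False assms by linarith
    \<comment> \<open>Restores the smallness condition for the remaining \<open>k2\<close> steps.
      The lower bound on the number of steps absorbs the term 36 s.\<close>
    have rh: "r * h \<le> s2 / 100"
    proof (rule power2_le_imp_le)
      have hs: "3 * 10 ^ 7 * h\<^sup>2 \<le> s"
        using False dt_pos mult_right_mono[of "3 * min_steps" "real k" dt] kappa by (simp add: s_def min_steps_def dt_def)
      have "(r * h)\<^sup>2 \<le> (486 / 10000 * D\<^sup>2 + 36 * s) * h\<^sup>2"
        unfolding power_mult_distrib by (intro mult_right_mono r2_le) simp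
      also have "\<dots> = 486 / 10000 * (D * h)\<^sup>2 + 36 * s * h\<^sup>2" by (simp add: power_mult_distrib algebra_simps)
      also have "\<dots> \<le> 486 / 10000 * (s / 100)\<^sup>2 + 36 * s * (s / (3 * 10 ^ 7))"
        using Dh D0 h_pos hs s by (intro add_mono mult_left_mono power_mono) auto
      also have "\<dots> \<le> (s / 2 / 100)\<^sup>2" by (simp add: power2_eq_square)
      also have "\<dots> \<le> (s2 / 100)\<^sup>2" using ss s by (intro power_mono) auto
      finally show "(r * h)\<^sup>2 \<le> (s2 / 100)\<^sup>2" .
    qed (use s12 in simp)
    have step: "c \<le> (avg ^^ k2) (indicator ?B) w" if w: "w \<in> V" "w \<in> cball v r" for w
    proof -
      have d: "dist w v \<le> r" using w(2) by (simp add: dist_commute)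
      have "c \<le> exp (- (10 * (dist w v)\<^sup>2 / s2 + 3000 * ln (real k2) + ball_cost))"
        using d s12 unfolding c_def by (simp add: divide_right_mono power_mono)
      also have "\<dots> \<le> (avg ^^ k2) (indicator ?B) w"
        unfolding s2_def
      proof (rule less.IH[OF _ w(1) K2])
        show "k2 < k" using k12(2) k9 by (auto simp: k2_def k1_def)
        show "dist w v * h \<le> real k2 * dt / 100"
          using mult_right_mono[OF d, of h] h_pos rh unfolding s2_def by linarith
      qed
      finally show ?thesis .
    qed
    have "exp (- (10 * D\<^sup>2 / s + 3000 * ln (real k) + ball_cost)) \<le> c * (exp (- D\<^sup>2 / (2 * s1) * (1 + 2 * \<eta>) - D * r / s1) / 2)"
    proof -
      define q where "q = D\<^sup>2 / s"
      have q0: "0 \<le> q" using s by (simp add: q_def)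
      have "D\<^sup>2 / (2 * s1) * (1 + 2 * \<eta>) \<le> D\<^sup>2 / (2 * (s / 3)) * (1 + 2 * (3 / 100))"
        using ss s s12 \<eta> by (intro mult_mono divide_left_mono) auto
      then have a1: "D\<^sup>2 / (2 * s1) * (1 + 2 * \<eta>) \<le> 16 / 10 * q" using q0 by (simp add: q_def)
      have rs: "r\<^sup>2 / s \<le> 486 / 10000 * q + 36"
        using divide_right_mono[OF r2_le, of s] s by (simp add: q_def add_divide_distrib)
      have "D * r / s1 \<le> D * r / (s / 3)" using ss s s12 D0 r0 by (intro divide_left_mono) auto
      also have "\<dots> \<le> (3 / 2 * (D\<^sup>2 + r\<^sup>2)) / s"
        using s sum_squares_bound[of D r] by (simp add: field_simps)
      also have "\<dots> = 3 / 2 * q + 3 / 2 * (r\<^sup>2 / s)" by (simp add: q_def add_divide_distrib)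
      finally have a2: "D * r / s1 \<le> 3 / 2 * q + 3 / 2 * (r\<^sup>2 / s)" .
      have "10 * r\<^sup>2 / s2 \<le> 10 * r\<^sup>2 / (s / 2)" using ss s s12 by (intro divide_left_mono) auto
      then have a3: "10 * r\<^sup>2 / s2 \<le> 20 * (r\<^sup>2 / s)" by simp
      have "ln (real k2) \<le> ln (2 / 3 * real k)" using k12(4,5) k9 by (intro ln_mono) auto
      also have "\<dots> = ln (2 / 3) + ln (real k)" by (rule ln_mult_pos[OF _ k0]) simp
      also have "ln (2 / 3 :: real) \<le> 2 / 3 - 1" by (rule ln_le_minus_one) simp
      finally have a4: "ln (real k2) \<le> ln (real k) - 1 / 3" by simp
      note a5 = exp_minus_1_le_half
      \<comment> \<open>The coefficients of \<open>q\<close> add up to less than 5. The constants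
        are 20 * 36 + 54 + 1 = 775, against the gain of 1000 from the logarithm.\<close>
      have "- (10 * q + 3000 * ln (real k) + ball_cost) \<le>
          - (10 * r\<^sup>2 / s2 + 3000 * ln (real k2) + ball_cost) + (- (D\<^sup>2 / (2 * s1) * (1 + 2 * \<eta>)) - D * r / s1) + - 1"
        using a1 a2 a3 a4 rs q0 by linarith
      then have "exp (- (10 * q + 3000 * ln (real k) + ball_cost)) \<le> c * exp (- (D\<^sup>2 / (2 * s1) * (1 + 2 * \<eta>)) - D * r / s1) * exp (- 1)"
        unfolding c_def exp_add[symmetric] by simp
      also have "\<dots> \<le> c * exp (- (D\<^sup>2 / (2 * s1) * (1 + 2 * \<eta>)) - D * r / s1) * (1 / 2)"
        using a5 by (intro mult_left_mono) (auto simp: c_def)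
      finally show ?thesis by (simp add: q_def)
    qed
    also have "\<dots> \<le> c * (avg ^^ k1) (indicator (cball v r)) u"
      using hop by (intro mult_left_mono) (auto simp: c_def)
    also have "\<dots> \<le> (avg ^^ (k1 + k2)) (indicator ?B) u"
      by (rule iter_chain[OF step _ less.prems(1)]) auto
    finally show ?thesis using k12(6) by (simp add: D_def s_def)
  qed
qed

definition vertex_cost :: real where "vertex_cost = ball_cost - real near_steps * ln c0"

lemma reach_point:
  assumes K: "3 \<le> min_steps" and u: "u \<in> V" and v: "v \<in> V" and k: "min_steps \<le> real k"
    and D: "dist u v * h \<le> real k * dt / 100"
  shows "exp (- (10 * (dist u v)\<^sup>2 / (real k * dt) + 3000 * ln (real k) + vertex_cost)) \<le>
   (avg ^^ (k + near_steps)) (indicator {v}) u"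
proof -
  let ?B = "cball v (3 * 10 ^ 5 * h)"
  have near: "c0 ^ near_steps \<le> (avg ^^ near_steps) (indicator {v}) w" if w: "w \<in> V" "w \<in> ?B" for w
  proof (rule reach[OF w(1) v])
    show d: "dist w v \<le> 3 * 10 ^ 5 * h" using w(2) by (simp add: dist_commute)
    have "card {z \<in> V. dist z v < dist w v} \<le> card {z \<in> V. dist z v \<le> 3 * 10 ^ 5 * h}"
      using d by (intro card_mono finite_vertices) auto
    also have "real \<dots> \<le> (2 * (3 * 10 ^ 5) / \<delta> + 2)\<^sup>2" by (rule card_vertices) simp
    finally have "real (card {z \<in> V. dist z v < dist w v}) \<le> real near_steps"
      unfolding near_steps_def using real_nat_ceiling_ge[of "(2 * (3 * 10 ^ 5) / \<delta> + 2)\<^sup>2"]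
      by (meson order_trans of_nat_mono)
    then show "card {z \<in> V. dist z v < dist w v} \<le> near_steps" by simp
  qed simp
  have "exp (- (10 * (dist u v)\<^sup>2 / (real k * dt) + 3000 * ln (real k) + vertex_cost)) =
      exp (real near_steps * ln c0) * exp (- (10 * (dist u v)\<^sup>2 / (real k * dt) + 3000 * ln (real k) + ball_cost))"
    unfolding exp_add[symmetric] vertex_cost_def by (simp add: algebra_simps)
  also have "exp (real near_steps * ln c0) = c0 ^ near_steps" using c0_pos by (simp add: exp_of_nat_mult)
  also have "c0 ^ near_steps * exp (- (10 * (dist u v)\<^sup>2 / (real k * dt) + 3000 * ln (real k) + ball_cost)) \<le>
      c0 ^ near_steps * (avg ^^ k) (indicator ?B) u"
    using c0_pos by (intro mult_left_mono reach_ball[OF K u k D]) auto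
  also have "\<dots> \<le> (avg ^^ (k + near_steps)) (indicator {v}) u"
    by (rule iter_chain[OF near _ u]) auto
  finally show ?thesis .
qed

text \<open>Most of the time is spent on one straight hop towards \<open>v\<close>; a fraction \<open>\<epsilon>\<close> of it is kept for
  hitting \<open>v\<close> exactly, which costs much less.\<close>

lemma iter_lower:
  assumes K: "3 \<le> min_steps" and u: "u \<in> V" and v: "v \<in> V" and \<epsilon>: "0 < \<epsilon>" "\<epsilon> < 1 / 2" and t: "0 < t"
    and D: "dist u v \<le> R" and x: "real near_steps + 3 \<le> \<epsilon> * (t / dt)" "2 * min_steps \<le> \<epsilon> * (t / dt)"
    and R: "R * h \<le> (1 - 2 * \<epsilon>) * t"
    and r: "0 < r" "54 * (R * (R * h / ((1 - 2 * \<epsilon>) * t)))\<^sup>2 + 72 * t \<le> r\<^sup>2" "r * h \<le> \<epsilon> * t / 200"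
  shows "exp (- ((dist u v)\<^sup>2 / (2 * ((1 - 2 * \<epsilon>) * t)) * (1 + 2 * (R * h / ((1 - 2 * \<epsilon>) * t))) +
      R * r / ((1 - 2 * \<epsilon>) * t) + 20 * r\<^sup>2 / (\<epsilon> * t) + 3000 * ln (t / dt) + vertex_cost + 1))
    \<le> (avg ^^ nat \<lfloor>t / dt\<rfloor>) (indicator {v}) u"
proof -
  define X where "X = t / dt"
  \<comment> \<open>\<open>n\<close> is the Poisson mode. Of these steps \<open>k1\<close> are for
    the hop, \<open>k2\<close> for reaching the ball around \<open>v\<close>, and
    \<open>near_steps\<close> for hitting \<open>v\<close>.\<close>
  define n k2 where "n = nat \<lfloor>X\<rfloor>" and "k2 = nat \<lfloor>\<epsilon> * X\<rfloor>"
  define k1 where "k1 = n - k2 - near_steps"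
  define q where "q = (1 - 2 * \<epsilon>) * t"
  define D' where "D' = dist u v"
  have X: "0 < X" using t dt_pos by (simp add: X_def)
  have tX: "t = X * dt" using dt_pos by (simp add: X_def)
  have \<epsilon>X: "3 \<le> \<epsilon> * X" using x(1) by (simp add: X_def)
  have n: "real n \<le> X" "X - 1 \<le> real n" using X by (auto simp: n_def)
  have k2: "real k2 \<le> \<epsilon> * X" "\<epsilon> * X - 1 \<le> real k2" using \<epsilon>X by (auto simp: k2_def)
  have x1: "real near_steps + 3 \<le> \<epsilon> * X" using x(1) by (simp add: X_def)
  have e2: "2 * (\<epsilon> * X) < X" using \<epsilon> X by simp
  have le: "k2 + near_steps \<le> n"
  proof -
    have "real k2 + real near_steps \<le> real n" using k2 n x1 e2 by linarith
    then show ?thesis by linarith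
  qed
  have k1: "real k1 = real n - real k2 - real near_steps" using le by (simp add: k1_def of_nat_diff)
  have sum: "n = k1 + (k2 + near_steps)" using le by (simp add: k1_def)
  \<comment> \<open>One \<open>\<epsilon>\<close> is used up by \<open>k2\<close>, the other covers
    \<open>near_steps\<close> and rounding.\<close>
  have "(1 - 2 * \<epsilon>) * X \<le> real k1" using k1 n k2 x1 by (simp add: algebra_simps)
  then have "(1 - 2 * \<epsilon>) * X * dt \<le> real k1 * dt" using dt_pos by (intro mult_right_mono) auto
  then have q1: "q \<le> real k1 * dt" by (simp add: q_def tX mult.assoc)
  have "real k1 \<le> X" using k1 n by linarith
  then have q2: "real k1 * dt \<le> t" unfolding tX using dt_pos by (intro mult_right_mono) auto
  have "\<epsilon> * X / 2 \<le> real k2" using k2 \<epsilon>X by linarith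
  then have "\<epsilon> * X / 2 * dt \<le> real k2 * dt" using dt_pos by (intro mult_right_mono) auto
  then have s2: "\<epsilon> * t / 2 \<le> real k2 * dt" by (simp add: tX mult.assoc)
  have q: "0 < q" using \<epsilon> t by (simp add: q_def)
  have s1: "0 < real k1 * dt" using q q1 by linarith
  have D0: "0 \<le> D'" "D' \<le> R" using D by (auto simp: D'_def)
  have \<eta>: "D' * h / (real k1 * dt) \<le> R * h / q"
    using D0 q q1 s1 h_pos by (intro frac_le mult_right_mono) auto
  have \<eta>0: "0 \<le> D' * h / (real k1 * dt)" using D0 s1 h_pos by simp
  have hop: "exp (- D'\<^sup>2 / (2 * (real k1 * dt)) * (1 + 2 * (D' * h / (real k1 * dt))) - D' * r / (real k1 * dt)) / 2
      \<le> (avg ^^ k1) (indicator (cball v r)) u"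
    unfolding D'_def
  proof (rule hop[OF u _ _ r(1)])
    show "0 < k1" using s1 by (auto intro: gr0I)
    have "D' * h \<le> R * h" using D0 h_pos by (intro mult_right_mono) auto
    then show "dist u v * h \<le> real k1 * dt" using R q1 by (simp add: q_def D'_def)
    have "(D' * (D' * h / (real k1 * dt)))\<^sup>2 \<le> (R * (R * h / q))\<^sup>2"
      using D0 \<eta> \<eta>0 by (intro power_mono mult_mono mult_nonneg_nonneg) auto
    then show "54 * (dist u v * (dist u v * h / (real k1 * dt)))\<^sup>2 + 72 * (real k1 * dt) \<le> r\<^sup>2"
      using r(2) q2 unfolding D'_def q_def by linarith
  qed
  define c where "c = exp (- (20 * r\<^sup>2 / (\<epsilon> * t) + 3000 * ln X + vertex_cost))"
  have step: "c \<le> (avg ^^ (k2 + near_steps)) (indicator {v}) w" if w: "w \<in> V" "w \<in> cball v r" for w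
  proof -
    have d: "dist w v \<le> r" using w(2) by (simp add: dist_commute)
    have K2: "min_steps \<le> real k2" using x(2) k2 \<open>\<epsilon> * X / 2 \<le> real k2\<close> by (simp add: X_def)
    have "10 * (dist w v)\<^sup>2 / (real k2 * dt) \<le> 10 * r\<^sup>2 / (\<epsilon> * t / 2)"
      using d s2 \<epsilon> t by (intro frac_le mult_left_mono power_mono) auto
    moreover have "ln (real k2) \<le> ln X"
      using k2 e2 X K2 K \<open>\<epsilon> * X / 2 \<le> real k2\<close> \<epsilon>X by (intro ln_mono) linarith+
    ultimately have "c \<le> exp (- (10 * (dist w v)\<^sup>2 / (real k2 * dt) + 3000 * ln (real k2) + vertex_cost))"
      unfolding c_def by simp
    also have "\<dots> \<le> (avg ^^ (k2 + near_steps)) (indicator {v}) w"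
    proof (rule reach_point[OF K w(1) v K2])
      have "dist w v * h \<le> r * h" using d h_pos by (intro mult_right_mono) auto
      then show "dist w v * h \<le> real k2 * dt / 100" using r(3) s2 by linarith
    qed
    finally show ?thesis .
  qed
  have "D'\<^sup>2 / (2 * (real k1 * dt)) * (1 + 2 * (D' * h / (real k1 * dt))) \<le> D'\<^sup>2 / (2 * q) * (1 + 2 * (R * h / q))"
    using q q1 \<eta> \<eta>0 by (intro mult_mono divide_left_mono) auto
  moreover have "D' * r / (real k1 * dt) \<le> R * r / q"
    using D0 q q1 s1 r(1) by (intro frac_le mult_right_mono) auto
  \<comment> \<open>The summand 1 in the exponent pays for the factor 1 / 2 of
    \<open>hop\<close>.\<close>
  ultimately have "exp (- (D'\<^sup>2 / (2 * q) * (1 + 2 * (R * h / q)) + R * r / q + 20 * r\<^sup>2 / (\<epsilon> * t) + 3000 * ln X + vertex_cost + 1)) \<le>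
      exp (- (20 * r\<^sup>2 / (\<epsilon> * t) + 3000 * ln X + vertex_cost)) * exp (- D'\<^sup>2 / (2 * (real k1 * dt)) * (1 + 2 * (D' * h / (real k1 * dt))) - D' * r / (real k1 * dt)) * exp (- 1)"
    unfolding exp_add[symmetric] by simp
  also have "\<dots> \<le> c * exp (- D'\<^sup>2 / (2 * (real k1 * dt)) * (1 + 2 * (D' * h / (real k1 * dt))) - D' * r / (real k1 * dt)) * (1 / 2)"
  proof -
    show ?thesis using exp_minus_1_le_half unfolding c_def by (intro mult_left_mono) auto
  qed
  also have "\<dots> \<le> c * (avg ^^ k1) (indicator (cball v r)) u"
    using mult_left_mono[OF hop, of c] by (simp add: c_def)
  also have "\<dots> \<le> (avg ^^ (k1 + (k2 + near_steps))) (indicator {v}) u"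
    by (rule iter_chain[OF step _ u]) auto
  finally show ?thesis unfolding sum[symmetric] by (simp add: D'_def q_def X_def n_def)
qed

end

section \<open>The walk on an isoradial graph\<close>

locale regular_isoradial = isoradial h V E for h V E +
  fixes cp cd :: real
  assumes cp_pos: "0 < cp" and cd_pos: "0 < cd"
    and edges_ge: "cp * h \<le> (INF e\<in>E. diameter e)"
    and dual_edges_ge: "cd * h \<le> (INF d\<in>dual_edges V E. diameter d)"
begin

lemma edge_length_ge:
  assumes z: "z \<in> N u"
  shows "cp * h \<le> norm (z - u)"
proof -
  have "bdd_below (diameter ` E)"
  proof (rule bdd_belowI2)
    fix e assume "e \<in> E"
    then obtain a b where "e = {a, b}" by (rule edge_cases)
    then show "0 \<le> diameter e" by (simp add: diameter_pair)
  qed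
  then have "(INF e\<in>E. diameter e) \<le> diameter {u, z}" by (rule cINF_lower) (rule neighbourD(1)[OF z])
  then show ?thesis using edges_ge by (simp add: diameter_pair dist_norm norm_minus_commute)
qed

lemma dual_edge_length_ge:
  assumes z: "z \<in> N u"
  shows "cd * h \<le> norm (rad u z - rad' u z)"
proof -
  have "bdd_below (diameter ` dual_edges V E)"
    by (rule bdd_belowI2[where m = 0]) (auto simp: dual_edges_def diameter_pair)
  moreover have "{centre (left_face u z), centre (left_face z u)} \<in> dual_edges V E"
    unfolding dual_edges_def centre_def
    using left_face_swap_neq[OF z] neighbourD(1)[OF z] incident_faces_eq[OF z]
    by (intro CollectI exI[of _ "left_face u z"] exI[of _ "left_face z u"]) auto
  ultimately have "(INF d\<in>dual_edges V E. diameter d) \<le> diameter {centre (left_face u z), centre (left_face z u)}"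
    by (rule cINF_lower)
  then show ?thesis using dual_edges_ge by (simp add: diameter_pair dist_norm rad_def rad'_def)
qed

text \<open>The dual edge is at least cd h long and the edge, a chord, at most
  \<open>h\<close>.\<close>

lemma edge_weight_ge: "z \<in> N u \<Longrightarrow> cd \<le> \<omega> u z"
proof -
  assume z: "z \<in> N u"
  have d: "0 < norm (z - u)" "norm (z - u) \<le> h"
    using neighbourD(2)[OF z] edge_length_le[OF z] by (auto simp: dist_norm norm_minus_commute)
  have "cd * norm (z - u) \<le> cd * h" using d cd_pos by (intro mult_left_mono) auto
  then show ?thesis using dual_edge_length_ge[OF z] d unfolding kite(5)[OF z] by (simp add: pos_le_divide_eq)
qed

lemma cp_le_1: "u \<in> V \<Longrightarrow> cp \<le> 1"
proof -
  assume "u \<in> V"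
  then obtain z where z: "z \<in> N u" using N_nonempty by blast
  have "cp * h \<le> 1 * h" using edge_length_ge[OF z] edge_length_le[OF z] by (simp add: dist_norm norm_minus_commute)
  then show ?thesis using h_pos by simp
qed

abbreviation "A \<equiv> vertex_area V E"

lemma vertex_area_ge:
  assumes u: "u \<in> V"
  shows "cd * cp\<^sup>2 * h\<^sup>2 / 4 \<le> A u"
proof -
  obtain z where z: "z \<in> N u" using N_nonempty[OF u] by blast
  have "cd * (cp * h)\<^sup>2 \<le> \<omega> u z * (norm (z - u))\<^sup>2"
    using edge_weight_ge[OF z] edge_length_ge[OF z] cp_pos cd_pos h_pos by (intro mult_mono power_mono) auto
  also have "\<dots> \<le> (\<Sum>z\<in>N u. \<omega> u z * (norm (z - u))\<^sup>2)"
    by (rule member_le_sum[OF z _ finite_N]) (use kite(7) in \<open>simp add: less_imp_le\<close>)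
  finally show ?thesis unfolding vertex_area_eq[OF u] by (simp add: power_mult_distrib mult.assoc)
qed

lemma vertex_area_pos: "u \<in> V \<Longrightarrow> 0 < A u"
proof -
  assume u: "u \<in> V"
  have "0 < cd * cp\<^sup>2 * h\<^sup>2 / 4" using cp_pos cd_pos h_pos by simp
  then show ?thesis using vertex_area_ge[OF u] by linarith
qed

lemma weighted_squares: "u \<in> V \<Longrightarrow> (\<Sum>z\<in>N u. \<omega> u z * (norm (z - u))\<^sup>2) = 4 * A u"
  by (simp add: vertex_area_eq)

lemma vertex_weight_pos: "u \<in> V \<Longrightarrow> 0 < vertex_weight V E u"
  unfolding vertex_weight_def using kite(7) by (intro sum_pos finite_N N_nonempty)

text \<open>Rates are at most 2 / (cp h)^2, since the weighted squared edge lengths at a vertex sum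
  to four times its area. \<open>Q\<close> is twice that, so the uniformized walk stays put with
  probability at least 1 / 2.\<close>

definition kap :: real where "kap = 4 / cp\<^sup>2"
definition Q :: real where "Q = kap / h\<^sup>2"

lemma Q_pos: "0 < Q" using cp_pos h_pos by (simp add: Q_def kap_def)

lemma jump_rate_pos: "u \<in> V \<Longrightarrow> 0 < jump_rate V E u"
  using vertex_weight_pos vertex_area_pos by (simp add: jump_rate_def)

lemma jump_rate_le: "u \<in> V \<Longrightarrow> jump_rate V E u \<le> Q / 2"
proof -
  assume u: "u \<in> V"
  have "vertex_weight V E u * (cp * h)\<^sup>2 = (\<Sum>z\<in>N u. \<omega> u z * (cp * h)\<^sup>2)"
    by (simp add: vertex_weight_def sum_distrib_right)
  also have "\<dots> \<le> (\<Sum>z\<in>N u. \<omega> u z * (norm (z - u))\<^sup>2)"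
    using kite(7) edge_length_ge cp_pos h_pos by (intro sum_mono mult_left_mono power_mono) (auto intro: less_imp_le)
  finally have "vertex_weight V E u * (cp * h)\<^sup>2 \<le> 4 * A u" by (simp add: weighted_squares[OF u])
  then show ?thesis
    using vertex_area_pos[OF u] cp_pos h_pos by (simp add: jump_rate_def Q_def kap_def field_simps power_mult_distrib)
qed

text \<open>\<open>embed_pmf\<close> is specified only for nonnegative weights of total mass 1,
  which is verified here.\<close>

lemma pmf_jump_law:
  assumes u: "u \<in> V"
  shows "pmf (jump_law V E u) v = (if v \<in> N u then \<omega> u v / vertex_weight V E u else 0)"
    and "set_pmf (jump_law V E u) = N u"
proof -
  let ?f = "\<lambda>v. if v \<in> N u then \<omega> u v / vertex_weight V E u else 0"
  have m: "0 < vertex_weight V E u" by (rule vertex_weight_pos[OF u])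
  have nn: "0 \<le> ?f v" for v using m kite(7)[of v u] by (simp add: less_imp_le)
  have "(\<integral>\<^sup>+ v. ennreal (?f v) \<partial>count_space UNIV) = (\<Sum>v\<in>N u. ennreal (?f v))"
    by (rule nn_integral_count_space'[OF finite_N]) auto
  also have "\<dots> = ennreal (\<Sum>v\<in>N u. ?f v)" by (rule sum_ennreal) (rule nn)
  also have "(\<Sum>v\<in>N u. ?f v) = 1"
    using m by (simp add: vertex_weight_def flip: sum_divide_distrib)
  finally have one: "(\<integral>\<^sup>+ v. ennreal (?f v) \<partial>count_space UNIV) = 1" by simp
  show "pmf (jump_law V E u) v = ?f v" unfolding jump_law_def by (rule pmf_embed_pmf[OF nn one])
  have "set_pmf (jump_law V E u) = {v. ?f v \<noteq> 0}" unfolding jump_law_def by (rule set_embed_pmf[OF nn one])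
  then show "set_pmf (jump_law V E u) = N u" using m kite(7) by force
qed

section \<open>The lazy kernel as an instance of the abstract walks\<close>

definition S :: "complex \<Rightarrow> complex set" where "S u = insert u (N u)"
definition p :: "complex \<Rightarrow> complex \<Rightarrow> real" where
  "p u z = (if z = u then 1 - jump_rate V E u / Q else \<omega> u z / (2 * A u * Q))"

lemma sum_S: "(\<Sum>z\<in>S u. g z) = g u + (\<Sum>z\<in>N u. g z)"
  using finite_N neighbourD(2)[of u u] unfolding S_def by (subst sum.insert) auto

lemma sum_N_p:
  fixes g :: "complex \<Rightarrow> 'b :: real_vector"
  shows "(\<Sum>z\<in>N u. p u z *\<^sub>R g z) = (1 / (2 * A u * Q)) *\<^sub>R (\<Sum>z\<in>N u. \<omega> u z *\<^sub>R g z)"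
  unfolding scaleR_sum_right using neighbourD(2) by (intro sum.cong refl) (auto simp: p_def)

lemma sum_N_p_1: "u \<in> V \<Longrightarrow> (\<Sum>z\<in>N u. p u z) = jump_rate V E u / Q"
  using sum_N_p[of u "\<lambda>_. 1 :: real"] by (simp add: jump_rate_def vertex_weight_def divide_simps)

definition cstep :: real where "cstep = min (1 / 2) (cd / (2 * kap))"

lemma p_ge:
  assumes u: "u \<in> V" and z: "z \<in> S u"
  shows "cstep \<le> p u z"
proof (cases "z = u")
  case True
  have "jump_rate V E u / Q \<le> 1 / 2" using jump_rate_le[OF u] Q_pos by (simp add: divide_le_eq)
  then show ?thesis using True by (simp add: p_def cstep_def)
next
  case False
  then have zN: "z \<in> N u" using z by (simp add: S_def)
  have k: "0 < kap" using cp_pos by (simp add: kap_def)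
  have "2 * A u * Q \<le> 2 * h\<^sup>2 * Q" using vertex_area_le[OF u] Q_pos by simp
  also have "\<dots> = 2 * kap" using h_pos by (simp add: Q_def)
  finally have "cd / (2 * kap) \<le> \<omega> u z / (2 * A u * Q)"
    using edge_weight_ge[OF zN] cd_pos vertex_area_pos[OF u] Q_pos by (intro frac_le) auto
  then show ?thesis using False by (simp add: p_def cstep_def)
qed

lemma cstep_pos: "0 < cstep" using cp_pos cd_pos by (simp add: cstep_def kap_def)

lemma markov: "markov_kernel V S p"
proof
  fix u assume u: "u \<in> V"
  show "S u \<subseteq> V" using u neighbourD(4) by (auto simp: S_def)
  show "0 \<le> p u z" if "z \<in> S u" for z using p_ge[OF u that] cstep_pos by linarith
  show "(\<Sum>z\<in>S u. p u z) = 1" by (simp add: sum_S sum_N_p_1[OF u]) (simp add: p_def)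
qed

sublocale markov_kernel V S p by (rule markov)

lemma countable_V: "countable V"
proof -
  have "V = (\<Union>n::nat. V \<inter> cball 0 (real n))" by (auto intro: real_arch_simple)
  moreover have "countable (\<Union>n::nat. V \<inter> cball 0 (real n))"
    by (intro countable_UN countableI_type countable_finite locally_finite) auto
  ultimately show ?thesis by simp
qed

sublocale uniformized_walk V E S p Q
proof
  show "countable V" by (rule countable_V)
  show "0 < Q" by (rule Q_pos)
  fix y assume y: "y \<in> V"
  show "0 < jump_rate V E y" by (rule jump_rate_pos[OF y])
  show "finite (set_pmf (jump_law V E y))" "set_pmf (jump_law V E y) \<subseteq> V"
    using finite_N neighbourD(4) by (auto simp: pmf_jump_law(2)[OF y])
  show "jump_rate V E y \<le> Q" using jump_rate_le[OF y] Q_pos by simp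
  fix f
  have m: "0 < vertex_weight V E y" by (rule vertex_weight_pos[OF y])
  have "(\<Sum>w\<in>set_pmf (jump_law V E y). pmf (jump_law V E y) w * f w) = (\<Sum>z\<in>N y. \<omega> y z * f z) / vertex_weight V E y"
    by (simp add: pmf_jump_law[OF y] sum_divide_distrib)
  moreover have "avg f y = (1 - jump_rate V E y / Q) * f y + (\<Sum>z\<in>N y. \<omega> y z * f z) / (2 * A y * Q)"
    using sum_N_p[of y f] by (simp add: avg_def sum_S p_def[of y y])
  moreover have "jump_rate V E y / Q * ((\<Sum>z\<in>N y. \<omega> y z * f z) / vertex_weight V E y) = (\<Sum>z\<in>N y. \<omega> y z * f z) / (2 * A y * Q)"
    using m by (simp add: jump_rate_def)
  ultimately show "avg f y = f y + jump_rate V E y / Q *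
      ((\<Sum>w\<in>set_pmf (jump_law V E y). pmf (jump_law V E y) w * f w) - f y)"
    by (simp add: algebra_simps)
qed

text \<open>The cancellation of the vertex area makes the variance uniform: the weighted squares sum
  to 4 A, and division by 2 A Q leaves 2 / Q at every vertex.\<close>

sublocale planar_walk V S p h kap cstep "cp / 2"
proof
  show "0 < h" by (rule h_pos)
  have "V \<noteq> {}" using infinite_V by auto
  then have "cp \<le> 1" using cp_le_1 by blast
  then have "cp\<^sup>2 \<le> 1" using cp_pos by (simp add: power_le_one)
  then show "1 \<le> kap" using cp_pos by (simp add: kap_def)
  show "0 < cstep" by (rule cstep_pos)
  show "0 < cp / 2" using cp_pos by simp
  fix u assume u: "u \<in> V"
  show "u \<in> S u" by (simp add: S_def)
  show "cstep \<le> p u z" if "z \<in> S u" for z by (rule p_ge[OF u that])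
  show "norm (z - u) \<le> h" if "z \<in> S u" for z
    using that edge_length_le[of z u] h_pos by (auto simp: S_def dist_norm norm_minus_commute)
  show "(\<Sum>z\<in>S u. of_real (p u z) * (z - u)) = 0"
    using sum_N_p[of u "\<lambda>z. z - u"] weight_first_moment[OF u] by (simp add: sum_S scaleR_conv_of_real)
  show "(\<Sum>z\<in>S u. of_real (p u z) * (z - u)\<^sup>2) = 0"
    using sum_N_p[of u "\<lambda>z. (z - u)\<^sup>2"] weight_second_moment[OF u] by (simp add: sum_S scaleR_conv_of_real)
  show "(\<Sum>z\<in>S u. p u z * (norm (z - u))\<^sup>2) = 2 * h\<^sup>2 / kap"
    using sum_N_p[of u "\<lambda>z. (norm (z - u))\<^sup>2"] weighted_squares[OF u] vertex_area_pos[OF u] h_pos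
    by (simp add: sum_S Q_def)
  fix v assume v: "v \<in> V" and neq: "u \<noteq> v"
  obtain z where z: "z \<in> N u" "dist z v < dist u v" using closer_neighbour[OF u v neq] .
  then show "\<exists>z\<in>S u. dist z v < dist u v" by (auto simp: S_def)
  \<comment> \<open>Vertices that are not adjacent must be separated too. The edge towards a
    neighbour closer to \<open>v\<close> has length at least cp h and less than twice the distance
    from \<open>u\<close> to \<open>v\<close>, hence the constant cp / 2.\<close>
  have "cp * h \<le> dist u z" using edge_length_ge[OF z(1)] by (simp add: dist_norm norm_minus_commute)
  also have "\<dots> \<le> dist u v + dist z v" by (rule dist_triangle2)
  finally show "cp / 2 * h \<le> dist u v" using z(2) by simp
qed

lemma heat_kernel_eq:
  "u \<in> V \<Longrightarrow> 0 \<le> t \<Longrightarrow> heat_kernel V E t u v = unif_prob v t u / A v"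
  unfolding heat_kernel_def by (simp add: measure_walk_eq_unif_prob)

end

section \<open>The heat kernel at small times\<close>

context regular_isoradial
begin

lemma dt_Q: "t / dt = Q * t" "dt * Q = 1"
  using h_pos kappa by (simp_all add: dt_def Q_def)

lemma dist_sq_bound: "dist u v \<le> R \<Longrightarrow> (dist u v)\<^sup>2 \<le> R\<^sup>2"
  by (intro power_mono) auto

text \<open>The Chernoff bound with the Gaussian optimum (v - u) / t as tilt. The factor exp (R h /
  t) is the price of discrete jumps, and the last term comes from the lower bound on the vertex
  area.\<close>

lemma log_heat_kernel_ge:
  assumes u: "u \<in> V" and v: "v \<in> V" and t: "0 < t" and D: "dist u v \<le> R"
    and pos: "0 < heat_kernel V E t u v"
  shows "(dist u v)\<^sup>2 - R\<^sup>2 * (exp (R * h / t) - 1) + 2 * t * ln (cd * cp\<^sup>2 / 4 * h\<^sup>2)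
    \<le> - 2 * t * ln (heat_kernel V E t u v)"
proof -
  define D' where "D' = dist u v"
  define l where "l = (1 / t) *\<^sub>R (v - u)"
  have nl: "norm l = D' / t" using t by (simp add: l_def D'_def dist_norm norm_minus_commute)
  have lu: "l \<bullet> (u - v) = - D'\<^sup>2 / t"
  proof -
    have "l \<bullet> (u - v) = l \<bullet> (- (v - u))" by simp
    also have "\<dots> = - ((norm (v - u))\<^sup>2 / t)"
      unfolding l_def inner_minus_right inner_scaleR_left power2_norm_eq_inner by simp
    finally show ?thesis by (simp add: D'_def dist_norm norm_minus_commute)
  qed
  have r: "0 \<le> dt * (norm l)\<^sup>2 / 2 * exp (norm l * h)" using dt_pos by simp
  have "unif_prob v t u \<le> exp (l \<bullet> (u - v)) * exp ((1 + dt * (norm l)\<^sup>2 / 2 * exp (norm l * h) - 1) * Q * t)"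
    using iter_le_exp[OF u] u t r by (intro unif_prob_le) auto
  also have "(1 + dt * (norm l)\<^sup>2 / 2 * exp (norm l * h) - 1) * Q * t = (dt * Q) * (D'\<^sup>2 / (2 * t) * exp (D' * h / t))"
    using t by (simp add: nl power2_eq_square mult_ac)
  finally have P: "unif_prob v t u \<le> exp (- D'\<^sup>2 / t + D'\<^sup>2 / (2 * t) * exp (D' * h / t))"
    unfolding dt_Q(2) lu by (simp flip: exp_add)
  define a where "a = cd * cp\<^sup>2 / 4 * h\<^sup>2"
  have a: "0 < a" "a \<le> A v" using vertex_area_ge[OF v] cp_pos cd_pos h_pos by (simp_all add: a_def)
  have "heat_kernel V E t u v \<le> exp (- D'\<^sup>2 / t + D'\<^sup>2 / (2 * t) * exp (D' * h / t)) / a"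
    unfolding heat_kernel_eq[OF u less_imp_le[OF t]] using P a by (intro frac_le) auto
  then have "ln (heat_kernel V E t u v) \<le> ln (exp (- D'\<^sup>2 / t + D'\<^sup>2 / (2 * t) * exp (D' * h / t)) / a)"
    using pos by (intro ln_mono) auto
  also have "\<dots> = - D'\<^sup>2 / t + D'\<^sup>2 / (2 * t) * exp (D' * h / t) - ln a"
    using a by (simp add: ln_div)
  finally have "- 2 * t * (- D'\<^sup>2 / t + D'\<^sup>2 / (2 * t) * exp (D' * h / t) - ln a) \<le> - 2 * t * ln (heat_kernel V E t u v)"
    using t by (intro mult_left_mono_neg) auto
  moreover have "- 2 * t * (- D'\<^sup>2 / t + D'\<^sup>2 / (2 * t) * exp (D' * h / t) - ln a) =
      D'\<^sup>2 - D'\<^sup>2 * (exp (D' * h / t) - 1) + 2 * t * ln a"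
    using t by (simp add: field_simps)
  moreover have "D'\<^sup>2 * (exp (D' * h / t) - 1) \<le> R\<^sup>2 * (exp (R * h / t) - 1)"
    using D t h_pos unfolding D'_def
    by (intro mult_mono dist_sq_bound) (auto intro!: divide_right_mono mult_right_mono)
  ultimately show ?thesis unfolding D'_def a_def by linarith
qed

text \<open>The single Poisson term at the mode, combined with \<open>iter_lower\<close> and the
  upper bound on the vertex area. Positivity is recorded as well, because \<open>ln\<close> is
  informative only for positive arguments.\<close>

lemma log_heat_kernel_le:
  assumes u: "u \<in> V" and v: "v \<in> V" and \<epsilon>: "0 < \<epsilon>" "\<epsilon> < 1 / 2" and t: "0 < t"
    and D: "dist u v \<le> R" and x: "real near_steps + 3 \<le> \<epsilon> * (t / dt)" "2 * min_steps \<le> \<epsilon> * (t / dt)"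
    and R: "R * h \<le> (1 - 2 * \<epsilon>) * t"
    and r: "0 < r" "54 * (R * (R * h / ((1 - 2 * \<epsilon>) * t)))\<^sup>2 + 72 * t \<le> r\<^sup>2" "r * h \<le> \<epsilon> * t / 200"
  shows "0 < heat_kernel V E t u v"
    and "- 2 * t * ln (heat_kernel V E t u v) \<le> (dist u v)\<^sup>2 +
      (R\<^sup>2 * ((1 + 2 * (R * h / ((1 - 2 * \<epsilon>) * t))) / (1 - 2 * \<epsilon>) - 1) +
       2 * R * r / (1 - 2 * \<epsilon>) + 40 * r\<^sup>2 / \<epsilon> + 6002 * (t * ln (t / dt)) + 2 * t * (vertex_cost + 3) + 2 * t * ln (h\<^sup>2))"
proof -
  define D' where "D' = dist u v"
  define q where "q = (1 - 2 * \<epsilon>) * t"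
  define C where "C = D'\<^sup>2 / (2 * q) * (1 + 2 * (R * h / q)) + R * r / q + 20 * r\<^sup>2 / (\<epsilon> * t) + 3000 * ln (t / dt) + vertex_cost + 1"
  have "1 \<le> kap" by (rule kappa)
  then have K: "3 \<le> min_steps" by (simp add: min_steps_def)
  have X1: "1 \<le> t / dt"
  proof -
    have "0 < t / dt" using t dt_pos by simp
    then have "\<epsilon> * (t / dt) \<le> 1 * (t / dt)" using \<epsilon> by (intro mult_right_mono) auto
    then show ?thesis using x(1) by linarith
  qed
  let ?n = "nat \<lfloor>t / dt\<rfloor>"
  have "exp (- 2) / (t / dt) * exp (- C) \<le> exp (- Q * t) * (Q * t) ^ ?n / fact ?n * (avg ^^ ?n) (indicator {v}) u"
  proof (rule mult_mono)
    show "exp (- 2) / (t / dt) \<le> exp (- Q * t) * (Q * t) ^ ?n / fact ?n"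
      using poisson_mode_lower[OF X1] unfolding dt_Q(1) by simp
    show "exp (- C) \<le> (avg ^^ ?n) (indicator {v}) u"
      unfolding C_def D'_def q_def by (rule iter_lower[OF K u v \<epsilon> t D x R r])
  qed (use Q_pos t in auto)
  also have "\<dots> \<le> unif_prob v t u" by (rule unif_prob_ge[OF u less_imp_le[OF t]])
  finally have P: "exp (- 2) / (t / dt) * exp (- C) \<le> unif_prob v t u" .
  have A: "0 < A v" "A v \<le> h\<^sup>2" using vertex_area_pos[OF v] vertex_area_le[OF v] by auto
  have hk: "exp (- 2) / (t / dt) * exp (- C) / h\<^sup>2 \<le> heat_kernel V E t u v"
    unfolding heat_kernel_eq[OF u less_imp_le[OF t]] using P A X1 unif_prob_nonneg[OF u less_imp_le[OF t]] by (intro frac_le) auto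
  have pos: "0 < exp (- 2) / (t / dt) * exp (- C) / h\<^sup>2" using t dt_pos h_pos by simp
  then show "0 < heat_kernel V E t u v" using hk by linarith
  have "ln (exp (- 2) / (t / dt) * exp (- C) / h\<^sup>2) \<le> ln (heat_kernel V E t u v)"
    by (rule ln_mono[OF hk pos])
  moreover have "ln (exp (- 2) / (t / dt) * exp (- C) / h\<^sup>2) = - 2 - ln (t / dt) - C - ln (h\<^sup>2)"
  proof -
    have "ln (exp (- 2) / X * exp (- C) / H) = - 2 - ln X - C - ln H" if "0 < X" "0 < H" for X H :: real
      using that by (simp add: ln_div ln_mult)
    moreover have "0 < t / dt" "0 < h\<^sup>2" using X1 h_pos by auto
    ultimately show ?thesis by blast
  qed
  ultimately have "- 2 * t * ln (heat_kernel V E t u v) \<le> - 2 * t * (- 2 - ln (t / dt) - C - ln (h\<^sup>2))"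
    using t by (intro mult_left_mono_neg) auto
  \<comment> \<open>The Poisson weight contributes one more logarithm and the constant 2; doubled,
    and added to the terms of \<open>C\<close>, they give 6002 and \<open>vertex_cost + 3\<close> in
    the claim.\<close>
  also have "\<dots> = 2 * t * C + 2 * (t * ln (t / dt)) + 4 * t + 2 * t * ln (h\<^sup>2)"
    by (simp add: algebra_simps)
  also have "2 * t * C = D'\<^sup>2 * ((1 + 2 * (R * h / q)) / (1 - 2 * \<epsilon>)) + 2 * R * r / (1 - 2 * \<epsilon>) + 40 * r\<^sup>2 / \<epsilon> +
      6000 * (t * ln (t / dt)) + 2 * t * (vertex_cost + 1)"
  proof -
    have "2 * t * (D'\<^sup>2 / (2 * q) * (1 + 2 * (R * h / q))) = D'\<^sup>2 * ((1 + 2 * (R * h / q)) / (1 - 2 * \<epsilon>))"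
      using t \<epsilon> by (simp add: q_def)
    moreover have "2 * t * (R * r / q) = 2 * R * r / (1 - 2 * \<epsilon>)" using t \<epsilon> by (simp add: q_def)
    moreover have "2 * t * (20 * r\<^sup>2 / (\<epsilon> * t)) = 40 * r\<^sup>2 / \<epsilon>" using t \<epsilon> by simp
    ultimately show ?thesis unfolding C_def by (simp only: distrib_left)
  qed
  finally have "- 2 * t * ln (heat_kernel V E t u v) \<le> D'\<^sup>2 * ((1 + 2 * (R * h / q)) / (1 - 2 * \<epsilon>)) +
    (2 * R * r / (1 - 2 * \<epsilon>) + 40 * r\<^sup>2 / \<epsilon> + 6002 * (t * ln (t / dt)) + 2 * t * (vertex_cost + 3) + 2 * t * ln (h\<^sup>2))"
    by (simp add: algebra_simps)
  moreover have "D'\<^sup>2 * ((1 + 2 * (R * h / q)) / (1 - 2 * \<epsilon>)) \<le> D'\<^sup>2 + R\<^sup>2 * ((1 + 2 * (R * h / q)) / (1 - 2 * \<epsilon>) - 1)"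
  proof -
    have "0 \<le> R" using D zero_le_dist[of u v] by linarith
    then have "0 \<le> R * h / q" using \<epsilon> t h_pos by (simp add: q_def)
    moreover have "1 \<le> (1 + 2 * y) / (1 - 2 * \<epsilon>)" if "0 \<le> y" for y
      using that \<epsilon> by (simp add: le_divide_eq)
    ultimately have "1 \<le> (1 + 2 * (R * h / q)) / (1 - 2 * \<epsilon>)" by blast
    then have "D'\<^sup>2 * ((1 + 2 * (R * h / q)) / (1 - 2 * \<epsilon>) - 1) \<le> R\<^sup>2 * ((1 + 2 * (R * h / q)) / (1 - 2 * \<epsilon>) - 1)"
      using dist_sq_bound[OF D] by (intro mult_right_mono) (auto simp: D'_def)
    then show ?thesis by (simp add: algebra_simps)
  qed
  ultimately show "- 2 * t * ln (heat_kernel V E t u v) \<le> (dist u v)\<^sup>2 +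
      (R\<^sup>2 * ((1 + 2 * (R * h / ((1 - 2 * \<epsilon>) * t))) / (1 - 2 * \<epsilon>) - 1) +
       2 * R * r / (1 - 2 * \<epsilon>) + 40 * r\<^sup>2 / \<epsilon> + 6002 * (t * ln (t / dt)) + 2 * t * (vertex_cost + 3) + 2 * t * ln (h\<^sup>2))"
    unfolding D'_def q_def by linarith
qed

end

section \<open>Limits as h tends to 0\<close>

lemma lim_t: "0 < \<beta> \<Longrightarrow> ((\<lambda>h::real. h powr \<beta> * \<tau>) \<longlongrightarrow> 0) (at_right 0)"
  by real_asymp

text \<open>The tilt is of order 1 / t and jumps have length at most \<open>h\<close>, so this limit
  makes the quadratic expansion of the exponential moments asymptotically exact.\<close>

lemma lim_h_t: "\<beta> < 1 \<Longrightarrow> 0 < \<tau> \<Longrightarrow> ((\<lambda>h::real. h / (h powr \<beta> * \<tau>)) \<longlongrightarrow> 0) (at_right 0)"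
  by real_asymp

lemma lim_t_hh: "\<beta> < 1 \<Longrightarrow> 0 < \<tau> \<Longrightarrow> filterlim (\<lambda>h::real. (h powr \<beta> * \<tau>) / h\<^sup>2) at_top (at_right 0)"
  by real_asymp



lemma (in isoradial) dist_closest_vertex:
  assumes "closest_vertex_map V pr"
  shows "dist x (pr x) \<le> h"
proof -
  obtain v where "v \<in> V" "dist x v \<le> h" using face_meets_vertex .
  moreover from this(1) have "dist x (pr x) \<le> dist x v"
    using assms unfolding closest_vertex_map_def by blast
  ultimately show ?thesis by linarith
qed


text \<open>Logarithmic costs vanish after multiplication by the time: the number of steps is
  polynomial in 1 / h.\<close>

lemma lim_t_ln_steps:
  "0 < \<beta> \<Longrightarrow> 0 < \<tau> \<Longrightarrow> 0 < c \<Longrightarrow> ((\<lambda>h::real. h powr \<beta> * \<tau> * ln (h powr \<beta> * \<tau> / (h\<^sup>2 / c))) \<longlongrightarrow> 0) (at_right 0)"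
  by real_asymp

lemma lim_t_ln_area:
  "0 < \<beta> \<Longrightarrow> 0 < c \<Longrightarrow> ((\<lambda>h::real. h powr \<beta> * \<tau> * ln (c * h\<^sup>2)) \<longlongrightarrow> 0) (at_right 0)"
  by real_asymp

lemma eventually_less_at_right: "0 < (b::real) \<Longrightarrow> eventually (\<lambda>x. x < b) (at_right 0)"
  using eventually_at_right_real[of 0 b] by (auto elim: eventually_mono)

theorem theorem3p1:
  fixes V :: "real \<Rightarrow> complex set" and E :: "real \<Rightarrow> complex set set"
    and proj :: "real \<Rightarrow> complex \<Rightarrow> complex"
    and c\<^sub>p c\<^sub>d \<beta> \<tau> :: real
    and K :: "(complex \<times> complex) set"
  assumes "\<And>h. h > 0 \<Longrightarrow> isoradial_graph h (V h) (E h)"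
    and "c\<^sub>p > 0" and "c\<^sub>d > 0"
    and "\<And>h. h > 0 \<Longrightarrow> c\<^sub>p * h \<le> (INF e\<in>E h. diameter e)"
    and "\<And>h. h > 0 \<Longrightarrow> c\<^sub>d * h \<le> (INF d\<in>dual_edges (V h) (E h). diameter d)"
    and "\<And>h. h > 0 \<Longrightarrow> closest_vertex_map (V h) (proj h)"
    and "0 < \<beta>" and "\<beta> < 1" and "\<tau> > 0"
    and "compact K"
  shows "uniform_limit K
     (\<lambda>h (x, y). - 2 * (h powr \<beta> * \<tau>) *
        ln (heat_kernel (V h) (E h) (h powr \<beta> * \<tau>) (proj h x) (proj h y)))
     (\<lambda>(x, y). (norm (x - y))\<^sup>2)
     (at_right 0)"
proof (rule uniform_limitI)
  fix e :: real assume e: "0 < e"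
  note \<beta> = assms(7,8) and \<tau> = assms(9)
  have loc: "regular_isoradial h (V h) (E h) c\<^sub>p c\<^sub>d" if "h > 0" for h
    by unfold_locales (use assms that in auto)
  obtain M where M: "\<And>x y. (x, y) \<in> K \<Longrightarrow> norm (x - y) \<le> M"
  proof -
    have "bounded ((\<lambda>(x, y). x - y) ` K)"
      using assms(10) by (intro compact_imp_bounded compact_continuous_image)
        (auto simp: split_beta intro!: continuous_intros)
    then obtain M where "\<forall>z\<in>(\<lambda>(x, y). x - y) ` K. norm z \<le> M" unfolding bounded_iff by blast
    then show ?thesis using that[of M] by force
  qed
  \<comment> \<open>Projection moves both points by at most h < 1, so \<open>R\<close> bounds the
    distances before and after it.\<close>
  define R where "R = \<bar>M\<bar> + 2"
  have R: "2 \<le> R" "M + 2 \<le> R" by (auto simp: R_def)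
  \<comment> \<open>Reserving time costs the factor 1 / (1 - 2 \<epsilon>), which does not improve
    as \<open>h\<close> decreases; \<open>\<epsilon>\<close> has to be fixed in advance, depending
    on \<open>e\<close> only through this loss.\<close>
  have "((\<lambda>\<epsilon>. R\<^sup>2 * ((1 + 0) / (1 - 2 * \<epsilon>) - 1)) \<longlongrightarrow> R\<^sup>2 * ((1 + 0) / (1 - 2 * 0) - 1)) (at_right 0)"
    by (intro tendsto_intros) auto
  then have "eventually (\<lambda>\<epsilon>. R\<^sup>2 * ((1 + 0) / (1 - 2 * \<epsilon>) - 1) < e / 2) (at_right 0)"
    using e by (intro order_tendstoD(2)) auto
  then have "eventually (\<lambda>\<epsilon>. 0 < \<epsilon> \<and> \<epsilon> < 1 / 2 \<and> R\<^sup>2 * ((1 + 0) / (1 - 2 * \<epsilon>) - 1) < e / 2) (at_right 0)"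
    using eventually_at_right_less[of "0 :: real"] eventually_less_at_right[OF half_gt_zero[OF zero_less_one]]
    by eventually_elim auto
  then obtain \<epsilon> where \<epsilon>: "0 < \<epsilon>" "\<epsilon> < 1 / 2" "R\<^sup>2 * ((1 + 0) / (1 - 2 * \<epsilon>) - 1) < e / 2"
    using eventually_happens'[OF trivial_limit_at_right_real] by blast
  define t where "t h = h powr \<beta> * \<tau>" for h :: real
  \<comment> \<open>These constants depend on the two regularity constants but not on
    \<open>h\<close>, so they can be named before a graph is chosen. This is what makes the limits
    below meaningful.\<close>
  define \<kappa> n0 B min_steps where "\<kappa> = regular_isoradial.kap c\<^sub>p" and "n0 = real (planar_walk.near_steps (c\<^sub>p / 2))"
    and "B = planar_walk.vertex_cost (regular_isoradial.kap c\<^sub>p) (regular_isoradial.cstep c\<^sub>p c\<^sub>d) (c\<^sub>p / 2)"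
    and "min_steps = planar_walk.min_steps (regular_isoradial.kap c\<^sub>p)"
  have \<kappa>: "0 < \<kappa>" using assms(2) regular_isoradial.kap_def[OF loc[of 1]] by (simp add: \<kappa>_def)
  have dt: "planar_walk.dt h (regular_isoradial.kap c\<^sub>p) = h\<^sup>2 / \<kappa>" if "h > 0" for h
  proof -
    interpret I: regular_isoradial h "V h" "E h" c\<^sub>p c\<^sub>d by (rule loc[OF that])
    show ?thesis by (simp add: I.dt_def \<kappa>_def)
  qed
  define y where "y h = R * h / ((1 - 2 * \<epsilon>) * t h)" for h
  \<comment> \<open>Equality in the condition on the hop radius. It tends to 0 because both y and t
    do.\<close>
  define r where "r h = sqrt (54 * (R * y h)\<^sup>2 + 72 * t h)" for h
  define upper where "upper h = R\<^sup>2 * ((1 + 2 * y h) / (1 - 2 * \<epsilon>) - 1) + 2 * R * r h / (1 - 2 * \<epsilon>) + 40 * (r h)\<^sup>2 / \<epsilon> +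
      6002 * (t h * ln (t h / (h\<^sup>2 / \<kappa>))) + 2 * t h * (B + 3) + 2 * (t h * ln (h\<^sup>2))" for h
  define lower where "lower h = R\<^sup>2 * (exp (R * (h / t h)) - 1) - 2 * (t h * ln (c\<^sub>d * c\<^sub>p\<^sup>2 / 4 * h\<^sup>2))" for h
  have t_pos: "0 < t h" if "h > 0" for h using that \<tau> by (simp add: t_def)
  have t0: "(t \<longlongrightarrow> 0) (at_right 0)" unfolding t_def[abs_def] by (rule lim_t[OF \<beta>(1)])
  have ht0: "((\<lambda>h. h / t h) \<longlongrightarrow> 0) (at_right 0)" unfolding t_def by (rule lim_h_t[OF \<beta>(2) \<tau>])
  have "((\<lambda>h. R / (1 - 2 * \<epsilon>) * (h / t h)) \<longlongrightarrow> R / (1 - 2 * \<epsilon>) * 0) (at_right 0)"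
    by (intro tendsto_intros ht0)
  then have y0: "(y \<longlongrightarrow> 0) (at_right 0)" by (simp add: y_def[abs_def])
  have "(r \<longlongrightarrow> sqrt (54 * (R * 0)\<^sup>2 + 72 * 0)) (at_right 0)"
    unfolding r_def[abs_def] by (intro tendsto_intros y0 t0)
  then have r0: "(r \<longlongrightarrow> 0) (at_right 0)" by simp
  have area0: "((\<lambda>h. t h * ln (h\<^sup>2)) \<longlongrightarrow> 0) (at_right 0)"
    unfolding t_def using lim_t_ln_area[OF \<beta>(1), of 1 \<tau>] by simp
  have "(upper \<longlongrightarrow> R\<^sup>2 * ((1 + 2 * 0) / (1 - 2 * \<epsilon>) - 1) + 2 * R * 0 / (1 - 2 * \<epsilon>) + 40 * 0\<^sup>2 / \<epsilon> +
      6002 * 0 + 2 * 0 * (B + 3) + 2 * 0) (at_right 0)"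
    unfolding upper_def[abs_def] using \<epsilon>
    by (intro tendsto_intros y0 r0 t0 lim_t_ln_steps[OF \<beta>(1) \<tau> \<kappa>, folded t_def] area0) auto
  then have upper: "eventually (\<lambda>h. upper h < e / 2) (at_right 0)"
    using \<epsilon>(3) by (intro order_tendstoD(2)) auto
  have "(lower \<longlongrightarrow> R\<^sup>2 * (exp (R * 0) - 1) - 2 * 0) (at_right 0)"
    unfolding lower_def[abs_def] using assms(2,3)
    by (intro tendsto_intros ht0 lim_t_ln_area[where \<tau> = \<tau>, OF \<beta>(1), folded t_def]) auto
  then have lower: "eventually (\<lambda>h. lower h < e / 2) (at_right 0)"
    using e by (intro order_tendstoD(2)) auto
  have X: "eventually (\<lambda>h. c \<le> \<epsilon> * (t h / (h\<^sup>2 / \<kappa>))) (at_right 0)" for c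
  proof -
    have "eventually (\<lambda>h. c / (\<epsilon> * \<kappa>) \<le> t h / h\<^sup>2) (at_right 0)"
      using lim_t_hh[OF \<beta>(2) \<tau>, folded t_def] by (simp add: filterlim_at_top)
    then show ?thesis
      by eventually_elim (use \<epsilon> \<kappa> in \<open>simp add: pos_divide_le_eq mult_ac\<close>)
  qed
  have Rh: "eventually (\<lambda>h. R * (h / t h) < 1 - 2 * \<epsilon>) (at_right 0)"
    using tendsto_mult_right_zero[OF ht0, of R] \<epsilon> by (intro order_tendstoD(2)) auto
  have rh: "eventually (\<lambda>h. r h * (h / t h) < \<epsilon> / 200) (at_right 0)"
    using tendsto_mult_zero[OF r0 ht0] \<epsilon> by (intro order_tendstoD(2)) auto
  have small: "eventually (\<lambda>h. h < min 1 (e / (8 * R))) (at_right 0)"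
    using e R by (intro eventually_less_at_right) auto
  have pos: "eventually (\<lambda>h::real. 0 < h) (at_right 0)" by (rule eventually_at_right_less)
  show "eventually (\<lambda>h. \<forall>x\<in>K. dist ((\<lambda>(x, y). - 2 * (h powr \<beta> * \<tau>) *
      ln (heat_kernel (V h) (E h) (h powr \<beta> * \<tau>) (proj h x) (proj h y))) x)
      ((\<lambda>(x, y). (norm (x - y))\<^sup>2) x) < e) (at_right 0)"
    using upper lower X[of "n0 + 3"] X[of "2 * min_steps"] Rh rh small pos
  proof eventually_elim
    case (elim h)
    interpret I: regular_isoradial h "V h" "E h" c\<^sub>p c\<^sub>d by (rule loc[OF elim(8)])
    have t: "0 < t h" by (rule t_pos[OF elim(8)])
    have "\<bar>- 2 * t h * ln (heat_kernel (V h) (E h) (t h) (proj h x) (proj h z)) - (norm (x - z))\<^sup>2\<bar> < e"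
      if xz: "(x, z) \<in> K" for x z
    proof -
      let ?u = "proj h x" and ?v = "proj h z"
      let ?f = "- 2 * t h * ln (heat_kernel (V h) (E h) (t h) ?u ?v)"
      have uv: "?u \<in> V h" "?v \<in> V h" using assms(6)[OF elim(8)] by (auto simp: closest_vertex_map_def)
      have "dist x ?u \<le> h" "dist z ?v \<le> h" by (rule I.dist_closest_vertex[OF assms(6)[OF elim(8)]])+
      then have diff: "\<bar>dist ?u ?v - norm (x - z)\<bar> \<le> 2 * h"
        using dist_triangle[of ?u ?v x] dist_triangle[of x ?v z] dist_triangle[of x z ?u] dist_triangle[of ?u z ?v]
        by (simp add: dist_norm norm_minus_commute abs_le_iff)
      have D: "dist ?u ?v \<le> R" "norm (x - z) \<le> R"
        using diff M[OF xz] R elim(7) by auto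
      \<comment> \<open>The effect of the projection on the squared distance; the bound e / (8 R) on
        \<open>h\<close> is chosen for it. The other half of \<open>e\<close> is left for
        \<open>upper\<close> and \<open>lower\<close>.\<close>
      have "\<bar>(dist ?u ?v)\<^sup>2 - (norm (x - z))\<^sup>2\<bar> = \<bar>dist ?u ?v - norm (x - z)\<bar> * (dist ?u ?v + norm (x - z))"
        by (simp add: square_diff_square_factored power2_eq_square abs_mult mult.commute)
      also have "\<dots> \<le> 2 * h * (2 * R)" using diff D by (intro mult_mono) auto
      also have "\<dots> < e / 2" using elim(7) R by (simp add: pos_less_divide_eq mult_ac)
      finally have sq: "\<bar>(dist ?u ?v)\<^sup>2 - (norm (x - z))\<^sup>2\<bar> < e / 2" .
      have r_pos: "0 < r h" unfolding r_def using t by (intro real_sqrt_gt_zero add_nonneg_pos) auto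
      have r_sq: "54 * (R * (R * h / ((1 - 2 * \<epsilon>) * t h)))\<^sup>2 + 72 * t h \<le> (r h)\<^sup>2"
        unfolding r_def y_def using t by simp
      have Rh': "R * h \<le> (1 - 2 * \<epsilon>) * t h" using elim(5) t by (simp add: pos_divide_less_eq)
      have rh': "r h * h \<le> \<epsilon> * t h / 200" using elim(6) t by (simp add: pos_divide_less_eq)
      note hyps = uv \<epsilon>(1,2) t D(1) elim(3)[folded dt[OF elim(8)], unfolded n0_def]
        elim(4)[folded dt[OF elim(8)], unfolded min_steps_def] Rh' r_pos r_sq rh'
      have hk: "0 < heat_kernel (V h) (E h) (t h) ?u ?v" by (rule I.log_heat_kernel_le(1)[OF hyps])
      have "?f \<le> (dist ?u ?v)\<^sup>2 + upper h"
        using I.log_heat_kernel_le(2)[OF hyps] unfolding upper_def y_def B_def dt[OF elim(8)] by (simp add: mult.assoc)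
      moreover have "(dist ?u ?v)\<^sup>2 - lower h \<le> ?f"
        using I.log_heat_kernel_ge[OF uv t D(1) hk] unfolding lower_def by (simp add: mult.assoc)
      ultimately show ?thesis using sq elim(1,2) by linarith
    qed
    then show ?case by (auto simp: dist_real_def t_def)
  qed
qed

end
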